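(* Let $B\ge1$ be a fixed integer and $\alpha\in(0,1)$. Consider the nested sampling setting (see context) with original estimate $\hat{\hat\psi}_{n,R_0}$ and resample estimates $\psi_{n,R}^{**1},\ldots,\psi_{n,R}^{**B}$. Assume: (i) for some $\sigma^2>0$, as $n\to\infty$, $\sqrt n(\hat\psi_n-\psi)\Rightarrow N(0,\sigma^2)$, and $\sqrt n(\psi_n^*-\hat\psi_n)\Rightarrow N(0,\sigma^2)$ conditionally on the data in probability; (ii) as $n\to\infty$, $\tau^2(\hat P_n)\stackrel{p}{\to}\tau^2(P)=:\tau^2$, $\kappa_3(\hat P_n)\stackrel{p}{\to}\kappa_3(P)=:\kappa_3$, $\tau^2(P_n^* )\stackrel{p}{\to}\tau^2$ and $\kappa_3(P_n^* )\stackrel{p}{\to}\kappa_3$, where $0<\tau^2<\infty$ and $\kappa_3<\infty$; (iii) $n,R_0,R\to\infty$ with $R_0/n\to p_0$ and $R/n\to p$ for some constants $0<p_0,p<1$. Let $\rho=\sqrt{p_0/p}$, let $$S_O^2=\frac1B\sum_{b=1}^B\left(\psi_{n,R}^{**b}-\hat{\hat\psi}_{n,R_0}\right)^2,\ S_O\ge0,\qquad q_{O,1-\alpha/2}=\min\left\{q:\inf_{\theta\ge0}F(q;\theta,\rho)\ge1-\frac\alpha2\right\},$$ where $F(\cdot;\theta,\rho)$ is the distribution function of $$\frac{\theta V_1+V_2}{\sqrt{\frac{\theta^2+\rho^2}{B}(Y+V_3^2)-2\sqrt{\frac{\theta^2+\rho^2}{B}}\,V_3V_2+V_2^2}}$$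 with $V_1,V_2,V_3\sim N(0,1)$ and $Y\sim\chi^2_{B-1}$ all independent ($Y=0$ if $B=1$). Then the interval $$\mathcal I_O=\left[\hat{\hat\psi}_{n,R_0}-q_{O,1-\alpha/2}S_O,\ \hat{\hat\psi}_{n,R_0}+q_{O,1-\alpha/2}S_O\right]$$ satisfies $\liminf_{n\to\infty}\mathbb P_n(\psi\in\mathcal I_O)\ge1-\alpha$, where $\mathbb P_n$ denotes the probability with respect to the data $X_1,\ldots,X_n$ and all randomness from the resampling and computation.
   Context: Data $X_1,X_2,\ldots$ are i.i.d. from $P$; $\psi(\cdot)$ is a real-valued functional on distributions, $\psi=\psi(P)$; $\hat P_n$ is the empirical distribution of $X_1,\ldots,X_n$. For $b=1,\ldots,B$, independently across $b$ given the data, $P_n^{*b}$ is the empirical distribution of $n$ points drawn independently and uniformly with replacement from $\{X_1,\ldots,X_n\}$; $P_n^*$ denotes a generic one. The (hypothetical, noise-free) estimates are $\hat\psi_n=\psi(\hat P_n)$, $\psi_n^{*b}=\psi(P_n^{*b})$, with generic $\psi_n^*=\psi(P_n^* )$. Noisy computation: for a given distribution $Q$ one can only generate i.i.d. noisy runs $\hat\psi_r(Q)$, $r=1,2,\ldots$, with $E\hat\psi_r(Q)=\psi(Q)$ (unbiased). Set $\tau^2(Q)=\mathrm{Var}(\hat\psi_r(Q))$ and $\kappa_3(Q)=E|\hat\psi_r(Q)-\psi(Q)|^3$ (moments over the computation randomness for fixed $Q$). Define $$\hat{\hat\psi}_{n,R_0}=\frac1{R_0}\sum_{r=1}^{R_0}\hat\psi_r(\hat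 P_n),\qquad \psi_{n,R}^{**b}=\frac1R\sum_{r=1}^R\hat\psi_r(P_n^{*b}),\quad b=1,\ldots,B,$$ where the runs are conditionally independent given the driving distribution, and the computation randomness used for the original estimate and for the different resample estimates is independent (given $\hat P_n,P_n^{*1},\ldots,P_n^{*B}$, all runs are independent, each depending only on its own driving distribution). "$\Rightarrow$" is convergence in distribution; "$\sqrt n(\psi_n^*-\hat\psi_n)\Rightarrow N(0,\sigma^2)$ conditionally on the data in probability" means $P(\sqrt n(\psi_n^*-\hat\psi_n)\le x\mid\hat P_n)\stackrel{p}{\to}P(N(0,\sigma^2)\le x)$ for every $x\in\mathbb R$. *)

theory Defs
  imports "HOL-Probability.Probability"
begin

text \<open>
  Convergence in probability to a constant, with possibly different probability spaces \<open>M n\<close>.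
  Neighbourhoods are used instead of distances because noise moments take values in \<^typ>\<open>ennreal\<close>;
  for real random variables this is the usual notion (lemma \<open>conv_in_prob_real_iff\<close>).
  Only meaningful for measurable \<open>X n\<close>.
\<close>
definition conv_in_prob ::
  "(nat \<Rightarrow> 'a measure) \<Rightarrow> (nat \<Rightarrow> 'a \<Rightarrow> 'b::topological_space) \<Rightarrow> 'b \<Rightarrow> bool" where
  "conv_in_prob M X c \<longleftrightarrow>
     (\<forall>U. open U \<and> c \<in> U \<longrightarrow> (\<lambda>n. \<P>(\<omega> in M n. X n \<omega> \<notin> U)) \<longlonglongrightarrow> 0)"

lemma conv_in_prob_real_iff:
  fixes X :: "nat \<Rightarrow> 'a \<Rightarrow> real"
  assumes "\<And>n. finite_measure (M n)" and [measurable]: "\<And>n. X n \<in> borel_measurable (M n)"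
  shows "conv_in_prob M X c \<longleftrightarrow>
    (\<forall>e>0. (\<lambda>n. \<P>(\<omega> in M n. \<bar>X n \<omega> - c\<bar> > e)) \<longlonglongrightarrow> 0)" (is "_ \<longleftrightarrow> ?R")
proof
  assume L: "conv_in_prob M X c"
  show ?R
  proof (intro allI impI)
    fix e :: real assume "e > 0"
    then have z: "(\<lambda>n. \<P>(\<omega> in M n. X n \<omega> \<notin> ball c e)) \<longlonglongrightarrow> 0"
      by (intro L[unfolded conv_in_prob_def, rule_format]) simp
    have le: "\<P>(\<omega> in M n. \<bar>X n \<omega> - c\<bar> > e) \<le> \<P>(\<omega> in M n. X n \<omega> \<notin> ball c e)" for n
    proof (rule finite_measure.finite_measure_mono[OF assms(1)])
      show "{\<omega> \<in> space (M n). \<bar>X n \<omega> - c\<bar> > e} \<subseteq> {\<omega> \<in> space (M n). X n \<omega> \<notin> ball c e}"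
        by (auto simp: dist_real_def)
      have [measurable]: "ball c e \<in> sets borel" by simp
      show "{\<omega> \<in> space (M n). X n \<omega> \<notin> ball c e} \<in> sets (M n)"
        by measurable
    qed
    show "(\<lambda>n. \<P>(\<omega> in M n. \<bar>X n \<omega> - c\<bar> > e)) \<longlonglongrightarrow> 0"
      by (rule tendsto_sandwich[OF always_eventually always_eventually tendsto_const z])
         (simp, intro allI le)
  qed
next
  assume R: ?R
  show "conv_in_prob M X c"
    unfolding conv_in_prob_def
  proof (intro allI impI)
    fix U :: "real set" assume U: "open U \<and> c \<in> U"
    then obtain e where e: "e > 0" "cball c e \<subseteq> U"
      using open_contains_cball by blast
    have z: "(\<lambda>n. \<P>(\<omega> in M n. \<bar>X n \<omega> - c\<bar> > e)) \<longlonglongrightarrow> 0"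
      by (intro R[rule_format] e(1))
    have le: "\<P>(\<omega> in M n. X n \<omega> \<notin> U) \<le> \<P>(\<omega> in M n. \<bar>X n \<omega> - c\<bar> > e)" for n
    proof (rule finite_measure.finite_measure_mono[OF assms(1)])
      have "\<bar>X n \<omega> - c\<bar> > e" if "X n \<omega> \<notin> U" for \<omega>
      proof -
        have "X n \<omega> \<notin> cball c e" using that e(2) by blast
        then show ?thesis by (simp add: dist_real_def)
      qed
      then show "{\<omega> \<in> space (M n). X n \<omega> \<notin> U} \<subseteq> {\<omega> \<in> space (M n). \<bar>X n \<omega> - c\<bar> > e}"
        by blast
      show "{\<omega> \<in> space (M n). \<bar>X n \<omega> - c\<bar> > e} \<in> sets (M n)"
        by measurable
    qed
    show "(\<lambda>n. \<P>(\<omega> in M n. X n \<omega> \<notin> U)) \<longlonglongrightarrow> 0"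
      by (rule tendsto_sandwich[OF always_eventually always_eventually tendsto_const z])
         (simp, intro allI le)
  qed
qed

definition normal_dist :: "real \<Rightarrow> real measure" where
  "normal_dist \<sigma> = density lborel (normal_density 0 \<sigma>)"

text \<open>For \<open>k = 0\<close> this is the point mass at \<open>0\<close>.\<close>
definition chi_square :: "nat \<Rightarrow> real measure" where
  "chi_square k =
     distr (\<Pi>\<^sub>M i\<in>{..<k}. std_normal_distribution) borel (\<lambda>z. \<Sum>i<k. (z i)\<^sup>2)"

lemma chi_square_0: "chi_square 0 = return borel 0"
proof -
  have "chi_square 0 = distr (count_space {\<lambda>_ :: nat. undefined :: real}) borel (\<lambda>_. 0 :: real)"
    by (simp add: chi_square_def PiM_empty)
  also have "\<dots> = return borel 0"
  proof (rule prob_space.distr_const)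
    show "prob_space (count_space {\<lambda>_ :: nat. undefined :: real})"
      by (rule prob_spaceI) (simp add: emeasure_count_space)
  qed simp
  finally show ?thesis .
qed

text \<open>
  Distributions live on the sigma-algebra of the measure \<open>S\<close>. The coordinates \<open>x 0, ..., x (n - 1)\<close>
  are the \<open>n\<close> points.
\<close>
definition empirical :: "'a measure \<Rightarrow> nat \<Rightarrow> (nat \<Rightarrow> 'a) \<Rightarrow> 'a measure" where
  "empirical S n x = distr (uniform_count_measure {..<n}) S x"

lemma measure_empirical:
  assumes "n \<ge> 1" "x \<in> {..<n} \<rightarrow> space S" "A \<in> sets S"
  shows "measure (empirical S n x) A = real (card {i. i < n \<and> x i \<in> A}) / real n"
proof -
  have m: "x \<in> measurable (uniform_count_measure {..<n}) S"
    using assms(2) by (auto simp: measurable_def space_uniform_count_measure sets_uniform_count_measure)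
  have "measure (empirical S n x) A = measure (uniform_count_measure {..<n}) (x -` A \<inter> {..<n})"
    unfolding empirical_def
    by (subst measure_distr[OF m assms(3)]) (simp add: space_uniform_count_measure)
  also have "\<dots> = real (card (x -` A \<inter> {..<n})) / real n"
    by (subst measure_uniform_count_measure) auto
  also have "x -` A \<inter> {..<n} = {i. i < n \<and> x i \<in> A}" by auto
  finally show ?thesis .
qed

definition data_law :: "'a measure \<Rightarrow> nat \<Rightarrow> (nat \<Rightarrow> 'a) measure" where
  "data_law P n = (\<Pi>\<^sub>M i\<in>{..<n}. P)"

text \<open>
  Resampling draws \<open>n\<close> independent uniform indices \<open>j\<close>, independently of the data \<open>x\<close>; the resample is
  \<open>x (j 0), ..., x (j (n - 1))\<close>. Hence, for fixed \<open>x\<close>, \<open>index_law n\<close>-probabilities are conditional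
  probabilities given the data.
\<close>
definition index_law :: "nat \<Rightarrow> (nat \<Rightarrow> nat) measure" where
  "index_law n = (\<Pi>\<^sub>M i\<in>{..<n}. uniform_count_measure {..<n})"

definition resample_empirical ::
  "'a measure \<Rightarrow> nat \<Rightarrow> (nat \<Rightarrow> 'a) \<Rightarrow> (nat \<Rightarrow> nat) \<Rightarrow> 'a measure" where
  "resample_empirical S n x j = empirical S n (\<lambda>i. x (j i))"

text \<open>
  \<open>run Q\<close> is the law of a single noisy run for the distribution \<open>Q\<close>. Its variance and its absolute
  third moment about \<open>\<psi> Q\<close> may be infinite.
\<close>
definition noise_var :: "('a measure \<Rightarrow> real measure) \<Rightarrow> 'a measure \<Rightarrow> ennreal" where
  "noise_var run Q = (\<integral>\<^sup>+ y. ennreal ((y - (\<integral>z. z \<partial>run Q))\<^sup>2) \<partial>run Q)"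

definition noise_abs3 ::
  "('a measure \<Rightarrow> real) \<Rightarrow> ('a measure \<Rightarrow> real measure) \<Rightarrow> 'a measure \<Rightarrow> ennreal" where
  "noise_abs3 \<psi> run Q = (\<integral>\<^sup>+ y. ennreal (\<bar>y - \<psi> Q\<bar> ^ 3) \<partial>run Q)"

text \<open>
  Conditional law of all runs \<open>(u, v)\<close> given the data \<open>x\<close> and the resampling indices \<open>j b\<close>:
  \<open>u r\<close> is a run for the empirical distribution, \<open>v b r\<close> a run for the \<open>b\<close>-th resample.
\<close>
definition runs_law ::
  "'a measure \<Rightarrow> ('a measure \<Rightarrow> real measure) \<Rightarrow> nat \<Rightarrow> nat \<Rightarrow> nat \<Rightarrow> nat
    \<Rightarrow> (nat \<Rightarrow> 'a) \<Rightarrow> (nat \<Rightarrow> nat \<Rightarrow> nat) \<Rightarrow> ((nat \<Rightarrow> real) \<times> (nat \<Rightarrow> nat \<Rightarrow> real)) measure" where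
  "runs_law S run n B R0 R x j =
     (\<Pi>\<^sub>M r\<in>{..<R0}. run (empirical S n x)) \<Otimes>\<^sub>M
     (\<Pi>\<^sub>M b\<in>{..<B}. \<Pi>\<^sub>M r\<in>{..<R}. run (resample_empirical S n x (j b)))"

definition nested_law ::
  "'a measure \<Rightarrow> ('a measure \<Rightarrow> real measure) \<Rightarrow> nat \<Rightarrow> nat \<Rightarrow> nat \<Rightarrow> nat
    \<Rightarrow> ((nat \<Rightarrow> real) \<times> (nat \<Rightarrow> nat \<Rightarrow> real)) measure" where
  "nested_law P run n B R0 R =
     (data_law P n \<Otimes>\<^sub>M (\<Pi>\<^sub>M b\<in>{..<B}. index_law n)) \<bind>
       (\<lambda>(x, j). runs_law P run n B R0 R x j)"

definition run_mean :: "nat \<Rightarrow> (nat \<Rightarrow> real) \<Rightarrow> real" where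
  "run_mean m u = (1 / real m) * (\<Sum>r<m. u r)"

definition S_O ::
  "nat \<Rightarrow> nat \<Rightarrow> nat \<Rightarrow> (nat \<Rightarrow> real) \<times> (nat \<Rightarrow> nat \<Rightarrow> real) \<Rightarrow> real" where
  "S_O B R0 R = (\<lambda>(u, v).
     sqrt ((1 / real B) * (\<Sum>b<B. (run_mean R (v b) - run_mean R0 u)\<^sup>2)))"

definition limit_stat ::
  "nat \<Rightarrow> real \<Rightarrow> real \<Rightarrow> real \<times> real \<times> real \<times> real \<Rightarrow> real" where
  "limit_stat B \<theta> \<rho> = (\<lambda>(v1, v2, v3, y).
     (\<theta> * v1 + v2) /
     sqrt ((\<theta>\<^sup>2 + \<rho>\<^sup>2) / real B * (y + v3\<^sup>2)
           - 2 * sqrt ((\<theta>\<^sup>2 + \<rho>\<^sup>2) / real B) * v3 * v2 + v2\<^sup>2))"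

definition F_O :: "nat \<Rightarrow> real \<Rightarrow> real \<Rightarrow> real \<Rightarrow> real" where
  "F_O B q \<theta> \<rho> =
     cdf (distr (std_normal_distribution \<Otimes>\<^sub>M std_normal_distribution \<Otimes>\<^sub>M
                 std_normal_distribution \<Otimes>\<^sub>M chi_square (B - 1))
            borel (limit_stat B \<theta> \<rho>)) q"

definition q_O :: "nat \<Rightarrow> real \<Rightarrow> real \<Rightarrow> real" where
  "q_O B \<rho> \<beta> = (LEAST q. (INF \<theta>\<in>{0..}. F_O B q \<theta> \<rho>) \<ge> \<beta>)"

definition I_O ::
  "nat \<Rightarrow> nat \<Rightarrow> nat \<Rightarrow> real \<Rightarrow> (nat \<Rightarrow> real) \<times> (nat \<Rightarrow> nat \<Rightarrow> real) \<Rightarrow> real set" where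
  "I_O B R0 R q w =
     {run_mean R0 (fst w) - q * S_O B R0 R w .. run_mean R0 (fst w) + q * S_O B R0 R w}"

end

theory Submission
  imports Defs
begin

text \<open>
  Given the data, the original estimate and the \<open>B\<close> resample estimates are independent, so after centring
  at \<open>\<psi>\<close> of the empirical distribution and scaling by \<open>sqrt n\<close> their conditional joint law is a product
  measure. Its factors are replaced one at a time by centred normal laws. The error is measured with
  \<open>[0,1]\<close>-valued Lipschitz test functions: this class is stable under integrating out the other
  coordinates, and a bound uniform over it controls every replacement. For the noise the bound comes from
  a central limit theorem that is uniform over laws with almost the right variance and a bounded third
  moment; for the resampling it comes from closeness of distribution functions at finitely many points.
  Both apply with conditional probability close to one.

  The coverage indicator is bounded below by a Lipschitz function of all coordinates. In the Gaussian limit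
  coverage is the event \<open>\<bar>T\<bar> \<le> q\<close>, where \<open>T\<close> has the law of the limit statistic for
  \<open>\<theta> = \<sigma> sqrt p0 / \<tau>\<close>, by the independence of sample mean and sample variance. Since \<open>T\<close> is symmetric,
  this event has probability at least \<open>2 F(q; \<theta>, \<rho>) - 1 \<ge> 1 - \<alpha>\<close>.
\<close>

text \<open>The order of choices matters. \<open>q\<close> is a constant, and the slope
  \<open>k\<close> of the Lipschitz minorant is fixed from the Gaussian limit before
  \<open>n\<close> grows, so one Lipschitz constant serves all test functions for all
  \<open>n\<close>. The hypotheses control the conditional laws only in probability, so a limit
  theorem cannot be applied along a fixed data sequence. Each one is therefore first turned into a
  quantitative implication for a single law (near moments, or distribution functions close at
  finitely many points, give close integrals), obtained by contradiction from its sequential form.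
  In the limit the scaled data error is \<sigma> v1, the noise of the original estimate is \<eta> v2
  with \<eta>^2 = \<tau>^2 / p0, and the deviation of the b-th resample estimate is s G_b with s^2 =
  \<sigma>^2 + \<tau>^2 / p. Dividing by \<eta> gives s^2 / \<eta>^2 = \<theta>^2 + \<rho>^2: this
  is the origin of \<rho> = sqrt (p0 / p). The value \<theta> depends on the unknown \<sigma> and
  \<tau>, hence the infimum in the critical value.\<close>

abbreviation std_normal :: "real measure" where
  "std_normal \<equiv> std_normal_distribution"

section \<open>Lipschitz test functions and weak convergence\<close>

text \<open>The range [0,1] keeps any two integrals within distance 1, which is the price paid on
  exceptional data; the constant \<open>L\<close> is explicit because all closeness bounds are
  uniform over the class for one fixed \<open>L\<close>.\<close>

definition lip01 :: "real \<Rightarrow> (real \<Rightarrow> real) \<Rightarrow> bool" where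
  "lip01 L g \<longleftrightarrow> (\<forall>x. 0 \<le> g x \<and> g x \<le> 1) \<and> (\<forall>x y. \<bar>g x - g y\<bar> \<le> L * \<bar>x - y\<bar>)"

lemma lip01_continuous_on:
  assumes "lip01 L g" shows "continuous_on UNIV g"
proof -
  have "\<bar>L\<bar>-lipschitz_on UNIV g"
  proof (rule lipschitz_onI)
    fix x y
    have "\<bar>g x - g y\<bar> \<le> L * \<bar>x - y\<bar>" using assms by (auto simp: lip01_def)
    also have "\<dots> \<le> \<bar>L\<bar> * \<bar>x - y\<bar>" by (intro mult_right_mono) auto
    finally show "dist (g x) (g y) \<le> \<bar>L\<bar> * dist x y" by (simp add: dist_real_def)
  qed simp
  then show ?thesis by (rule lipschitz_on_continuous_on)
qed

lemma lip01_measurable: "lip01 L g \<Longrightarrow> g \<in> borel_measurable borel"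
  by (intro borel_measurable_continuous_onI lip01_continuous_on)

lemma lip01_bounds: "lip01 L g \<Longrightarrow> 0 \<le> g x" "lip01 L g \<Longrightarrow> g x \<le> 1" "lip01 L g \<Longrightarrow> \<bar>g x\<bar> \<le> 1"
  by (auto simp: lip01_def)

lemma (in prob_space) integrable_01:
  fixes f :: "'a \<Rightarrow> real"
  assumes "f \<in> borel_measurable M" "\<And>x. 0 \<le> f x" "\<And>x. f x \<le> 1"
  shows "integrable M f"
  by (rule integrable_const_bound[where B=1]) (use assms in auto)

lemma (in prob_space) integral_01:
  fixes f :: "'a \<Rightarrow> real"
  assumes "f \<in> borel_measurable M" "\<And>x. 0 \<le> f x" "\<And>x. f x \<le> 1"
  shows "0 \<le> integral\<^sup>L M f" "integral\<^sup>L M f \<le> 1"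
proof -
  show "0 \<le> integral\<^sup>L M f" using assms by (intro integral_nonneg_AE) auto
  have "integral\<^sup>L M f \<le> (\<integral>x. 1 \<partial>M)"
    by (intro integral_mono integrable_01 assms) auto
  then show "integral\<^sup>L M f \<le> 1" by (simp add: prob_space)
qed

text \<open>Skorohod's coupling gives uniformity in \<open>g\<close>: on one space
  \<open>Ys n\<close> tends to \<open>Y\<close> pointwise, and
  \<open>\<bar>g (Ys n x) - g (Y x)\<bar>\<close> is at most
  \<open>min 1 \<bar>L * (Ys n x - Y x)\<bar>\<close>, which no longer mentions \<open>g\<close>.
  Dominated convergence then bounds all \<open>g\<close> at once.\<close>

lemma weak_conv_imp_lip01_close:
  assumes M: "\<And>n. real_distribution (M n)" and N: "real_distribution N"
    and conv: "weak_conv_m M N" and e: "e > 0"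
  shows "\<forall>\<^sub>F n in sequentially. \<forall>g. lip01 L g \<longrightarrow> \<bar>integral\<^sup>L (M n) g - integral\<^sup>L N g\<bar> \<le> e"
proof -
  obtain \<Omega> :: "real measure" and Ys Y where
    ps: "prob_space \<Omega>" and Ys[measurable]: "\<And>n. Ys n \<in> borel_measurable \<Omega>"
    and dYs: "\<And>n. distr \<Omega> borel (Ys n) = M n"
    and Y[measurable]: "Y \<in> borel_measurable \<Omega>" and dY: "distr \<Omega> borel Y = N"
    and lim: "\<And>x. x \<in> space \<Omega> \<Longrightarrow> (\<lambda>n. Ys n x) \<longlonglongrightarrow> Y x"
    using Skorohod[OF M N conv] by force
  interpret prob_space \<Omega> by (rule ps)
  let ?h = "\<lambda>n x. min 1 \<bar>L * (Ys n x - Y x)\<bar>"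
  have "(\<lambda>n. \<integral>x. ?h n x \<partial>\<Omega>) \<longlonglongrightarrow> (\<integral>x. 0 \<partial>\<Omega>)"
  proof (rule integral_dominated_convergence[where w="\<lambda>_. 1"])
    show "AE x in \<Omega>. (\<lambda>n. ?h n x) \<longlonglongrightarrow> 0"
    proof (rule AE_I2)
      fix x assume "x \<in> space \<Omega>"
      then have "(\<lambda>n. min 1 \<bar>L * (Ys n x - Y x)\<bar>) \<longlonglongrightarrow> min 1 \<bar>L * (Y x - Y x)\<bar>"
        by (intro tendsto_intros lim)
      then show "(\<lambda>n. ?h n x) \<longlonglongrightarrow> 0" by simp
    qed
  qed auto
  then have "\<forall>\<^sub>F n in sequentially. (\<integral>x. ?h n x \<partial>\<Omega>) < e"
    using e by (intro order_tendstoD(2)[where y=0]) auto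
  then show ?thesis
  proof eventually_elim
    case (elim n)
    show ?case
    proof (intro allI impI)
      fix g assume g: "lip01 L g"
      note [measurable] = lip01_measurable[OF g]
      have int: "integrable \<Omega> (\<lambda>x. g (Ys n x))" "integrable \<Omega> (\<lambda>x. g (Y x))"
        by (auto intro!: integrable_01 lip01_bounds[OF g])
      have "integral\<^sup>L (M n) g - integral\<^sup>L N g = (\<integral>x. g (Ys n x) - g (Y x) \<partial>\<Omega>)"
        unfolding dYs[symmetric] dY[symmetric] by (subst (1 2) integral_distr) (auto simp: int)
      also have "\<bar>\<dots>\<bar> \<le> (\<integral>x. \<bar>g (Ys n x) - g (Y x)\<bar> \<partial>\<Omega>)" by (rule integral_abs_bound)
      also have "\<dots> \<le> (\<integral>x. ?h n x \<partial>\<Omega>)"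
      proof (rule integral_mono)
        show "integrable \<Omega> (\<lambda>x. \<bar>g (Ys n x) - g (Y x)\<bar>)" using int by auto
        show "integrable \<Omega> (?h n)" by (rule integrable_01) auto
        fix x
        have "\<bar>g (Ys n x) - g (Y x)\<bar> \<le> L * \<bar>Ys n x - Y x\<bar>" using g by (auto simp: lip01_def)
        also have "\<dots> \<le> \<bar>L * (Ys n x - Y x)\<bar>" by (simp add: abs_mult mult_right_mono)
        finally show "\<bar>g (Ys n x) - g (Y x)\<bar> \<le> ?h n x"
          using lip01_bounds[OF g, of "Ys n x"] lip01_bounds[OF g, of "Y x"] by auto
      qed
      finally show "\<bar>integral\<^sup>L (M n) g - integral\<^sup>L N g\<bar> \<le> e" using elim by simp
    qed
  qed
qed

text \<open>The bootstrap hypothesis controls the conditional distribution function at one point at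
  a time; since finitely many points suffice here, a single exceptional event of small probability
  is enough. Otherwise there would be counterexamples \<open>M k\<close> whose distribution
  functions approach that of \<open>N\<close> at every rational, hence weakly, against the preceding
  lemma.\<close>

lemma cdf_close_imp_lip01_close:
  assumes N: "real_distribution N" and cont: "\<And>x. isCont (cdf N) x" and e: "e > 0"
  shows "\<exists>\<delta>>0. \<exists>T. finite T \<and> (\<forall>M g. real_distribution M \<longrightarrow>
    (\<forall>t\<in>T. \<bar>cdf M t - cdf N t\<bar> < \<delta>) \<longrightarrow> lip01 L g \<longrightarrow> \<bar>integral\<^sup>L M g - integral\<^sup>L N g\<bar> \<le> e)"
proof (rule ccontr)
  assume neg: "\<not> ?thesis"
  let ?r = "\<lambda>i. real_of_rat (from_nat i)"
  have "\<forall>k. \<exists>M g. real_distribution M \<and> (\<forall>t\<in>?r ` {..k::nat}. \<bar>cdf M t - cdf N t\<bar> < 1 / real (Suc k)) \<and>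
      lip01 L g \<and> \<not> \<bar>integral\<^sup>L M g - integral\<^sup>L N g\<bar> \<le> e"
  proof
    fix k :: nat
    have "finite (?r ` {..k})" "1 / real (Suc k) > 0" by auto
    then show "\<exists>M g. real_distribution M \<and> (\<forall>t\<in>?r ` {..k::nat}. \<bar>cdf M t - cdf N t\<bar> < 1 / real (Suc k)) \<and>
      lip01 L g \<and> \<not> \<bar>integral\<^sup>L M g - integral\<^sup>L N g\<bar> \<le> e"
      using neg by blast
  qed
  then obtain M g where M: "\<And>k. real_distribution (M k)"
    and cl: "\<And>k t. t \<in> ?r ` {..k} \<Longrightarrow> \<bar>cdf (M k) t - cdf N t\<bar> < 1 / real (Suc k)"
    and g: "\<And>k. lip01 L (g k)" and ng: "\<And>k. \<not> \<bar>integral\<^sup>L (M k) (g k) - integral\<^sup>L N (g k)\<bar> \<le> e"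
    by metis
  have rat: "(\<lambda>k. cdf (M k) (?r i)) \<longlonglongrightarrow> cdf N (?r i)" for i
  proof (rule LIM_zero_cancel, rule Lim_null_comparison)
    show "\<forall>\<^sub>F k in sequentially. norm (cdf (M k) (?r i) - cdf N (?r i)) \<le> 1 / real (Suc k)"
      using eventually_ge_at_top[of i]
      by eventually_elim (use cl in \<open>auto intro!: less_imp_le\<close>)
    show "(\<lambda>k. 1 / real (Suc k)) \<longlonglongrightarrow> 0" by (rule LIMSEQ_Suc, rule lim_1_over_n)
  qed
  have "weak_conv_m M N"
    unfolding weak_conv_m_def weak_conv_def
  proof (intro allI impI)
    fix x
    \<comment> \<open>Limits at the rationals extend to every \<open>x\<close>: monotonicity
      compares \<open>cdf (M k) x\<close> with its value at a rational on either side, and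
      continuity of \<open>cdf N\<close> keeps the limit at that rational on the required side of
      \<open>a\<close>.\<close>
    have rr: "\<exists>i. x < y \<longrightarrow> x < ?r i \<and> ?r i < y" for x y
      using of_rat_dense[of x y] by (metis surj_from_nat surj_def)
    interpret N: real_distribution N by (rule N)
    show "(\<lambda>k. cdf (M k) x) \<longlonglongrightarrow> cdf N x"
    proof (rule order_tendstoI)
      fix a assume a: "a < cdf N x"
      have "\<forall>\<^sub>F y in at_left x. cdf N y > a"
        using cont[of x] a by (intro order_tendstoD(1)) (auto simp: isCont_def filterlim_at_split)
      then obtain y where y: "y < x" "\<And>z. y < z \<Longrightarrow> z < x \<Longrightarrow> cdf N z > a"
        by (auto simp: eventually_at_left_field)
      obtain i where i: "y < ?r i" "?r i < x" using rr[of y x] y by auto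
      show "\<forall>\<^sub>F k in sequentially. a < cdf (M k) x"
        using order_tendstoD(1)[OF rat y(2)[OF i]]
      proof eventually_elim
        case (elim k)
        interpret Mk: real_distribution "M k" by (rule M)
        show ?case using elim Mk.cdf_nondecreasing[of "?r i" x] i by simp
      qed
    next
      fix a assume a: "cdf N x < a"
      have "\<forall>\<^sub>F y in at_right x. cdf N y < a"
        using cont[of x] a by (intro order_tendstoD(2)) (auto simp: isCont_def filterlim_at_split)
      then obtain y where y: "x < y" "\<And>z. x < z \<Longrightarrow> z < y \<Longrightarrow> cdf N z < a"
        by (auto simp: eventually_at_right_field)
      obtain i where i: "x < ?r i" "?r i < y" using rr[of x y] y by auto
      show "\<forall>\<^sub>F k in sequentially. cdf (M k) x < a"
        using order_tendstoD(2)[OF rat y(2)[OF i]]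
      proof eventually_elim
        case (elim k)
        interpret Mk: real_distribution "M k" by (rule M)
        show ?case using elim Mk.cdf_nondecreasing[of x "?r i"] i by simp
      qed
    qed
  qed
  from weak_conv_imp_lip01_close[OF M N this e, of L]
  obtain k where "\<bar>integral\<^sup>L (M k) (g k) - integral\<^sup>L N (g k)\<bar> \<le> e"
    using g by (auto simp: eventually_sequentially)
  with ng show False by blast
qed

section \<open>A central limit theorem uniform in the law\<close>

lemma run_mean_measurable [measurable]: "run_mean R \<in> borel_measurable (\<Pi>\<^sub>M r\<in>{..<R}. borel)"
  unfolding run_mean_def by measurable

lemma char_centered_run_mean:
  assumes Q: "real_distribution Q" and R: "R > 0"
  shows "char (distr (\<Pi>\<^sub>M r\<in>{..<R}. Q) borel (\<lambda>u. c * (run_mean R u - m))) t =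
    char (distr Q borel (\<lambda>y. y - m)) (c * t / real R) ^ R"
proof -
  interpret Q: real_distribution Q by (rule Q)
  interpret P: product_sigma_finite "\<lambda>_ :: nat. Q"
    by standard
  interpret pp: prob_space "\<Pi>\<^sub>M r\<in>{..<R}. Q" by (rule prob_space_PiM) (rule Q.prob_space_axioms)
  have [measurable_cong]: "sets Q = sets borel" by simp
  have "char (distr (\<Pi>\<^sub>M r\<in>{..<R}. Q) borel (\<lambda>u. c * (run_mean R u - m))) t =
      (\<integral>u. iexp (t * (c * (run_mean R u - m))) \<partial>(\<Pi>\<^sub>M r\<in>{..<R}. Q))"
    unfolding char_def by (subst integral_distr) auto
  also have "\<dots> = (\<integral>u. (\<Prod>r<R. iexp (c * t / real R * (u r - m))) \<partial>(\<Pi>\<^sub>M r\<in>{..<R}. Q))"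
  proof (intro Bochner_Integration.integral_cong refl)
    fix u :: "nat \<Rightarrow> real"
    have "t * (c * (run_mean R u - m)) = (\<Sum>r<R. c * t / real R * (u r - m))"
      using R unfolding sum_distrib_left[symmetric] sum_subtractf run_mean_def
      by (simp add: field_simps)
    then show "iexp (t * (c * (run_mean R u - m))) = (\<Prod>r<R. iexp (c * t / real R * (u r - m)))"
      by (simp add: exp_sum sum_distrib_left)
  qed
  also have "\<dots> = (\<Prod>r<R. \<integral>y. iexp (c * t / real R * (y - m)) \<partial>Q)"
    by (intro P.product_integral_prod Q.integrable_iexp) auto
  also have "\<dots> = char (distr Q borel (\<lambda>y. y - m)) (c * t / real R) ^ R"
    unfolding char_def by (subst integral_distr) auto
  finally show ?thesis .
qed

text \<open>Quadratic remainder used to pass from the Taylor polynomial 1 - h^2 w / 2 of a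
  characteristic function to the Gaussian factor.\<close>

lemma abs_exp_minus_le:
  fixes y :: real assumes "y \<ge> 0" shows "\<bar>exp (- y) - (1 - y)\<bar> \<le> y\<^sup>2"
proof -
  have "1 - y \<le> exp (- y)" using exp_ge_add_one_self[of "-y"] by simp
  moreover have "exp (- y) \<le> 1 - y + y\<^sup>2"
  proof -
    have "exp (- y) \<le> 1 / (1 + y)"
      using exp_ge_add_one_self[of y] assms by (simp add: exp_minus inverse_eq_divide frac_le)
    also have "1 / (1 + y) \<le> 1 - y + y\<^sup>2"
    proof -
      \<comment> \<open>The right-hand side equals 1 + y^3.\<close>
      have "1 \<le> (1 + y) * (1 - y + y\<^sup>2)"
        using assms by (simp add: algebra_simps power2_eq_square)
      then show ?thesis using assms by (simp add: divide_le_eq mult.commute)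
    qed
    finally show ?thesis .
  qed
  ultimately show ?thesis by auto
qed

text \<open>Both bases have modulus at most 1, so their \<open>R\<close>-th powers differ by at most
  \<open>R\<close> times the difference of the bases; that difference is a third-moment Taylor
  remainder plus the quadratic remainder of the exponential. The bound depends on \<open>Q\<close>
  only through \<open>w\<close> and \<open>K\<close>, which is what makes the limit theorem
  uniform.\<close>

lemma char_power_gaussian_bound:
  assumes Q: "real_distribution Q" and int: "integrable Q (\<lambda>y. y)" "integral\<^sup>L Q (\<lambda>y. y) = m"
    and int2: "integrable Q (\<lambda>y. (y - m)\<^sup>2)" "(\<integral>y. (y - m)\<^sup>2 \<partial>Q) = w"
    and int3: "integrable Q (\<lambda>y. \<bar>y - m\<bar> ^ 3)" "(\<integral>y. \<bar>y - m\<bar> ^ 3 \<partial>Q) \<le> K"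
  shows "cmod (char (distr Q borel (\<lambda>y. y - m)) h ^ R - complex_of_real (exp (- (real R * h\<^sup>2 * w / 2))))
    \<le> real R * h\<^sup>2 * (\<bar>h\<bar> * K / 6 + w\<^sup>2 * h\<^sup>2 / 4)"
proof -
  interpret Q: real_distribution Q by (rule Q)
  have w0: "0 \<le> w" unfolding int2(2)[symmetric] by (intro integral_nonneg_AE) auto
  interpret D: real_distribution "distr Q borel (\<lambda>y. y - m)"
    by (rule Q.real_distribution_distr) simp
  let ?\<phi> = "char (distr Q borel (\<lambda>y. y - m)) h"
  have "cmod (?\<phi> - complex_of_real (1 - h\<^sup>2 * w / 2)) \<le> (h\<^sup>2 / 6) * (\<integral>x. min (6 * (x - m)\<^sup>2) (\<bar>h\<bar> * \<bar>x - m\<bar>^3) \<partial>Q)"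
  proof (rule Q.char_approx3'[OF _ _ int2(1)])
    show E0: "Q.expectation (\<lambda>y. y - m) = 0"
      using int Q.prob_space by (subst Bochner_Integration.integral_diff) auto
    show "Q.variance (\<lambda>y. y - m) = w" unfolding E0 using int2(2) by simp
    show "integrable Q (\<lambda>y. y - m)" using int(1) by (intro Bochner_Integration.integrable_diff Q.integrable_const)
  qed auto
  also have "(\<integral>x. min (6 * (x - m)\<^sup>2) (\<bar>h\<bar> * \<bar>x - m\<bar>^3) \<partial>Q) \<le> (\<integral>x. \<bar>h\<bar> * \<bar>x - m\<bar>^3 \<partial>Q)"
    by (intro integral_mono integrable_min integrable_mult_right int2 int3) auto
  also have "\<dots> = \<bar>h\<bar> * (\<integral>x. \<bar>x - m\<bar>^3 \<partial>Q)" by simp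
  also have "\<dots> \<le> \<bar>h\<bar> * K" by (intro mult_left_mono int3) auto
  finally have 1: "cmod (?\<phi> - complex_of_real (1 - h\<^sup>2 * w / 2)) \<le> h\<^sup>2 / 6 * (\<bar>h\<bar> * K)"
    by (simp add: mult_left_mono)
  have "cmod (complex_of_real (1 - h\<^sup>2 * w / 2) - complex_of_real (exp (- (h\<^sup>2 * w / 2)))) =
      \<bar>exp (- (h\<^sup>2 * w / 2)) - (1 - h\<^sup>2 * w / 2)\<bar>"
    unfolding of_real_diff[symmetric] norm_of_real by (rule abs_minus_commute)
  also have "\<dots> \<le> (h\<^sup>2 * w / 2)\<^sup>2" using w0 by (intro abs_exp_minus_le) auto
  finally have 2: "cmod (complex_of_real (1 - h\<^sup>2 * w / 2) - complex_of_real (exp (- (h\<^sup>2 * w / 2)))) \<le> (h\<^sup>2 * w / 2)\<^sup>2" .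
  have 3: "cmod (?\<phi> - complex_of_real (exp (- (h\<^sup>2 * w / 2)))) \<le> h\<^sup>2 / 6 * (\<bar>h\<bar> * K) + (h\<^sup>2 * w / 2)\<^sup>2"
    using norm_triangle_le[OF add_mono[OF 1 2]] by simp
  have "exp (- (real R * h\<^sup>2 * w / 2)) = exp (- (h\<^sup>2 * w / 2)) ^ R"
    by (simp add: exp_of_nat_mult[symmetric] mult.assoc)
  then have "cmod (?\<phi> ^ R - complex_of_real (exp (- (real R * h\<^sup>2 * w / 2)))) =
      cmod (?\<phi> ^ R - complex_of_real (exp (- (h\<^sup>2 * w / 2))) ^ R)" by simp
  also have "\<dots> \<le> real R * cmod (?\<phi> - complex_of_real (exp (- (h\<^sup>2 * w / 2))))"
    by (rule norm_power_diff) (use w0 in \<open>auto intro: D.cmod_char_le_1 simp: norm_exp_eq_Re simp flip: exp_of_real\<close>)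
  also have "\<dots> \<le> real R * (h\<^sup>2 / 6 * (\<bar>h\<bar> * K) + (h\<^sup>2 * w / 2)\<^sup>2)"
    by (intro mult_left_mono 3) auto
  also have "\<dots> = real R * h\<^sup>2 * (\<bar>h\<bar> * K / 6 + w\<^sup>2 * h\<^sup>2 / 4)"
    by (simp add: field_simps power2_eq_square)
  finally show ?thesis .
qed

lemma char_scaled_std_normal:
  "char (distr std_normal borel (\<lambda>z. \<eta> * z)) t = complex_of_real (exp (- ((\<eta> * t)\<^sup>2) / 2))"
proof -
  have "char (distr std_normal borel (\<lambda>z. \<eta> * z)) t = char std_normal (\<eta> * t)"
    unfolding char_def by (subst integral_distr) (auto simp: algebra_simps)
  then show ?thesis by (simp add: char_std_normal_distribution)
qed

definition near_moments :: "real \<Rightarrow> real \<Rightarrow> real \<Rightarrow> real measure \<Rightarrow> bool" where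
  "near_moments v \<delta> K Q \<longleftrightarrow> integrable Q (\<lambda>y. y) \<and>
     (\<integral>\<^sup>+ y. ennreal ((y - integral\<^sup>L Q (\<lambda>y. y))\<^sup>2) \<partial>Q) \<in> {ennreal (v - \<delta>)<..<ennreal (v + \<delta>)} \<and>
     (\<integral>\<^sup>+ y. ennreal (\<bar>y - integral\<^sup>L Q (\<lambda>y. y)\<bar> ^ 3) \<partial>Q) < ennreal K"

lemma near_momentsD:
  assumes Q: "real_distribution Q" and nm: "near_moments v \<delta> K Q" and v: "v > 0"
  defines "m \<equiv> integral\<^sup>L Q (\<lambda>y. y)"
  shows "integrable Q (\<lambda>y. (y - m)\<^sup>2)" "\<bar>(\<integral>y. (y - m)\<^sup>2 \<partial>Q) - v\<bar> < \<delta>"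
    "integrable Q (\<lambda>y. \<bar>y - m\<bar> ^ 3)" "(\<integral>y. \<bar>y - m\<bar> ^ 3 \<partial>Q) \<le> K"
proof -
  interpret Q: real_distribution Q by (rule Q)
  have V: "(\<integral>\<^sup>+ y. ennreal ((y - m)\<^sup>2) \<partial>Q) \<in> {ennreal (v - \<delta>)<..<ennreal (v + \<delta>)}"
    and T: "(\<integral>\<^sup>+ y. ennreal (\<bar>y - m\<bar> ^ 3) \<partial>Q) < ennreal K"
    using nm by (auto simp: near_moments_def m_def)
  show i2: "integrable Q (\<lambda>y. (y - m)\<^sup>2)"
    by (rule integrableI_nonneg) (use V in \<open>auto simp: less_top[symmetric] intro: less_trans\<close>)
  show i3: "integrable Q (\<lambda>y. \<bar>y - m\<bar> ^ 3)"
    by (rule integrableI_nonneg) (use T in \<open>auto simp: less_top[symmetric] intro: less_trans\<close>)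
  have e2: "(\<integral>\<^sup>+ y. ennreal ((y - m)\<^sup>2) \<partial>Q) = ennreal (\<integral>y. (y - m)\<^sup>2 \<partial>Q)"
    by (rule nn_integral_eq_integral[OF i2]) auto
  have e3: "(\<integral>\<^sup>+ y. ennreal (\<bar>y - m\<bar> ^ 3) \<partial>Q) = ennreal (\<integral>y. \<bar>y - m\<bar> ^ 3 \<partial>Q)"
    by (rule nn_integral_eq_integral[OF i3]) auto
  have n2: "0 \<le> (\<integral>y. (y - m)\<^sup>2 \<partial>Q)" and n3: "0 \<le> (\<integral>y. \<bar>y - m\<bar> ^ 3 \<partial>Q)" by (auto intro!: integral_nonneg_AE)
  \<comment> \<open>If v < \<delta>, the lower endpoint is truncated to 0 by \<open>ennreal\<close>,
    and the bound holds because the variance is nonnegative.\<close>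
  have "v - \<delta> < (\<integral>y. (y - m)\<^sup>2 \<partial>Q)"
    using V n2 unfolding e2 by (cases "v - \<delta> \<ge> 0") (auto simp: ennreal_less_iff intro: less_le_trans[of _ 0])
  moreover have "(\<integral>y. (y - m)\<^sup>2 \<partial>Q) < v + \<delta>"
    using V n2 unfolding e2 by (auto simp: ennreal_less_iff)
  ultimately show "\<bar>(\<integral>y. (y - m)\<^sup>2 \<partial>Q) - v\<bar> < \<delta>" by auto
  show "(\<integral>y. \<bar>y - m\<bar> ^ 3 \<partial>Q) \<le> K"
    using T n3 unfolding e3 by (auto simp: ennreal_less_iff)
qed

text \<open>If the bound fails, the offending laws form a triangular array to which Levy's continuity theorem applies.\<close>

lemma uniform_clt:
  fixes R :: "nat \<Rightarrow> nat"
  assumes R: "filterlim R at_top sequentially" "(\<lambda>n. real (R n) / real n) \<longlonglongrightarrow> p" and p: "p > 0"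
    and v: "v > 0" and e: "e > 0"
  shows "\<exists>\<delta>>0. \<forall>\<^sub>F n in sequentially. \<forall>Q g. real_distribution Q \<longrightarrow> near_moments v \<delta> K Q \<longrightarrow> lip01 L g \<longrightarrow>
    \<bar>(\<integral>u. g (sqrt (real n) * (run_mean (R n) u - integral\<^sup>L Q (\<lambda>y. y))) \<partial>(\<Pi>\<^sub>M r\<in>{..<R n}. Q))
      - (\<integral>z. g (sqrt (v / p) * z) \<partial>std_normal)\<bar> \<le> e"
proof (rule ccontr)
  let ?P = "\<lambda>n \<delta> Q g. real_distribution Q \<and> near_moments v \<delta> K Q \<and> lip01 L g \<and>
    \<not> \<bar>(\<integral>u. g (sqrt (real n) * (run_mean (R n) u - integral\<^sup>L Q (\<lambda>y. y))) \<partial>(\<Pi>\<^sub>M r\<in>{..<R n}. Q))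
      - (\<integral>z. g (sqrt (v / p) * z) \<partial>std_normal)\<bar> \<le> e"
  assume neg: "\<not> ?thesis"
  \<comment> \<open>Tolerance 1 / (k + 1) and an index of at least \<open>k\<close> force the
    variances of the chosen laws to \<open>v\<close> and the indices to infinity; positive
    \<open>n\<close> and \<open>R n\<close> avoid division by zero.\<close>
  have "\<exists>n Q g. n \<ge> k \<and> R n > 0 \<and> n > 0 \<and> ?P n (1 / real (Suc k)) Q g" for k
  proof -
    have "\<exists>\<^sub>F n in sequentially. \<exists>Q g. ?P n (1 / real (Suc k)) Q g"
      using neg[unfolded not_ex, rule_format, of "1 / real (Suc k)"]
      by (auto simp: not_eventually elim!: frequently_elim1)
    moreover have "\<forall>\<^sub>F n in sequentially. n \<ge> k \<and> R n > 0 \<and> n > 0"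
      using eventually_ge_at_top[of k] eventually_gt_at_top[of 0]
        R(1)[unfolded filterlim_at_top, rule_format, of 1]
      by eventually_elim auto
    ultimately have "\<exists>\<^sub>F n in sequentially. (\<exists>Q g. ?P n (1 / real (Suc k)) Q g) \<and> n \<ge> k \<and> R n > 0 \<and> n > 0"
      by (rule frequently_eventually_frequently)
    from frequently_ex[OF this] show ?thesis by blast
  qed
  then obtain N Q g where N: "\<And>k. N k \<ge> k" "\<And>k. R (N k) > 0" "\<And>k. N k > 0"
    and Q: "\<And>k. real_distribution (Q k)" and nm: "\<And>k. near_moments v (1 / real (Suc k)) K (Q k)"
    and g: "\<And>k. lip01 L (g k)"
    and far: "\<And>k. \<not> \<bar>(\<integral>u. g k (sqrt (real (N k)) * (run_mean (R (N k)) u - integral\<^sup>L (Q k) (\<lambda>y. y)))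
        \<partial>(\<Pi>\<^sub>M r\<in>{..<R (N k)}. Q k)) - (\<integral>z. g k (sqrt (v / p) * z) \<partial>std_normal)\<bar> \<le> e"
    by metis
  define m where "m k = integral\<^sup>L (Q k) (\<lambda>y. y)" for k
  define w where "w k = (\<integral>y. (y - m k)\<^sup>2 \<partial>Q k)" for k
  note mom = near_momentsD[OF Q nm v, folded m_def]
  have Ninf: "filterlim N at_top sequentially"
    by (rule filterlim_at_top_mono[OF filterlim_ident]) (use N in auto)
  have inv: "(\<lambda>k. 1 / real (Suc k)) \<longlonglongrightarrow> 0" by (rule LIMSEQ_Suc, rule lim_1_over_n)
  have wlim: "w \<longlonglongrightarrow> v"
  proof (rule LIM_zero_cancel, rule Lim_null_comparison[OF _ inv])
    show "\<forall>\<^sub>F k in sequentially. norm (w k - v) \<le> 1 / real (Suc k)"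
      using mom(2) by (auto simp: w_def less_imp_le)
  qed
  have RN: "filterlim (\<lambda>k. real (R (N k))) at_top sequentially"
    by (rule filterlim_compose[OF filterlim_real_sequentially filterlim_compose[OF R(1) Ninf]])
  have ratio: "(\<lambda>k. real (N k) / real (R (N k))) \<longlonglongrightarrow> 1 / p"
  proof -
    have "(\<lambda>k. 1 / (real (R (N k)) / real (N k))) \<longlonglongrightarrow> 1 / p"
      using p by (intro tendsto_divide tendsto_const filterlim_compose[OF R(2) Ninf]) auto
    then show ?thesis by simp
  qed
  define MM where "MM k = distr (\<Pi>\<^sub>M r\<in>{..<R (N k)}. Q k) borel (\<lambda>u. sqrt (real (N k)) * (run_mean (R (N k)) u - m k))" for k
  have Qs[measurable_cong]: "sets (Q k) = sets borel" for k
    using Q[of k] by (simp add: real_distribution_def real_distribution_axioms_def)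
  have MMd: "real_distribution (MM k)" for k
  proof -
    interpret prob_space "\<Pi>\<^sub>M r\<in>{..<R (N k)}. Q k"
      by (rule prob_space_PiM) (use Q in \<open>auto simp: real_distribution_def\<close>)
    show ?thesis unfolding MM_def by (rule real_distribution_distr) measurable
  qed
  have Nd: "real_distribution (distr std_normal borel (\<lambda>z. sqrt (v / p) * z))"
    using real_dist_normal_dist
    by (intro prob_space.real_distribution_distr) (auto simp: real_distribution_def)
  have "weak_conv_m MM (distr std_normal borel (\<lambda>z. sqrt (v / p) * z))"
  proof (rule levy_continuity[OF MMd Nd])
    fix t
    \<comment> \<open>The argument at which each single run's characteristic function is evaluated:
      it tends to 0, while R h^2 = t^2 n / R tends to t^2 / p. This scaling produces the limit
      variance v / p.\<close>
    define h where "h k = sqrt (real (N k)) * t / real (R (N k))" for k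
    have h2: "(h k)\<^sup>2 = t\<^sup>2 * (real (N k) / real (R (N k))) * (1 / real (R (N k)))" for k
      by (simp add: h_def power_divide power_mult_distrib power2_eq_square)
    have invR: "(\<lambda>k. 1 / real (R (N k))) \<longlonglongrightarrow> 0"
      by (rule tendsto_divide_0[OF tendsto_const filterlim_at_top_imp_at_infinity[OF RN]])
    have h2lim: "(\<lambda>k. (h k)\<^sup>2) \<longlonglongrightarrow> 0"
      unfolding h2 using tendsto_mult[OF tendsto_mult[OF tendsto_const ratio] invR, of "t\<^sup>2"] by simp
    have hlim: "(\<lambda>k. \<bar>h k\<bar>) \<longlonglongrightarrow> 0"
      using tendsto_real_sqrt[OF h2lim] by simp
    have Rh2: "real (R (N k)) * (h k)\<^sup>2 = t\<^sup>2 * (real (N k) / real (R (N k)))" for k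
      using N(2)[of k] by (simp add: h2)
    have Rh2lim: "(\<lambda>k. real (R (N k)) * (h k)\<^sup>2) \<longlonglongrightarrow> t\<^sup>2 * (1 / p)"
      unfolding Rh2 by (intro tendsto_mult tendsto_const ratio)
    have c: "char (MM k) t = char (distr (Q k) borel (\<lambda>y. y - m k)) (h k) ^ R (N k)" for k
      unfolding MM_def h_def by (rule char_centered_run_mean[OF Q N(2)])
    have "(\<lambda>k. char (MM k) t - complex_of_real (exp (- (real (R (N k)) * (h k)\<^sup>2 * w k / 2)))) \<longlonglongrightarrow> 0"
    proof (rule Lim_null_comparison)
      show "\<forall>\<^sub>F k in sequentially. norm (char (MM k) t - complex_of_real (exp (- (real (R (N k)) * (h k)\<^sup>2 * w k / 2))))
        \<le> real (R (N k)) * (h k)\<^sup>2 * (\<bar>h k\<bar> * K / 6 + (w k)\<^sup>2 * (h k)\<^sup>2 / 4)"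
        unfolding c using nm m_def mom w_def
        by (intro always_eventually allI char_power_gaussian_bound Q) (auto simp: near_moments_def)
      have "(\<lambda>k. real (R (N k)) * (h k)\<^sup>2 * (\<bar>h k\<bar> * K / 6 + (w k)\<^sup>2 * (h k)\<^sup>2 / 4)) \<longlonglongrightarrow>
          t\<^sup>2 * (1 / p) * (0 * K / 6 + v\<^sup>2 * 0 / 4)"
        by (intro tendsto_intros Rh2lim hlim h2lim wlim) auto
      then show "(\<lambda>k. real (R (N k)) * (h k)\<^sup>2 * (\<bar>h k\<bar> * K / 6 + (w k)\<^sup>2 * (h k)\<^sup>2 / 4)) \<longlonglongrightarrow> 0" by simp
    qed
    moreover have "(\<lambda>k. complex_of_real (exp (- (real (R (N k)) * (h k)\<^sup>2 * w k / 2)))) \<longlonglongrightarrow>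
        complex_of_real (exp (- (t\<^sup>2 * (1 / p) * v / 2)))"
      by (intro tendsto_intros Rh2lim wlim) auto
    ultimately have "(\<lambda>k. char (MM k) t) \<longlonglongrightarrow> complex_of_real (exp (- (t\<^sup>2 * (1 / p) * v / 2)))"
      by (rule Lim_transform[rotated])
    also have "- (t\<^sup>2 * (1 / p) * v / 2) = - ((sqrt (v / p) * t)\<^sup>2) / 2"
      using v p by (simp add: power_mult_distrib)
    finally show "(\<lambda>k. char (MM k) t) \<longlonglongrightarrow> char (distr std_normal borel (\<lambda>z. sqrt (v / p) * z)) t"
      by (simp add: char_scaled_std_normal)
  qed
  from weak_conv_imp_lip01_close[OF MMd Nd this e, of L]
  obtain k where k: "\<bar>integral\<^sup>L (MM k) (g k) - integral\<^sup>L (distr std_normal borel (\<lambda>z. sqrt (v / p) * z)) (g k)\<bar> \<le> e"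
    using g by (auto simp: eventually_sequentially)
  note [measurable] = lip01_measurable[OF g[of k]]
  have "integral\<^sup>L (MM k) (g k) = (\<integral>u. g k (sqrt (real (N k)) * (run_mean (R (N k)) u - integral\<^sup>L (Q k) (\<lambda>y. y)))
        \<partial>(\<Pi>\<^sub>M r\<in>{..<R (N k)}. Q k))"
    unfolding MM_def m_def by (subst integral_distr) auto
  moreover have "integral\<^sup>L (distr std_normal borel (\<lambda>z. sqrt (v / p) * z)) (g k) =
     (\<integral>z. g k (sqrt (v / p) * z) \<partial>std_normal)"
    by (subst integral_distr) auto
  ultimately show False using k far[of k] by simp
qed

section \<open>Product measures and kernels\<close>

lemma lip01_integral:
  assumes M: "prob_space M" and lip: "\<And>z. lip01 L (\<lambda>y. F y z)"
    and meas: "\<And>y. F y \<in> borel_measurable M"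
  shows "lip01 L (\<lambda>y. \<integral>z. F y z \<partial>M)"
proof -
  interpret prob_space M by (rule M)
  have i: "integrable M (F y)" for y
    by (intro integrable_01 meas lip01_bounds(1,2)[OF lip])
  show ?thesis
    unfolding lip01_def
  proof (intro conjI allI)
    show "0 \<le> (\<integral>z. F y z \<partial>M)" "(\<integral>z. F y z \<partial>M) \<le> 1" for y
      by (intro integral_01 meas lip01_bounds(1,2)[OF lip])+
    fix x y
    have "\<bar>(\<integral>z. F x z \<partial>M) - (\<integral>z. F y z \<partial>M)\<bar> = \<bar>\<integral>z. F x z - F y z \<partial>M\<bar>"
      using i by simp
    also have "\<dots> \<le> (\<integral>z. \<bar>F x z - F y z\<bar> \<partial>M)" by (rule integral_abs_bound)
    also have "\<dots> \<le> (\<integral>z. L * \<bar>x - y\<bar> \<partial>M)"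
      using lip i by (intro integral_mono) (auto simp: lip01_def)
    finally show "\<bar>(\<integral>z. F x z \<partial>M) - (\<integral>z. F y z \<partial>M)\<bar> \<le> L * \<bar>x - y\<bar>" by (simp add: prob_space)
  qed
qed

text \<open>Hybrid argument: first the law of coordinate \<open>i\<close> is exchanged while the
  others keep law \<open>M\<close>, at cost \<open>e\<close>. The average of \<open>F\<close> over
  coordinate \<open>i\<close> under \<open>N\<close> is still Lipschitz in each remaining
  coordinate, so the induction hypothesis applies to it.\<close>

lemma PiM_integral_close:
  fixes F :: "('i \<Rightarrow> real) \<Rightarrow> real"
  assumes I: "finite I" and M: "real_distribution M" and N: "real_distribution N"
    and F: "F \<in> borel_measurable (\<Pi>\<^sub>M i\<in>I. borel)" "\<And>d. 0 \<le> F d" "\<And>d. F d \<le> 1"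
    and lip: "\<And>i d. i \<in> I \<Longrightarrow> lip01 L (\<lambda>y. F (d(i := y)))"
    and close: "\<And>g. lip01 L g \<Longrightarrow> \<bar>integral\<^sup>L M g - integral\<^sup>L N g\<bar> \<le> e"
  shows "\<bar>(\<integral>d. F d \<partial>(\<Pi>\<^sub>M i\<in>I. M)) - (\<integral>d. F d \<partial>(\<Pi>\<^sub>M i\<in>I. N))\<bar> \<le> real (card I) * e"
  using I F lip
proof (induction I arbitrary: F rule: finite_induct)
  case empty
  then show ?case by (simp add: PiM_empty)
next
  case (insert i I)
  interpret M: real_distribution M by (rule M)
  interpret N: real_distribution N by (rule N)
  interpret PM: product_sigma_finite "\<lambda>_ :: 'i. M" by standard
  interpret PN: product_sigma_finite "\<lambda>_ :: 'i. N" by standard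
  have sM[measurable_cong]: "sets M = sets borel" and sN[measurable_cong]: "sets N = sets borel" by simp_all
  have pM: "prob_space (PiM J (\<lambda>_. M))" "prob_space (PiM J (\<lambda>_. N))" for J :: "'i set"
    by (intro prob_space_PiM M.prob_space_axioms N.prob_space_axioms)+
  interpret IM: prob_space "PiM I (\<lambda>_. M)" by (rule pM)
  interpret IM': prob_space "PiM (insert i I) (\<lambda>_. M)" by (rule pM)
  interpret IN': prob_space "PiM (insert i I) (\<lambda>_. N)" by (rule pM)
  note [measurable] = insert.prems(1)
  define G where "G d = (\<integral>y. F (d(i := y)) \<partial>N)" for d
  define H where "H d = (\<integral>y. F (d(i := y)) \<partial>M)" for d
  have upd[measurable]: "(\<lambda>(d, y). d(i := y)) \<in> (\<Pi>\<^sub>M i\<in>I. borel) \<Otimes>\<^sub>M borel \<rightarrow>\<^sub>M (\<Pi>\<^sub>M i\<in>insert i I. (borel :: real measure))"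
    using measurable_add_dim[of i I "\<lambda>_. borel"] by simp
  have Fupd: "(\<lambda>(d, y). F (d(i := y))) \<in> borel_measurable ((\<Pi>\<^sub>M i\<in>I. borel) \<Otimes>\<^sub>M borel)"
    using measurable_compose[OF upd insert.prems(1)] by (simp add: split_def)
  have Fupd': "(\<lambda>(d, y). F (d(i := y))) \<in> borel_measurable ((\<Pi>\<^sub>M i\<in>I. borel) \<Otimes>\<^sub>M N)"
    "(\<lambda>(d, y). F (d(i := y))) \<in> borel_measurable ((\<Pi>\<^sub>M i\<in>I. borel) \<Otimes>\<^sub>M M)"
    using Fupd by (simp_all cong: measurable_cong_sets sets_pair_measure_cong add: sM sN)
  have sec: "(\<lambda>y. F (d(i := y))) \<in> borel_measurable borel" for d
    by (rule lip01_measurable[OF insert.prems(4)]) simp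
  have Gm[measurable]: "G \<in> borel_measurable (\<Pi>\<^sub>M i\<in>I. borel)"
    unfolding G_def using N.borel_measurable_lebesgue_integral[OF Fupd'(1)] .
  have Hm[measurable]: "H \<in> borel_measurable (\<Pi>\<^sub>M i\<in>I. borel)"
    unfolding H_def using M.borel_measurable_lebesgue_integral[OF Fupd'(2)] .
  have Gb: "0 \<le> G d" "G d \<le> 1" and Hb: "0 \<le> H d" "H d \<le> 1" for d
    unfolding G_def H_def using sec insert.prems
    by (auto intro!: N.integral_01 M.integral_01)
  have Glip: "lip01 L (\<lambda>y. G (d(j := y)))" if "j \<in> I" for j d
  proof -
    have "j \<noteq> i" using that insert.hyps by auto
    then have "G (d(j := y)) = (\<integral>z. F (d(i := z, j := y)) \<partial>N)" for y
      unfolding G_def by (simp add: fun_upd_twist)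
    moreover have "lip01 L (\<lambda>y. \<integral>z. F (d(i := z, j := y)) \<partial>N)"
    proof (rule lip01_integral[OF N.prob_space_axioms])
      show "lip01 L (\<lambda>y. F (d(i := z, j := y)))" for z
        using that by (intro insert.prems(4)) auto
      show "(\<lambda>z. F (d(i := z, j := y))) \<in> borel_measurable N" for y
        using sec[of "d(j := y)"] \<open>j \<noteq> i\<close> by (simp add: fun_upd_twist)
    qed
    ultimately show ?thesis by simp
  qed
  have 1: "(\<integral>d. F d \<partial>(\<Pi>\<^sub>M i\<in>insert i I. M)) = (\<integral>d. H d \<partial>(\<Pi>\<^sub>M i\<in>I. M))"
    unfolding H_def using insert.hyps insert.prems
    by (intro PM.product_integral_insert IM'.integrable_01) measurable
  have 2: "(\<integral>d. F d \<partial>(\<Pi>\<^sub>M i\<in>insert i I. N)) = (\<integral>d. G d \<partial>(\<Pi>\<^sub>M i\<in>I. N))"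
    unfolding G_def using insert.hyps insert.prems
    by (intro PN.product_integral_insert IN'.integrable_01) measurable
  have "\<bar>(\<integral>d. H d \<partial>(\<Pi>\<^sub>M i\<in>I. M)) - (\<integral>d. G d \<partial>(\<Pi>\<^sub>M i\<in>I. M))\<bar> = \<bar>\<integral>d. H d - G d \<partial>(\<Pi>\<^sub>M i\<in>I. M)\<bar>"
    using Gb Hb by (subst Bochner_Integration.integral_diff) (auto intro!: IM.integrable_01)
  also have "\<dots> \<le> (\<integral>d. \<bar>H d - G d\<bar> \<partial>(\<Pi>\<^sub>M i\<in>I. M))" by (rule integral_abs_bound)
  also have "\<dots> \<le> (\<integral>d. e \<partial>(\<Pi>\<^sub>M i\<in>I. M))"
  proof (rule integral_mono)
    show "integrable (\<Pi>\<^sub>M i\<in>I. M) (\<lambda>d. \<bar>H d - G d\<bar>)"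
      using Gb Hb by (intro integrable_abs Bochner_Integration.integrable_diff IM.integrable_01) auto
    show "\<bar>H d - G d\<bar> \<le> e" for d
      unfolding H_def G_def by (intro close insert.prems(4)) simp
  qed simp
  finally have 3: "\<bar>(\<integral>d. H d \<partial>(\<Pi>\<^sub>M i\<in>I. M)) - (\<integral>d. G d \<partial>(\<Pi>\<^sub>M i\<in>I. M))\<bar> \<le> e"
    by (simp add: IM.prob_space)
  have 4: "\<bar>(\<integral>d. G d \<partial>(\<Pi>\<^sub>M i\<in>I. M)) - (\<integral>d. G d \<partial>(\<Pi>\<^sub>M i\<in>I. N))\<bar> \<le> real (card I) * e"
    by (rule insert.IH[OF Gm Gb Glip])
  show ?case unfolding 1 2 using 3 4 insert.hyps by (simp add: algebra_simps)
qed

section \<open>Finite products of probability kernels\<close>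

lemma emeasure_PiM_prob:
  assumes I: "finite I" and M: "\<And>i. i \<in> I \<Longrightarrow> prob_space (M i)" and A: "\<And>i. i \<in> I \<Longrightarrow> A i \<in> sets (M i)"
  shows "emeasure (PiM I M) (Pi\<^sub>E I A) = (\<Prod>i\<in>I. emeasure (M i) (A i))"
proof -
  \<comment> \<open>Outside \<open>I\<close> a one-point probability space is put in, because
    \<open>product_prob_space\<close> asks for a probability measure at every index.\<close>
  define M' where "M' i = (if i \<in> I then M i else count_space {undefined})" for i
  have "prob_space (M' i)" for i
    unfolding M'_def using M by (auto intro!: prob_spaceI)
  then interpret product_prob_space M' by (intro product_prob_spaceI)
  have "PiM I M = PiM I M'" by (intro PiM_cong) (auto simp: M'_def)
  then have "emeasure (PiM I M) (Pi\<^sub>E I A) = (\<Prod>i\<in>I. emeasure (M' i) (A i))"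
    using I A by (simp add: emeasure_PiM M'_def)
  also have "\<dots> = (\<Prod>i\<in>I. emeasure (M i) (A i))"
    by (intro prod.cong) (auto simp: M'_def)
  finally show ?thesis .
qed

text \<open>Boxes form an intersection-stable generator, and on a box the product measure is a
  finite product of functions measurable in \<open>x\<close>.\<close>

lemma measurable_PiM_prob_algebra:
  assumes I: "finite I" and K: "\<And>i. i \<in> I \<Longrightarrow> K i \<in> M \<rightarrow>\<^sub>M prob_algebra (N i)"
  shows "(\<lambda>x. \<Pi>\<^sub>M i\<in>I. K i x) \<in> M \<rightarrow>\<^sub>M prob_algebra (PiM I N)"
proof -
  have Kx: "prob_space (K i x)" "sets (K i x) = sets (N i)" if "i \<in> I" "x \<in> space M" for i x
    using measurable_space[OF K that(2)] that by (auto simp: space_prob_algebra)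
  let ?G = "{Pi\<^sub>E I E | E. \<forall>i\<in>I. E i \<in> sets (N i)}"
  show ?thesis
  proof (rule measurable_prob_algebra_generated)
    show "sets (PiM I N) = sigma_sets (\<Pi>\<^sub>E i\<in>I. space (N i)) ?G"
      by (simp add: sets_PiM prod_algebra_eq_finite[OF I] Pi_iff)
    show "Int_stable ?G" by (rule Int_stable_PiE)
    show "?G \<subseteq> Pow (\<Pi>\<^sub>E i\<in>I. space (N i))" by (auto dest: sets.sets_into_space)
    show "prob_space (\<Pi>\<^sub>M i\<in>I. K i x)" if "x \<in> space M" for x
      using Kx that by (intro prob_space_PiM) auto
    show "sets (\<Pi>\<^sub>M i\<in>I. K i x) = sets (PiM I N)" if "x \<in> space M" for x
      using Kx that by (intro sets_PiM_cong) auto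
    fix A assume "A \<in> ?G"
    then obtain E where A: "A = Pi\<^sub>E I E" and E: "\<And>i. i \<in> I \<Longrightarrow> E i \<in> sets (N i)" by auto
    have "(\<lambda>x. \<Prod>i\<in>I. emeasure (K i x) (E i)) \<in> borel_measurable M"
      using E K by (intro borel_measurable_prod_ennreal
          measurable_compose[OF measurable_prob_algebraD measurable_emeasure_subprob_algebra]) auto
    then show "(\<lambda>x. emeasure (\<Pi>\<^sub>M i\<in>I. K i x) A) \<in> borel_measurable M"
      unfolding A using Kx E I by (subst measurable_cong[OF emeasure_PiM_prob]) auto
  qed
qed

text \<open>Independent mixing variables, each feeding only its own factor, can be integrated out
  factor by factor. This shows that averaging over the resampling indices leaves the resample blocks
  independent and identically distributed given the data.\<close>

lemma PiM_bind_PiM: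
  fixes I :: "'i set"
  assumes I: "finite I" and M: "prob_space M" and K: "K \<in> M \<rightarrow>\<^sub>M prob_algebra N"
  shows "(\<Pi>\<^sub>M i\<in>I. M) \<bind> (\<lambda>j. \<Pi>\<^sub>M i\<in>I. K (j i)) = (\<Pi>\<^sub>M i\<in>I. M \<bind> K)"
proof -
  interpret M: prob_space M by (rule M)
  have Mp: "M \<in> space (prob_algebra M)" using M by (simp add: space_prob_algebra)
  have PMp: "PiM I (\<lambda>_. M) \<in> space (prob_algebra (PiM I (\<lambda>_. M)))"
    by (simp add: space_prob_algebra prob_space_PiM M)
  have sK: "sets (M \<bind> K) = sets N" by (rule sets_bind'[OF Mp K])
  have pK: "prob_space (M \<bind> K)" by (rule prob_space_bind'[OF Mp K])
  interpret pK: prob_space "M \<bind> K" by (rule pK)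
  interpret PM: product_sigma_finite "\<lambda>_ :: 'i. M" by standard
  interpret PK: product_sigma_finite "\<lambda>_ :: 'i. M \<bind> K" by standard
  have KK: "(\<lambda>j. \<Pi>\<^sub>M i\<in>I. K (j i)) \<in> PiM I (\<lambda>_. M) \<rightarrow>\<^sub>M prob_algebra (PiM I (\<lambda>_. N))"
    using K by (intro measurable_PiM_prob_algebra I) (auto intro: measurable_compose[OF measurable_component_singleton])
  have Kx: "prob_space (K x)" "sets (K x) = sets N" if "x \<in> space M" for x
    using measurable_space[OF K that(1)] that by (auto simp: space_prob_algebra)
  show ?thesis
  proof (rule PK.PiM_eqI[OF I])
    have "sets (PiM I (\<lambda>_. M) \<bind> (\<lambda>j. \<Pi>\<^sub>M i\<in>I. K (j i))) = sets (PiM I (\<lambda>_. N))"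
      by (rule sets_bind'[OF PMp KK])
    also have "\<dots> = sets (PiM I (\<lambda>_. M \<bind> K))" by (intro sets_PiM_cong) (auto simp: sK)
    finally show "sets (PiM I (\<lambda>_. M) \<bind> (\<lambda>j. \<Pi>\<^sub>M i\<in>I. K (j i))) = sets (PiM I (\<lambda>_. M \<bind> K))" .
    fix A assume "\<And>i. i \<in> I \<Longrightarrow> A i \<in> sets (M \<bind> K)"
    then have A: "\<And>i. i \<in> I \<Longrightarrow> A i \<in> sets N" by (simp add: sK)
    have "emeasure (PiM I (\<lambda>_. M) \<bind> (\<lambda>j. \<Pi>\<^sub>M i\<in>I. K (j i))) (Pi\<^sub>E I A) =
        (\<integral>\<^sup>+ j. emeasure (\<Pi>\<^sub>M i\<in>I. K (j i)) (Pi\<^sub>E I A) \<partial>PiM I (\<lambda>_. M))"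
      using A I by (intro emeasure_bind_prob_algebra[OF PMp KK] sets_PiM_I_finite) auto
    also have "\<dots> = (\<integral>\<^sup>+ j. (\<Prod>i\<in>I. emeasure (K (j i)) (A i)) \<partial>PiM I (\<lambda>_. M))"
      using A Kx by (intro nn_integral_cong emeasure_PiM_prob I) (auto simp: space_PiM PiE_iff)
    also have "\<dots> = (\<Prod>i\<in>I. \<integral>\<^sup>+ x. emeasure (K x) (A i) \<partial>M)"
      using A by (intro PM.product_nn_integral_prod I measurable_compose[OF measurable_prob_algebraD[OF K] measurable_emeasure_subprob_algebra]) auto
    also have "\<dots> = (\<Prod>i\<in>I. emeasure (M \<bind> K) (A i))"
      using A by (intro prod.cong refl emeasure_bind_prob_algebra[OF Mp K, symmetric]) auto
    finally show "emeasure (PiM I (\<lambda>_. M) \<bind> (\<lambda>j. \<Pi>\<^sub>M i\<in>I. K (j i))) (Pi\<^sub>E I A) = (\<Prod>i\<in>I. emeasure (M \<bind> K) (A i))" .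
  qed
qed

text \<open>The first factor \<open>A x\<close> does not depend on \<open>j\<close>, so averaging
  over \<open>j\<close> can be moved into the second factor; the substance is an exchange of the
  integrals over \<open>J\<close> and \<open>A x\<close>.\<close>

lemma bind_pair_measure_kernels:
  assumes X: "prob_space X" and J: "prob_space J"
    and A: "A \<in> X \<rightarrow>\<^sub>M prob_algebra N1" and K: "K \<in> X \<Otimes>\<^sub>M J \<rightarrow>\<^sub>M prob_algebra N2"
  shows "(X \<Otimes>\<^sub>M J) \<bind> (\<lambda>(x, j). A x \<Otimes>\<^sub>M K (x, j)) = X \<bind> (\<lambda>x. A x \<Otimes>\<^sub>M (J \<bind> (\<lambda>j. K (x, j))))"
proof (rule measure_eqI)
  interpret X: prob_space X by (rule X)
  interpret J: prob_space J by (rule J)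
  interpret XJ: pair_prob_space X J ..
  have Xp: "X \<in> space (prob_algebra X)" and Jp: "J \<in> space (prob_algebra J)"
    and XJp: "X \<Otimes>\<^sub>M J \<in> space (prob_algebra (X \<Otimes>\<^sub>M J))"
    using X J by (auto simp: space_prob_algebra intro: prob_space_pair)
  have K1: "(\<lambda>j. K (x, j)) \<in> J \<rightarrow>\<^sub>M prob_algebra N2" if "x \<in> space X" for x
    using measurable_compose[OF measurable_Pair1'[OF that] K] .
  have L: "(\<lambda>(x, j). A x \<Otimes>\<^sub>M K (x, j)) \<in> X \<Otimes>\<^sub>M J \<rightarrow>\<^sub>M prob_algebra (N1 \<Otimes>\<^sub>M N2)"
    unfolding split_def using A K by (intro measurable_pair_prob) (auto intro: measurable_compose[OF measurable_fst])
  have JK: "(\<lambda>x. J \<bind> (\<lambda>j. K (x, j))) \<in> X \<rightarrow>\<^sub>M prob_algebra N2"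
    using K by (intro measurable_bind_prob_space2[OF measurable_const[OF Jp]]) (simp add: split_def)
  have Rr: "(\<lambda>x. A x \<Otimes>\<^sub>M (J \<bind> (\<lambda>j. K (x, j)))) \<in> X \<rightarrow>\<^sub>M prob_algebra (N1 \<Otimes>\<^sub>M N2)"
    by (intro measurable_pair_prob A JK)
  have s: "sets ((X \<Otimes>\<^sub>M J) \<bind> (\<lambda>(x, j). A x \<Otimes>\<^sub>M K (x, j))) = sets (N1 \<Otimes>\<^sub>M N2)"
    by (rule sets_bind'[OF XJp L])
  also have "\<dots> = sets (X \<bind> (\<lambda>x. A x \<Otimes>\<^sub>M (J \<bind> (\<lambda>j. K (x, j)))))"
    by (rule sets_bind'[OF Xp Rr, symmetric])
  finally show "sets ((X \<Otimes>\<^sub>M J) \<bind> (\<lambda>(x, j). A x \<Otimes>\<^sub>M K (x, j))) = sets (X \<bind> (\<lambda>x. A x \<Otimes>\<^sub>M (J \<bind> (\<lambda>j. K (x, j)))))" .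
  fix S assume "S \<in> sets ((X \<Otimes>\<^sub>M J) \<bind> (\<lambda>(x, j). A x \<Otimes>\<^sub>M K (x, j)))"
  then have S[measurable]: "S \<in> sets (N1 \<Otimes>\<^sub>M N2)" unfolding s .
  have "emeasure ((X \<Otimes>\<^sub>M J) \<bind> (\<lambda>(x, j). A x \<Otimes>\<^sub>M K (x, j))) S =
      (\<integral>\<^sup>+ w. emeasure (case w of (x, j) \<Rightarrow> A x \<Otimes>\<^sub>M K (x, j)) S \<partial>(X \<Otimes>\<^sub>M J))"
    by (rule emeasure_bind_prob_algebra[OF XJp L S])
  also have "\<dots> = (\<integral>\<^sup>+ x. \<integral>\<^sup>+ j. emeasure (A x \<Otimes>\<^sub>M K (x, j)) S \<partial>J \<partial>X)"
    using measurable_compose[OF measurable_prob_algebraD[OF L] measurable_emeasure_subprob_algebra[OF S]]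
    by (subst J.nn_integral_fst[symmetric]) auto
  also have "\<dots> = (\<integral>\<^sup>+ x. emeasure (A x \<Otimes>\<^sub>M (J \<bind> (\<lambda>j. K (x, j)))) S \<partial>X)"
  proof (rule nn_integral_cong)
    fix x assume x: "x \<in> space X"
    have Ax: "prob_space (A x)" and sA[measurable_cong]: "sets (A x) = sets N1"
      using measurable_space[OF A x] by (auto simp: space_prob_algebra)
    interpret Ax: prob_space "A x" by (rule Ax)
    interpret P: pair_prob_space J "A x" ..
    have Kx: "prob_space (K (x, j))" "sets (K (x, j)) = sets N2" if "j \<in> space J" for j
      using measurable_space[OF K1[OF x] that] by (auto simp: space_prob_algebra)
    have Bx: "prob_space (J \<bind> (\<lambda>j. K (x, j)))" "sets (J \<bind> (\<lambda>j. K (x, j))) = sets N2"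
      using measurable_space[OF JK x] by (auto simp: space_prob_algebra)
    have cut: "Pair u -` S \<in> sets N2" for u using S by (rule sets_Pair1)
    have "(\<integral>\<^sup>+ j. emeasure (A x \<Otimes>\<^sub>M K (x, j)) S \<partial>J) = (\<integral>\<^sup>+ j. \<integral>\<^sup>+ u. emeasure (K (x, j)) (Pair u -` S) \<partial>A x \<partial>J)"
    proof (rule nn_integral_cong)
      fix j assume j: "j \<in> space J"
      interpret Kj: prob_space "K (x, j)" by (rule Kx[OF j])
      have "S \<in> sets (A x \<Otimes>\<^sub>M K (x, j))"
        using S sets_pair_measure_cong[OF sA Kx(2)[OF j]] by simp
      then show "emeasure (A x \<Otimes>\<^sub>M K (x, j)) S = (\<integral>\<^sup>+ u. emeasure (K (x, j)) (Pair u -` S) \<partial>A x)"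
        by (rule Kj.emeasure_pair_measure_alt)
    qed
    also have "\<dots> = (\<integral>\<^sup>+ u. \<integral>\<^sup>+ j. emeasure (K (x, j)) (Pair u -` S) \<partial>J \<partial>A x)"
    proof (rule P.Fubini'[symmetric])
      have m: "(\<lambda>w. K (x, fst w)) \<in> J \<Otimes>\<^sub>M A x \<rightarrow>\<^sub>M subprob_algebra N2"
        using measurable_compose[OF measurable_fst measurable_prob_algebraD[OF K1[OF x]]] .
      \<comment> \<open>Both the measure and the section vary with (j, u). Joint measurability comes
        from viewing all sections together as one preimage of \<open>S\<close>.\<close>
      have "(\<lambda>w. emeasure (K (x, fst w)) (Pair (snd w) -` S)) \<in> borel_measurable (J \<Otimes>\<^sub>M A x)"
      proof (rule emeasure_measurable_subprob_algebra2[OF _ m])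
        have "(SIGMA w:space (J \<Otimes>\<^sub>M A x). Pair (snd w) -` S) =
            (\<lambda>(w, v). (snd w, v)) -` S \<inter> space ((J \<Otimes>\<^sub>M A x) \<Otimes>\<^sub>M N2)"
          using sets.sets_into_space[OF cut] by (auto simp: space_pair_measure)
        also have "\<dots> \<in> sets ((J \<Otimes>\<^sub>M A x) \<Otimes>\<^sub>M N2)" by measurable
        finally show "(SIGMA w:space (J \<Otimes>\<^sub>M A x). Pair (snd w) -` S) \<in> sets ((J \<Otimes>\<^sub>M A x) \<Otimes>\<^sub>M N2)" .
      qed
      then show "(\<lambda>(j, u). emeasure (K (x, j)) (Pair u -` S)) \<in> borel_measurable (J \<Otimes>\<^sub>M A x)"
        by (simp add: split_def)
    qed
    also have "\<dots> = (\<integral>\<^sup>+ u. emeasure (J \<bind> (\<lambda>j. K (x, j))) (Pair u -` S) \<partial>A x)"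
      by (intro nn_integral_cong emeasure_bind_prob_algebra[OF Jp K1[OF x] cut, symmetric])
    also have "\<dots> = emeasure (A x \<Otimes>\<^sub>M (J \<bind> (\<lambda>j. K (x, j)))) S"
    proof -
      interpret Bx: prob_space "J \<bind> (\<lambda>j. K (x, j))" by (rule Bx)
      have "S \<in> sets (A x \<Otimes>\<^sub>M (J \<bind> (\<lambda>j. K (x, j))))"
        using S sets_pair_measure_cong[OF sA Bx(2)] by simp
      then show ?thesis by (rule Bx.emeasure_pair_measure_alt[symmetric])
    qed
    finally show "(\<integral>\<^sup>+ j. emeasure (A x \<Otimes>\<^sub>M K (x, j)) S \<partial>J) = emeasure (A x \<Otimes>\<^sub>M (J \<bind> (\<lambda>j. K (x, j)))) S" .
  qed
  also have "\<dots> = emeasure (X \<bind> (\<lambda>x. A x \<Otimes>\<^sub>M (J \<bind> (\<lambda>j. K (x, j))))) S"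
    by (rule emeasure_bind_prob_algebra[OF Xp Rr S, symmetric])
  finally show "emeasure ((X \<Otimes>\<^sub>M J) \<bind> (\<lambda>(x, j). A x \<Otimes>\<^sub>M K (x, j))) S = emeasure (X \<bind> (\<lambda>x. A x \<Otimes>\<^sub>M (J \<bind> (\<lambda>j. K (x, j))))) S" .
qed

section \<open>Gaussian samples\<close>

text \<open>The map is an orthogonal reflection (determinant -1). It is realised by two
  one-dimensional substitutions with an exchange of integrals between them: first u = a x + b y
  replaces y, then x = a u + b w. Their factors 1 / b and b cancel.\<close>

lemma nn_integral_lborel_rotation:
  fixes a b :: real and g :: "real \<times> real \<Rightarrow> ennreal"
  assumes ab: "a\<^sup>2 + b\<^sup>2 = 1" "b > 0" and [measurable]: "g \<in> borel_measurable (borel \<Otimes>\<^sub>M borel)"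
  shows "(\<integral>\<^sup>+x. \<integral>\<^sup>+y. g (x, y) \<partial>lborel \<partial>lborel) =
    (\<integral>\<^sup>+u. \<integral>\<^sup>+w. g (a * u + b * w, b * u - a * w) \<partial>lborel \<partial>lborel)"
proof -
  have "(\<integral>\<^sup>+x. \<integral>\<^sup>+y. g (x, y) \<partial>lborel \<partial>lborel) =
      (\<integral>\<^sup>+x. \<integral>\<^sup>+u. ennreal (1 / b) * g (x, - a * x / b + 1 / b * u) \<partial>lborel \<partial>lborel)"
  proof (rule nn_integral_cong)
    fix x
    have "(\<integral>\<^sup>+y. g (x, y) \<partial>lborel) = \<bar>1 / b\<bar> * (\<integral>\<^sup>+u. g (x, - a * x / b + 1 / b * u) \<partial>lborel)"
      using ab by (intro nn_integral_real_affine) auto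
    then show "(\<integral>\<^sup>+y. g (x, y) \<partial>lborel) = (\<integral>\<^sup>+u. ennreal (1 / b) * g (x, - a * x / b + 1 / b * u) \<partial>lborel)"
      using ab by (simp add: nn_integral_cmult)
  qed
  also have "\<dots> = (\<integral>\<^sup>+u. \<integral>\<^sup>+x. ennreal (1 / b) * g (x, - a * x / b + 1 / b * u) \<partial>lborel \<partial>lborel)"
    by (rule lborel_pair.Fubini') measurable
  also have "\<dots> = (\<integral>\<^sup>+u. \<integral>\<^sup>+w. g (a * u + b * w, b * u - a * w) \<partial>lborel \<partial>lborel)"
  proof (rule nn_integral_cong)
    fix u
    have eq: "- a * (a * u + b * w) / b + 1 / b * u = b * u - a * w" for w
    proof -
      have "- a * (a * u + b * w) / b + 1 / b * u = ((1 - a\<^sup>2) * u - a * b * w) / b"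
        using ab by (simp add: field_simps power2_eq_square)
      also have "1 - a\<^sup>2 = b\<^sup>2" using ab by simp
      finally show ?thesis using ab by (simp add: field_simps power2_eq_square)
    qed
    have "(\<integral>\<^sup>+x. ennreal (1 / b) * g (x, - a * x / b + 1 / b * u) \<partial>lborel) =
        \<bar>b\<bar> * (\<integral>\<^sup>+w. ennreal (1 / b) * g (a * u + b * w, - a * (a * u + b * w) / b + 1 / b * u) \<partial>lborel)"
      using ab by (intro nn_integral_real_affine) auto
    also have "\<dots> = (\<integral>\<^sup>+w. ennreal b * (ennreal (1 / b) * g (a * u + b * w, b * u - a * w)) \<partial>lborel)"
      using ab unfolding eq by (simp add: nn_integral_cmult)
    also have "\<dots> = (\<integral>\<^sup>+w. g (a * u + b * w, b * u - a * w) \<partial>lborel)"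
      using ab by (intro nn_integral_cong) (simp add: mult.assoc[symmetric] flip: ennreal_mult')
    finally show "(\<integral>\<^sup>+x. ennreal (1 / b) * g (x, - a * x / b + 1 / b * u) \<partial>lborel) =
        (\<integral>\<^sup>+w. g (a * u + b * w, b * u - a * w) \<partial>lborel)" .
  qed
  finally show ?thesis .
qed

lemma nn_integral_std_normal_pair:
  assumes [measurable]: "f \<in> borel_measurable (borel \<Otimes>\<^sub>M borel)"
  shows "(\<integral>\<^sup>+x. \<integral>\<^sup>+y. f (x, y) \<partial>std_normal \<partial>std_normal) =
    (\<integral>\<^sup>+x. \<integral>\<^sup>+y. ennreal (std_normal_density x * std_normal_density y) * f (x, y) \<partial>lborel \<partial>lborel)"
  by (subst (1 2) nn_integral_density)
     (auto intro!: nn_integral_cong simp: ennreal_mult' mult.assoc nn_integral_cmult[symmetric])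

text \<open>The joint density depends only on the sum of squares (\<open>i3\<close>), and the
  reflection is its own inverse (\<open>i1\<close>, \<open>i2\<close>), so substituting it restores
  the arguments of \<open>f\<close>.\<close>

lemma std_normal_rotation:
  fixes a b :: real and f :: "real \<times> real \<Rightarrow> ennreal"
  assumes ab: "a\<^sup>2 + b\<^sup>2 = 1" "b > 0" and [measurable]: "f \<in> borel_measurable (borel \<Otimes>\<^sub>M borel)"
  shows "(\<integral>\<^sup>+x. \<integral>\<^sup>+y. f (a * x + b * y, b * x - a * y) \<partial>std_normal \<partial>std_normal) =
    (\<integral>\<^sup>+u. \<integral>\<^sup>+w. f (u, w) \<partial>std_normal \<partial>std_normal)"
proof -
  have i1: "a * (a * u + b * w) + b * (b * u - a * w) = u" for u w
  proof -
    have "a * (a * u + b * w) + b * (b * u - a * w) = (a\<^sup>2 + b\<^sup>2) * u"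
      by (simp add: algebra_simps power2_eq_square)
    then show ?thesis using ab by simp
  qed
  have i2: "b * (a * u + b * w) - a * (b * u - a * w) = w" for u w
  proof -
    have "b * (a * u + b * w) - a * (b * u - a * w) = (a\<^sup>2 + b\<^sup>2) * w"
      by (simp add: algebra_simps power2_eq_square)
    then show ?thesis using ab by simp
  qed
  have i3: "std_normal_density (a * u + b * w) * std_normal_density (b * u - a * w) = std_normal_density u * std_normal_density w" for u w
  proof -
    have "(a * u + b * w)\<^sup>2 + (b * u - a * w)\<^sup>2 = (a\<^sup>2 + b\<^sup>2) * (u\<^sup>2 + w\<^sup>2)"
      by (simp add: algebra_simps power2_eq_square)
    then have "(a * u + b * w)\<^sup>2 + (b * u - a * w)\<^sup>2 = u\<^sup>2 + w\<^sup>2" using ab by simp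
    then have "- (a * u + b * w)\<^sup>2 / 2 + - (b * u - a * w)\<^sup>2 / 2 = - u\<^sup>2 / 2 + - w\<^sup>2 / 2" by simp
    from arg_cong[OF this, of exp] show ?thesis
      unfolding exp_add by (simp add: std_normal_density_def)
  qed
  have "(\<integral>\<^sup>+x. \<integral>\<^sup>+y. f (a * x + b * y, b * x - a * y) \<partial>std_normal \<partial>std_normal) =
    (\<integral>\<^sup>+x. \<integral>\<^sup>+y. ennreal (std_normal_density x * std_normal_density y) * f (a * x + b * y, b * x - a * y) \<partial>lborel \<partial>lborel)"
    using nn_integral_std_normal_pair[of "\<lambda>(x, y). f (a * x + b * y, b * x - a * y)"] by simp
  also have "\<dots> = (\<integral>\<^sup>+u. \<integral>\<^sup>+w. ennreal (std_normal_density u * std_normal_density w) * f (u, w) \<partial>lborel \<partial>lborel)"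
    using nn_integral_lborel_rotation[OF ab, of "\<lambda>(x, y). ennreal (std_normal_density x * std_normal_density y) * f (a * x + b * y, b * x - a * y)"]
    by (simp add: i1 i2 i3)
  also have "\<dots> = (\<integral>\<^sup>+u. \<integral>\<^sup>+w. f (u, w) \<partial>std_normal \<partial>std_normal)"
    by (rule nn_integral_std_normal_pair[symmetric]) measurable
  finally show ?thesis .
qed

lemma prob_space_std_normal: "prob_space std_normal"
  by (rule prob_space_normal_density) simp

lemma sets_chi_square [simp, measurable_cong]: "sets (chi_square k) = sets borel"
  by (simp add: chi_square_def)

lemma prob_space_chi_square: "prob_space (chi_square k)"
  unfolding chi_square_def
  by (intro prob_space.prob_space_distr prob_space_PiM prob_space_std_normal) measurable

lemma nn_integral_chi_square_Suc:
  assumes [measurable]: "f \<in> borel_measurable borel"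
  shows "(\<integral>\<^sup>+y. f y \<partial>chi_square (Suc n)) = (\<integral>\<^sup>+y. \<integral>\<^sup>+w. f (y + w\<^sup>2) \<partial>std_normal \<partial>chi_square n)"
proof -
  interpret S: prob_space std_normal by (rule prob_space_std_normal)
  interpret P: product_sigma_finite "\<lambda>_ :: nat. std_normal" by standard
  have "(\<integral>\<^sup>+y. f y \<partial>chi_square (Suc n)) =
      (\<integral>\<^sup>+z. f (\<Sum>i<Suc n. (z i)\<^sup>2) \<partial>(\<Pi>\<^sub>M i\<in>insert n {..<n}. std_normal))"
    unfolding chi_square_def lessThan_Suc[symmetric] by (subst nn_integral_distr) auto
  also have "\<dots> = (\<integral>\<^sup>+z. \<integral>\<^sup>+w. f (\<Sum>i<Suc n. ((z(n := w)) i)\<^sup>2) \<partial>std_normal \<partial>(\<Pi>\<^sub>M i\<in>{..<n}. std_normal))"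
  proof (rule P.product_nn_integral_insert)
    show "(\<lambda>z. f (\<Sum>i<Suc n. (z i)\<^sup>2)) \<in> borel_measurable (\<Pi>\<^sub>M i\<in>insert n {..<n}. std_normal)"
      unfolding lessThan_Suc[symmetric] by measurable
  qed auto
  also have "\<dots> = (\<integral>\<^sup>+z. \<integral>\<^sup>+w. f ((\<Sum>i<n. (z i)\<^sup>2) + w\<^sup>2) \<partial>std_normal \<partial>(\<Pi>\<^sub>M i\<in>{..<n}. std_normal))"
    by simp
  also have "\<dots> = (\<integral>\<^sup>+y. \<integral>\<^sup>+w. f (y + w\<^sup>2) \<partial>std_normal \<partial>chi_square n)"
    unfolding chi_square_def by (subst nn_integral_distr) auto
  finally show ?thesis .
qed

text \<open>Induction on the sample size: a new sample point and the previous normalized mean are mapped by a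
  rotation of the plane to the new normalized mean and an independent increment of the sum of squares.\<close>

lemma nn_integral_std_normal_sample:
  assumes "f \<in> borel_measurable (borel \<Otimes>\<^sub>M borel)"
  shows "(\<integral>\<^sup>+G. f ((\<Sum>i<Suc n. G i) / sqrt (real (Suc n)), (\<Sum>i<Suc n. (G i)\<^sup>2) - (\<Sum>i<Suc n. G i)\<^sup>2 / real (Suc n))
      \<partial>(\<Pi>\<^sub>M i\<in>{..<Suc n}. std_normal)) =
    (\<integral>\<^sup>+v. \<integral>\<^sup>+y. f (v, y) \<partial>chi_square n \<partial>std_normal)"
  using assms
proof (induction n arbitrary: f)
  case 0
  interpret S: prob_space std_normal by (rule prob_space_std_normal)
  interpret P: product_sigma_finite "\<lambda>_ :: nat. std_normal" by standard
  note [measurable] = 0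
  \<comment> \<open>A sample of one point has no deviation from its mean, which matches the point
    mass \<open>chi_square 0\<close>; the index \<open>n\<close> counts degrees of freedom, one less
    than the sample size.\<close>
  have I: "{..<Suc 0} = {0}" by auto
  have "(\<integral>\<^sup>+G. f (G 0, 0) \<partial>(\<Pi>\<^sub>M i\<in>{0::nat}. std_normal)) = (\<integral>\<^sup>+v. f (v, 0) \<partial>std_normal)"
    by (rule P.product_nn_integral_singleton) measurable
  moreover have "(\<integral>\<^sup>+y. f (v, y) \<partial>chi_square 0) = f (v, 0)" for v
    unfolding chi_square_0 by (rule nn_integral_return) measurable
  ultimately show ?case by (simp add: I)
next
  case (Suc n)
  interpret S: prob_space std_normal by (rule prob_space_std_normal)
  interpret C: prob_space "chi_square n" by (rule prob_space_chi_square)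
  interpret P: product_sigma_finite "\<lambda>_ :: nat. std_normal" by standard
  interpret SS: pair_prob_space std_normal std_normal ..
  interpret SC: pair_prob_space std_normal "chi_square n" ..
  interpret CS: pair_prob_space "chi_square n" std_normal ..
  note [measurable] = Suc.prems
  let ?k = "real (Suc n)" and ?S = "std_normal"
  \<comment> \<open>Direction cosines: with m the normalized mean of the first \<open>Suc n\<close>
    points, the new normalized mean is a m + b g, and (b m - a g)^2 is exactly what the sum of
    squared deviations gains.\<close>
  define a b where "a = sqrt ?k / sqrt (?k + 1)" and "b = 1 / sqrt (?k + 1)"
  have ab: "a\<^sup>2 + b\<^sup>2 = 1" "b > 0"
    by (simp_all add: a_def b_def power_divide add_divide_distrib[symmetric])
  have id: "((\<Sum>i<Suc n. G i) + g) / sqrt (?k + 1) = a * ((\<Sum>i<Suc n. G i) / sqrt ?k) + b * g" (is ?t1)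
    "((\<Sum>i<Suc n. (G i)\<^sup>2) + g\<^sup>2) - ((\<Sum>i<Suc n. G i) + g)\<^sup>2 / (?k + 1) =
     ((\<Sum>i<Suc n. (G i)\<^sup>2) - (\<Sum>i<Suc n. G i)\<^sup>2 / ?k) + (b * ((\<Sum>i<Suc n. G i) / sqrt ?k) - a * g)\<^sup>2" (is ?t2)
    for G :: "nat \<Rightarrow> real" and g
  proof -
    define s where "s = (\<Sum>i<Suc n. G i)"
    define m where "m = s / sqrt ?k"
    have sm: "s = sqrt ?k * m" "s\<^sup>2 / ?k = m\<^sup>2" by (simp_all add: m_def power_divide)
    show 1: ?t1 unfolding s_def[symmetric] by (simp add: a_def b_def add_divide_distrib)
    have "(s + g)\<^sup>2 / (?k + 1) = ((s + g) / sqrt (?k + 1))\<^sup>2" by (simp add: power_divide)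
    also have "(s + g) / sqrt (?k + 1) = a * m + b * g" using 1 unfolding s_def m_def .
    finally have 2: "(s + g)\<^sup>2 / (?k + 1) = (a * m + b * g)\<^sup>2" .
    have "(a * m + b * g)\<^sup>2 + (b * m - a * g)\<^sup>2 = (a\<^sup>2 + b\<^sup>2) * (m\<^sup>2 + g\<^sup>2)"
      by (simp add: algebra_simps power2_eq_square)
    then have 3: "(a * m + b * g)\<^sup>2 + (b * m - a * g)\<^sup>2 = m\<^sup>2 + g\<^sup>2" using ab by simp
    show ?t2 unfolding s_def[symmetric] m_def[symmetric] 2 sm(2) using 3 by simp
  qed
  have "(\<integral>\<^sup>+G. f ((\<Sum>i<Suc (Suc n). G i) / sqrt (real (Suc (Suc n))),
        (\<Sum>i<Suc (Suc n). (G i)\<^sup>2) - (\<Sum>i<Suc (Suc n). G i)\<^sup>2 / real (Suc (Suc n))) \<partial>(\<Pi>\<^sub>M i\<in>{..<Suc (Suc n)}. ?S)) =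
      (\<integral>\<^sup>+g. \<integral>\<^sup>+G. f ((\<Sum>i<Suc (Suc n). (G(Suc n := g)) i) / sqrt (real (Suc (Suc n))),
        (\<Sum>i<Suc (Suc n). ((G(Suc n := g)) i)\<^sup>2) - (\<Sum>i<Suc (Suc n). (G(Suc n := g)) i)\<^sup>2 / real (Suc (Suc n)))
        \<partial>(\<Pi>\<^sub>M i\<in>{..<Suc n}. ?S) \<partial>?S)"
    unfolding lessThan_Suc[of "Suc n"]
    by (rule P.product_nn_integral_insert_rev) auto
  also have "\<dots> = (\<integral>\<^sup>+g. \<integral>\<^sup>+G. f (((\<Sum>i<Suc n. G i) + g) / sqrt (?k + 1),
        ((\<Sum>i<Suc n. (G i)\<^sup>2) + g\<^sup>2) - ((\<Sum>i<Suc n. G i) + g)\<^sup>2 / (?k + 1)) \<partial>(\<Pi>\<^sub>M i\<in>{..<Suc n}. ?S) \<partial>?S)"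
  proof -
    have "(\<Sum>i<Suc (Suc n). (G(Suc n := g)) i) = (\<Sum>i<Suc n. G i) + g"
      "(\<Sum>i<Suc (Suc n). ((G(Suc n := g)) i)\<^sup>2) = (\<Sum>i<Suc n. (G i)\<^sup>2) + g\<^sup>2" for G :: "nat \<Rightarrow> real" and g
      unfolding sum.lessThan_Suc[of _ "Suc n"] by (auto intro!: sum.cong arg_cong2[where f="(+)"])
    moreover have "real (Suc (Suc n)) = ?k + 1" by simp
    ultimately show ?thesis by presburger
  qed
  also have "\<dots> = (\<integral>\<^sup>+g. \<integral>\<^sup>+v. \<integral>\<^sup>+y. f (a * v + b * g, y + (b * v - a * g)\<^sup>2) \<partial>chi_square n \<partial>?S \<partial>?S)"
    unfolding id
  proof (rule nn_integral_cong)
    fix g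
    show "(\<integral>\<^sup>+G. f (a * ((\<Sum>i<Suc n. G i) / sqrt ?k) + b * g, ((\<Sum>i<Suc n. (G i)\<^sup>2) - (\<Sum>i<Suc n. G i)\<^sup>2 / ?k) +
          (b * ((\<Sum>i<Suc n. G i) / sqrt ?k) - a * g)\<^sup>2) \<partial>(\<Pi>\<^sub>M i\<in>{..<Suc n}. ?S)) =
        (\<integral>\<^sup>+v. \<integral>\<^sup>+y. f (a * v + b * g, y + (b * v - a * g)\<^sup>2) \<partial>chi_square n \<partial>?S)"
      using Suc.IH[of "\<lambda>(v, y). f (a * v + b * g, y + (b * v - a * g)\<^sup>2)"] by simp
  qed
  also have "\<dots> = (\<integral>\<^sup>+v. \<integral>\<^sup>+g. \<integral>\<^sup>+y. f (a * v + b * g, y + (b * v - a * g)\<^sup>2) \<partial>chi_square n \<partial>?S \<partial>?S)"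
    by (rule SS.Fubini') measurable
  also have "\<dots> = (\<integral>\<^sup>+u. \<integral>\<^sup>+w. \<integral>\<^sup>+y. f (u, y + w\<^sup>2) \<partial>chi_square n \<partial>?S \<partial>?S)"
    using std_normal_rotation[OF ab, of "\<lambda>(u, w). \<integral>\<^sup>+y. f (u, y + w\<^sup>2) \<partial>chi_square n"] by simp
  also have "\<dots> = (\<integral>\<^sup>+u. \<integral>\<^sup>+y. \<integral>\<^sup>+w. f (u, y + w\<^sup>2) \<partial>?S \<partial>chi_square n \<partial>?S)"
    by (intro nn_integral_cong CS.Fubini') measurable
  also have "\<dots> = (\<integral>\<^sup>+u. \<integral>\<^sup>+y. f (u, y) \<partial>chi_square (Suc n) \<partial>?S)"
    by (intro nn_integral_cong nn_integral_chi_square_Suc[symmetric]) measurable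
  finally show ?case .
qed

section \<open>The limit statistic and its critical value\<close>

abbreviation limit_law :: "nat \<Rightarrow> (real \<times> real \<times> real \<times> real) measure" where
  "limit_law k \<equiv> std_normal \<Otimes>\<^sub>M std_normal \<Otimes>\<^sub>M
     std_normal \<Otimes>\<^sub>M chi_square k"

abbreviation borel4 :: "(real \<times> real \<times> real \<times> real) measure" where
  "borel4 \<equiv> borel \<Otimes>\<^sub>M borel \<Otimes>\<^sub>M borel \<Otimes>\<^sub>M borel"

text \<open>Separated from \<open>limit_stat\<close> so that coverage can be written without a
  division, as a comparison of numerator and denominator that stays meaningful where the denominator
  is 0.\<close>

definition limit_denom :: "nat \<Rightarrow> real \<Rightarrow> real \<Rightarrow> real \<times> real \<times> real \<times> real \<Rightarrow> real" where
  "limit_denom B \<theta> \<rho> = (\<lambda>(v1, v2, v3, y).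
     sqrt ((\<theta>\<^sup>2 + \<rho>\<^sup>2) / real B * (y + v3\<^sup>2)
           - 2 * sqrt ((\<theta>\<^sup>2 + \<rho>\<^sup>2) / real B) * v3 * v2 + v2\<^sup>2))"

lemma limit_stat_eq: "limit_stat B \<theta> \<rho> (v1, v2, v3, y) = (\<theta> * v1 + v2) / limit_denom B \<theta> \<rho> (v1, v2, v3, y)"
  by (simp add: limit_stat_def limit_denom_def)

text \<open>In this form the radicand is visibly nonnegative for y \<ge> 0, and the square alone is
  a lower bound for it.\<close>

lemma limit_denom_complete_square:
  "limit_denom B \<theta> \<rho> (v1, v2, v3, y) =
     sqrt ((\<theta>\<^sup>2 + \<rho>\<^sup>2) / real B * y + (sqrt ((\<theta>\<^sup>2 + \<rho>\<^sup>2) / real B) * v3 - v2)\<^sup>2)"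
proof -
  define k where "k = sqrt ((\<theta>\<^sup>2 + \<rho>\<^sup>2) / real B)"
  have k: "(\<theta>\<^sup>2 + \<rho>\<^sup>2) / real B = k\<^sup>2" by (simp add: k_def)
  show ?thesis unfolding limit_denom_def k_def[symmetric] k by (simp add: algebra_simps power2_eq_square)
qed

lemma limit_measurable [measurable]:
  "limit_stat B \<theta> \<rho> \<in> borel_measurable borel4"
  "limit_denom B \<theta> \<rho> \<in> borel_measurable borel4"
  unfolding limit_stat_def limit_denom_def by measurable

lemma space_chi_square [simp]: "space (chi_square k) = UNIV"
  using sets_eq_imp_space_eq[OF sets_chi_square[of k]] by simp

lemma space_limit_law [simp]: "space (limit_law k) = UNIV"
  by (simp add: space_pair_measure)

lemma sets_Collect_borel4 [measurable (raw)]: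
  fixes P :: "real \<times> real \<times> real \<times> real \<Rightarrow> bool"
  assumes "Measurable.pred borel4 P"
  shows "{w. P w} \<in> sets borel4"
  using assms by (simp add: pred_def space_pair_measure)

lemma prob_space_limit_law: "prob_space (limit_law k)"
  by (intro prob_space_pair prob_space_std_normal prob_space_chi_square)

lemma nn_integral_limit_law:
  assumes [measurable]: "f \<in> borel_measurable borel4"
  shows "(\<integral>\<^sup>+w. f w \<partial>limit_law k) = (\<integral>\<^sup>+v1. \<integral>\<^sup>+v2. \<integral>\<^sup>+v3. \<integral>\<^sup>+y. f (v1, v2, v3, y)
    \<partial>chi_square k \<partial>std_normal \<partial>std_normal \<partial>std_normal)"
proof -
  interpret C: prob_space "chi_square k" by (rule prob_space_chi_square)
  interpret SC: prob_space "std_normal \<Otimes>\<^sub>M chi_square k"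
    by (intro prob_space_pair prob_space_std_normal prob_space_chi_square)
  interpret SSC: prob_space "std_normal \<Otimes>\<^sub>M std_normal \<Otimes>\<^sub>M chi_square k"
    by (intro prob_space_pair prob_space_std_normal prob_space_chi_square)
  show ?thesis
    by (subst SSC.nn_integral_fst[symmetric], measurable)
       (subst SC.nn_integral_fst[symmetric], measurable, subst C.nn_integral_fst[symmetric], measurable)
qed

lemma AE_limit_lawI:
  assumes P [measurable]: "Measurable.pred borel4 P"
    and AE: "\<And>v1 v2. AE v3 in std_normal. AE y in chi_square k. P (v1, v2, v3, y)"
  shows "AE w in limit_law k. P w"
proof -
  interpret S: prob_space std_normal by (rule prob_space_std_normal)
  interpret C: prob_space "chi_square k" by (rule prob_space_chi_square)
  interpret SC: prob_space "std_normal \<Otimes>\<^sub>M chi_square k"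
    by (intro prob_space_pair prob_space_std_normal prob_space_chi_square)
  interpret SSC: prob_space "std_normal \<Otimes>\<^sub>M std_normal \<Otimes>\<^sub>M chi_square k"
    by (intro prob_space_pair prob_space_std_normal prob_space_chi_square)
  interpret P1: pair_sigma_finite std_normal "chi_square k" ..
  interpret P2: pair_sigma_finite std_normal "std_normal \<Otimes>\<^sub>M chi_square k" ..
  interpret P3: pair_sigma_finite std_normal "std_normal \<Otimes>\<^sub>M std_normal \<Otimes>\<^sub>M chi_square k" ..
  show ?thesis
  proof (rule P3.AE_pair_measure)
    show "AE v1 in std_normal. AE w in std_normal \<Otimes>\<^sub>M std_normal \<Otimes>\<^sub>M chi_square k. P (v1, w)"
    proof (rule AE_I2, rule P2.AE_pair_measure)
      fix v1 :: real
      show "AE v2 in std_normal. AE w in std_normal \<Otimes>\<^sub>M chi_square k. P (v1, v2, w)"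
      proof (rule AE_I2, rule P1.AE_pair_measure)
        fix v2 :: real
        show "AE v3 in std_normal. AE y in chi_square k. P (v1, v2, v3, y)" by (rule AE)
      qed measurable
    qed measurable
  qed measurable
qed

lemma AE_chi_square_nonneg: "AE y in chi_square k. 0 \<le> y"
  unfolding chi_square_def by (subst AE_distr_iff) (auto intro!: sum_nonneg)

lemma AE_std_normal_neq: "AE x in std_normal. x \<noteq> (a :: real)"
  using AE_lborel_singleton[of a] by (auto simp: AE_density)

text \<open>For \<open>B = 1\<close> the chi-square term vanishes, so positivity has to come from
  the square: for fixed \<open>v2\<close> it is zero at a single value of \<open>v3\<close>, a
  Gaussian null set.\<close>

lemma limit_denom_pos:
  assumes "B \<ge> 1" "\<rho> > 0"
  shows "AE w in limit_law k. limit_denom B \<theta> \<rho> w > 0"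
proof (rule AE_limit_lawI)
  fix v1 v2 :: real
  define c where "c = sqrt ((\<theta>\<^sup>2 + \<rho>\<^sup>2) / real B)"
  have c: "c > 0" using assms by (simp add: c_def add_nonneg_pos)
  show "AE v3 in std_normal. AE y in chi_square k. 0 < limit_denom B \<theta> \<rho> (v1, v2, v3, y)"
    using AE_std_normal_neq[of "v2 / c"]
  proof eventually_elim
    case (elim v3)
    then have "c * v3 - v2 \<noteq> 0" using c by (simp add: field_simps)
    then have "(c * v3 - v2)\<^sup>2 > 0" by simp
    then show ?case
      using AE_chi_square_nonneg[of k] unfolding limit_denom_complete_square c_def[symmetric]
      by (auto elim!: eventually_mono intro!: add_nonneg_pos mult_nonneg_nonneg)
  qed
qed measurable

text \<open>The denominator does not involve \<open>v1\<close>. With the other coordinates fixed,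
  equality therefore holds for at most two values of \<open>v1\<close>, because \<theta> > 0;
  exchanging the order of the almost-everywhere quantifiers gives the claim.\<close>

lemma limit_no_atom:
  assumes "\<theta> > 0"
  shows "AE w in limit_law k. \<bar>\<theta> * fst w + fst (snd w)\<bar> \<noteq> q * limit_denom B \<theta> \<rho> w"
proof -
  interpret S: prob_space std_normal by (rule prob_space_std_normal)
  interpret SSC: prob_space "std_normal \<Otimes>\<^sub>M std_normal \<Otimes>\<^sub>M chi_square k"
    by (intro prob_space_pair prob_space_std_normal prob_space_chi_square)
  interpret P3: pair_sigma_finite std_normal "std_normal \<Otimes>\<^sub>M std_normal \<Otimes>\<^sub>M chi_square k" ..
  let ?P = "\<lambda>v1 w. \<bar>\<theta> * v1 + fst w\<bar> \<noteq> q * limit_denom B \<theta> \<rho> (v1, w)"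
  have "AE w in std_normal \<Otimes>\<^sub>M std_normal \<Otimes>\<^sub>M chi_square k. AE v1 in std_normal. ?P v1 w"
  proof (rule AE_I2)
    fix w :: "real \<times> real \<times> real"
    obtain v2 v3 y where w: "w = (v2, v3, y)" by (cases w) auto
    define d where "d = q * limit_denom B \<theta> \<rho> (0, w)"
    have d: "q * limit_denom B \<theta> \<rho> (v1, w) = d" for v1 by (simp add: d_def w limit_denom_def)
    show "AE v1 in std_normal. ?P v1 w"
      using AE_std_normal_neq[of "(d - v2) / \<theta>"] AE_std_normal_neq[of "(- d - v2) / \<theta>"]
    proof eventually_elim
      case (elim v1)
      then have "\<theta> * v1 \<noteq> d - v2" "\<theta> * v1 \<noteq> - d - v2" using assms by (auto simp: field_simps)
      then have "\<bar>\<theta> * v1 + v2\<bar> \<noteq> d" by auto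
      then show ?case unfolding d by (simp add: w)
    qed
  qed
  then have "AE v1 in std_normal. AE w in std_normal \<Otimes>\<^sub>M std_normal \<Otimes>\<^sub>M chi_square k. ?P v1 w"
    by (subst P3.AE_commute) measurable
  then have "AE w in limit_law k. ?P (fst w) (snd w)"
    by (subst P3.AE_pair_iff[symmetric]) measurable
  then show ?thesis by simp
qed

lemma F_O_eq: "F_O B q \<theta> \<rho> = measure (limit_law (B - 1)) {w. limit_stat B \<theta> \<rho> w \<le> q}"
  unfolding F_O_def cdf_def by (subst measure_distr) (auto intro!: arg_cong2[where f=measure])

section \<open>Symmetry, tightness uniform in \<theta>, and attainment of the critical value\<close>

lemma nn_integral_std_normal_uminus:
  assumes [measurable]: "f \<in> borel_measurable borel"
  shows "(\<integral>\<^sup>+x. f (- x) \<partial>std_normal) = (\<integral>\<^sup>+x. f x \<partial>std_normal)"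
proof -
  have "(\<integral>\<^sup>+x. f x \<partial>std_normal) = (\<integral>\<^sup>+x. ennreal (std_normal_density x) * f x \<partial>lborel)"
    by (subst nn_integral_density) auto
  also have "\<dots> = \<bar>- 1 :: real\<bar> * (\<integral>\<^sup>+x. ennreal (std_normal_density (0 + (- 1) * x)) * f (0 + (- 1) * x) \<partial>lborel)"
    by (rule nn_integral_real_affine) auto
  also have "\<dots> = (\<integral>\<^sup>+x. ennreal (std_normal_density x) * f (- x) \<partial>lborel)"
    by (simp add: std_normal_density_def)
  also have "\<dots> = (\<integral>\<^sup>+x. f (- x) \<partial>std_normal)"
    by (subst nn_integral_density) auto
  finally show ?thesis by simp
qed

text \<open>Reversing the signs of \<open>v1\<close>, \<open>v2\<close> and \<open>v3\<close>
  together negates the numerator and keeps the denominator, whose cross term is v3 v2; the three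
  Gaussian integrals are then reflected one after another.\<close>

lemma limit_stat_symmetric:
  "measure (limit_law k) {w. - q \<le> limit_stat B \<theta> \<rho> w} = measure (limit_law k) {w. limit_stat B \<theta> \<rho> w \<le> q}"
proof -
  let ?S = "std_normal" and ?C = "chi_square k"
  interpret S: prob_space ?S by (rule prob_space_std_normal)
  interpret C: prob_space ?C by (rule prob_space_chi_square)
  let ?f = "indicator {w. limit_stat B \<theta> \<rho> w \<le> q} :: _ \<Rightarrow> ennreal"
  have f[measurable]: "?f \<in> borel_measurable borel4"
    by (rule borel_measurable_indicator) measurable
  have neg: "limit_stat B \<theta> \<rho> (- v1, - v2, - v3, y) = - limit_stat B \<theta> \<rho> (v1, v2, v3, y)" for v1 v2 v3 y
    by (simp add: limit_stat_def minus_divide_left algebra_simps)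
  have "emeasure (limit_law k) {w. - q \<le> limit_stat B \<theta> \<rho> w} = (\<integral>\<^sup>+w. indicator {w. - q \<le> limit_stat B \<theta> \<rho> w} w \<partial>limit_law k)"
    by (rule nn_integral_indicator[symmetric]) measurable
  also have "\<dots> = (\<integral>\<^sup>+v1. \<integral>\<^sup>+v2. \<integral>\<^sup>+v3. \<integral>\<^sup>+y. indicator {w. - q \<le> limit_stat B \<theta> \<rho> w} (v1, v2, v3, y) \<partial>?C \<partial>?S \<partial>?S \<partial>?S)"
    by (rule nn_integral_limit_law, rule borel_measurable_indicator) measurable
  also have "\<dots> = (\<integral>\<^sup>+v1. \<integral>\<^sup>+v2. \<integral>\<^sup>+v3. \<integral>\<^sup>+y. ?f (- v1, - v2, - v3, y) \<partial>?C \<partial>?S \<partial>?S \<partial>?S)"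
    by (intro nn_integral_cong) (auto simp: neg indicator_def)
  also have "\<dots> = (\<integral>\<^sup>+v1. \<integral>\<^sup>+v2. \<integral>\<^sup>+v3. \<integral>\<^sup>+y. ?f (- v1, - v2, v3, y) \<partial>?C \<partial>?S \<partial>?S \<partial>?S)"
    by (intro nn_integral_cong nn_integral_std_normal_uminus[where f="\<lambda>v3. \<integral>\<^sup>+y. ?f (- _, - _, v3, y) \<partial>?C"]) measurable
  also have "\<dots> = (\<integral>\<^sup>+v1. \<integral>\<^sup>+v2. \<integral>\<^sup>+v3. \<integral>\<^sup>+y. ?f (- v1, v2, v3, y) \<partial>?C \<partial>?S \<partial>?S \<partial>?S)"
    by (intro nn_integral_cong nn_integral_std_normal_uminus[where f="\<lambda>v2. \<integral>\<^sup>+v3. \<integral>\<^sup>+y. ?f (- _, v2, v3, y) \<partial>?C \<partial>?S"]) measurable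
  also have "\<dots> = (\<integral>\<^sup>+v1. \<integral>\<^sup>+v2. \<integral>\<^sup>+v3. \<integral>\<^sup>+y. ?f (v1, v2, v3, y) \<partial>?C \<partial>?S \<partial>?S \<partial>?S)"
    by (intro nn_integral_std_normal_uminus[where f="\<lambda>v1. \<integral>\<^sup>+v2. \<integral>\<^sup>+v3. \<integral>\<^sup>+y. ?f (v1, v2, v3, y) \<partial>?C \<partial>?S \<partial>?S"]) measurable
  also have "\<dots> = (\<integral>\<^sup>+w. ?f w \<partial>limit_law k)" by (rule nn_integral_limit_law[symmetric]) measurable
  also have "\<dots> = emeasure (limit_law k) {w. limit_stat B \<theta> \<rho> w \<le> q}"
    by (rule nn_integral_indicator) measurable
  finally show ?thesis by (simp add: measure_def)
qed

lemma std_normal_interval_le: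
  assumes "r \<ge> 0"
  shows "emeasure std_normal {x. \<bar>x - u\<bar> < r} \<le> ennreal (2 * r)"
proof -
  have s: "{x. \<bar>x - u\<bar> < r} = {u - r<..<u + r}" by auto
  have "emeasure std_normal {x. \<bar>x - u\<bar> < r} =
      (\<integral>\<^sup>+x. ennreal (std_normal_density x) * indicator {u - r<..<u + r} x \<partial>lborel)"
    unfolding s by (rule emeasure_density) auto
  also have "\<dots> \<le> (\<integral>\<^sup>+x. indicator {u - r<..<u + r} x \<partial>lborel)"
  proof (rule nn_integral_mono)
    fix x :: real
    have "1 \<le> sqrt (2 * pi)" using pi_gt3 by simp
    then have "std_normal_density x \<le> 1"
      by (auto simp: std_normal_density_def divide_le_eq intro: order.trans[of _ 1])
    then show "ennreal (std_normal_density x) * indicator {u - r<..<u + r} x \<le> indicator {u - r<..<u + r} x"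
      by (auto simp: indicator_def)
  qed
  also have "\<dots> = ennreal (2 * r)" using assms by simp
  finally show ?thesis .
qed

text \<open>Guarantees that the minimum defining \<open>q_O\<close> is taken over a nonempty set; \<open>LEAST\<close> would be unspecified otherwise.\<close>

lemma F_O_uniformly_tight:
  assumes B: "B \<ge> 1" and \<rho>: "\<rho> > 0" and e: "e > 0"
  shows "\<exists>q. \<forall>\<theta>\<ge>0. F_O B q \<theta> \<rho> \<ge> 1 - e"
proof -
  interpret L: prob_space "limit_law (B - 1)" by (rule prob_space_limit_law)
  interpret S: prob_space std_normal by (rule prob_space_std_normal)
  interpret C: prob_space "chi_square (B - 1)" by (rule prob_space_chi_square)
  \<comment> \<open>With c = sqrt (\<theta>^2 + \<rho>^2) both \<theta> and \<rho> are at most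
    \<open>c\<close>, so the numerator is at most c W. As \<open>W\<close> itself is free of
    \<theta>, its tail bound \<open>K\<close> serves all \<theta>.\<close>
  define W where "W = (\<lambda>w :: real \<times> real \<times> real \<times> real. \<bar>fst w\<bar> + \<bar>fst (snd w)\<bar> / \<rho>)"
  have [measurable]: "W \<in> borel_measurable borel4" unfolding W_def by measurable
  have "(\<lambda>k::nat. measure (limit_law (B - 1)) {w. real k < W w}) \<longlonglongrightarrow> measure (limit_law (B - 1)) (\<Inter>k. {w. real k < W w})"
  proof (rule L.finite_Lim_measure_decseq)
    show "range (\<lambda>k. {w. real k < W w}) \<subseteq> sets (limit_law (B - 1))"
      by (rule image_subsetI) measurable
    show "decseq (\<lambda>k. {w. real k < W w})" by (auto simp: decseq_def)
  qed
  also have "(\<Inter>k. {w. real k < W w}) = {}"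
  proof (rule equals0I)
    fix w assume w: "w \<in> (\<Inter>k. {w. real k < W w})"
    obtain k where "W w \<le> real k" using real_arch_simple by blast
    moreover have "real k < W w" using w by blast
    ultimately show False by simp
  qed
  finally have "\<forall>\<^sub>F k in sequentially. measure (limit_law (B - 1)) {w. real k < W w} < e / 2"
    using e by (intro order_tendstoD(2)[where y=0]) auto
  then obtain k0 where k0: "\<And>k. k \<ge> k0 \<Longrightarrow> measure (limit_law (B - 1)) {w. real k < W w} < e / 2"
    by (auto simp: eventually_sequentially)
  define K where "K = real (Suc k0)"
  have K: "K > 0" "measure (limit_law (B - 1)) {w. K < W w} < e / 2"
    using k0[of "Suc k0"] by (auto simp: K_def)
  \<comment> \<open>Chosen so that q k (e / 4) = c K, where k = c / sqrt B is the coefficient of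
    \<open>v3\<close> below: the growth of numerator and denominator in \<theta> cancels.\<close>
  define q where "q = 4 * sqrt (real B) * K / e"
  have q: "q > 0" using B K e by (simp add: q_def)
  show ?thesis
  proof (intro exI[of _ q] allI impI)
    fix \<theta> :: real assume \<theta>: "\<theta> \<ge> 0"
    define c where "c = sqrt (\<theta>\<^sup>2 + \<rho>\<^sup>2)"
    define k where "k = sqrt ((\<theta>\<^sup>2 + \<rho>\<^sup>2) / real B)"
    have c: "c \<ge> \<theta>" "c \<ge> \<rho>" unfolding c_def by (simp_all add: real_le_rsqrt)
    have k: "k = c / sqrt (real B)" by (simp add: k_def c_def real_sqrt_divide)
    have kpos: "k > 0" "c > 0" using c \<rho> B by (auto simp: k)
    \<comment> \<open>The event of a small denominator. Given \<open>v2\<close>, it confines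
      \<open>v3\<close> to an interval of length e / 2, and the normal density is at most 1.\<close>
    let ?V = "{w :: real \<times> real \<times> real \<times> real. \<bar>fst (snd (snd w)) - fst (snd w) / k\<bar> < e / 4}"
    have V[measurable]: "?V \<in> sets borel4"
      by measurable
    have "emeasure (limit_law (B - 1)) ?V = (\<integral>\<^sup>+w. indicator ?V w \<partial>limit_law (B - 1))"
      by (rule nn_integral_indicator[symmetric]) measurable
    also have "\<dots> = (\<integral>\<^sup>+v1. \<integral>\<^sup>+v2. \<integral>\<^sup>+v3. \<integral>\<^sup>+y. indicator ?V (v1, v2, v3, y)
        \<partial>chi_square (B - 1) \<partial>std_normal \<partial>std_normal \<partial>std_normal)"
      by (rule nn_integral_limit_law) measurable
    also have "\<dots> = (\<integral>\<^sup>+v1. \<integral>\<^sup>+v2. \<integral>\<^sup>+v3. indicator {x. \<bar>x - v2 / k\<bar> < e / 4} v3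
        \<partial>std_normal \<partial>std_normal \<partial>std_normal)"
      by (auto simp: indicator_def C.emeasure_space_1[simplified] intro!: nn_integral_cong)
    also have "\<dots> = (\<integral>\<^sup>+(v1::real). \<integral>\<^sup>+v2. emeasure std_normal {x. \<bar>x - v2 / k\<bar> < e / 4}
        \<partial>std_normal \<partial>std_normal)"
      by (intro nn_integral_cong nn_integral_indicator) auto
    also have "\<dots> \<le> (\<integral>\<^sup>+(v1::real). \<integral>\<^sup>+(v2::real). ennreal (2 * (e / 4)) \<partial>std_normal \<partial>std_normal)"
      using e by (intro nn_integral_mono std_normal_interval_le) auto
    also have "\<dots> = ennreal (e / 2)" using S.emeasure_space_1 by simp
    finally have mV: "measure (limit_law (B - 1)) ?V \<le> e / 2"
      using e unfolding L.emeasure_eq_measure by (subst (asm) ennreal_le_iff) auto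
    have "measure (limit_law (B - 1)) {w. \<not> limit_stat B \<theta> \<rho> w \<le> q} \<le> measure (limit_law (B - 1)) ({w. K < W w} \<union> ?V)"
    proof (rule L.finite_measure_mono_AE)
      have y0: "AE w in limit_law (B - 1). 0 \<le> snd (snd (snd w))"
        by (rule AE_limit_lawI) (auto intro: AE_chi_square_nonneg)
      show "AE w in limit_law (B - 1). w \<in> {w. \<not> limit_stat B \<theta> \<rho> w \<le> q} \<longrightarrow> w \<in> {w. K < W w} \<union> ?V"
        using y0 limit_denom_pos[OF B \<rho>, where k="B - 1" and \<theta>=\<theta>]
      proof (eventually_elim, intro impI)
        fix w
        assume y: "0 \<le> snd (snd (snd w))" and d: "0 < limit_denom B \<theta> \<rho> w" and "w \<in> {w. \<not> limit_stat B \<theta> \<rho> w \<le> q}"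
        obtain v1 v2 v3 y where w: "w = (v1, v2, v3, y)" by (cases w) auto
        have y: "0 \<le> y" and T: "q < limit_stat B \<theta> \<rho> (v1, v2, v3, y)"
          using y \<open>w \<in> _\<close> by (auto simp: w)
        show "w \<in> {w. K < W w} \<union> ?V"
        proof (cases "K < W w")
          case False
          then have WK: "\<bar>v1\<bar> + \<bar>v2\<bar> / \<rho> \<le> K" by (simp add: W_def w)
          have "q * \<bar>k * v3 - v2\<bar> \<le> q * limit_denom B \<theta> \<rho> (v1, v2, v3, y)"
            unfolding limit_denom_complete_square k_def[symmetric] using y q
            by (intro mult_left_mono) (auto intro!: real_le_rsqrt)
          also have "\<dots> < \<theta> * v1 + v2"
            using T d by (simp add: limit_stat_eq w field_simps)
          also have "\<dots> \<le> \<theta> * \<bar>v1\<bar> + \<rho> * (\<bar>v2\<bar> / \<rho>)"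
            using \<theta> \<rho> by (intro add_mono mult_left_mono) auto
          also have "\<dots> \<le> c * \<bar>v1\<bar> + c * (\<bar>v2\<bar> / \<rho>)"
            using c \<rho> by (intro add_mono mult_right_mono) auto
          also have "\<dots> = c * (\<bar>v1\<bar> + \<bar>v2\<bar> / \<rho>)" by (simp add: algebra_simps)
          also have "\<dots> \<le> c * K" using WK kpos by (intro mult_left_mono) auto
          finally have "q * \<bar>k * v3 - v2\<bar> < c * K" .
          moreover have "k * v3 - v2 = k * (v3 - v2 / k)" using kpos by (simp add: field_simps)
          ultimately have "q * k * \<bar>v3 - v2 / k\<bar> < c * K" using kpos by (simp add: abs_mult mult.assoc)
          moreover have "q * k * (e / 4) = c * K" using B e by (simp add: q_def k)
          ultimately have "q * k * \<bar>v3 - v2 / k\<bar> < q * k * (e / 4)" by simp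
          then have "\<bar>v3 - v2 / k\<bar> < e / 4" using q kpos by simp
          then show ?thesis by (simp add: w)
        qed simp
      qed
    qed measurable
    also have "\<dots> \<le> measure (limit_law (B - 1)) {w. K < W w} + measure (limit_law (B - 1)) ?V"
      by (rule measure_Un_le) measurable
    also have "\<dots> \<le> e" using K mV by simp
    finally have "measure (limit_law (B - 1)) {w. \<not> limit_stat B \<theta> \<rho> w \<le> q} \<le> e" .
    moreover have "{w \<in> space (limit_law (B - 1)). limit_stat B \<theta> \<rho> w \<le> q} \<in> sets (limit_law (B - 1))" by measurable
    then have "measure (limit_law (B - 1)) {w \<in> space (limit_law (B - 1)). \<not> limit_stat B \<theta> \<rho> w \<le> q} = 1 - measure (limit_law (B - 1)) {w \<in> space (limit_law (B - 1)). limit_stat B \<theta> \<rho> w \<le> q}"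
      by (rule L.prob_neg)
    ultimately show "1 - e \<le> F_O B q \<theta> \<rho>" unfolding F_O_eq by simp
  qed
qed

text \<open>\<open>LEAST\<close> is an attained minimum here: the admissible set \<open>A\<close> is
  nonempty by uniform tightness, bounded below by 0, and contains its infimum because each
  distribution function is right-continuous and each constraint can be passed to the limit
  separately.\<close>

lemma F_O_q_O:
  assumes B: "B \<ge> 1" and \<rho>: "\<rho> > 0" and \<beta>: "1 / 2 < \<beta>" "\<beta> < 1" and \<theta>: "\<theta> \<ge> 0"
  shows "\<beta> \<le> F_O B (q_O B \<rho> \<beta>) \<theta> \<rho>"
proof -
  interpret L: prob_space "limit_law (B - 1)" by (rule prob_space_limit_law)
  have rd: "real_distribution (distr (limit_law (B - 1)) borel (limit_stat B \<theta> \<rho>))" for \<theta>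
    by (rule L.real_distribution_distr) measurable
  define A where "A = {q. \<forall>\<theta>\<ge>0. \<beta> \<le> F_O B q \<theta> \<rho>}"
  have INF_iff: "\<beta> \<le> (INF \<theta>\<in>{0..}. F_O B q \<theta> \<rho>) \<longleftrightarrow> q \<in> A" for q
  proof -
    have "bdd_below ((\<lambda>\<theta>. F_O B q \<theta> \<rho>) ` {0..})"
      by (intro bdd_belowI2[where m=0]) (simp add: F_O_eq)
    then show ?thesis by (subst le_cINF_iff) (auto simp: A_def)
  qed
  obtain q1 where "q1 \<in> A"
    using F_O_uniformly_tight[OF B \<rho>, of "1 - \<beta>"] \<beta> by (auto simp: A_def)
  \<comment> \<open>For q < 0 the events T \<le> q and T \<ge> -q would be disjoint, and by symmetry
    each would have probability at least \<beta> > 1 / 2. The single value \<theta> = 0 suffices for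
    this.\<close>
  have A0: "0 \<le> q" if "q \<in> A" for q
  proof (rule ccontr)
    assume "\<not> 0 \<le> q"
    have F: "\<beta> \<le> measure (limit_law (B - 1)) {w. limit_stat B 0 \<rho> w \<le> q}" using that by (auto simp: A_def F_O_eq)
    have "measure (limit_law (B - 1)) {w. limit_stat B 0 \<rho> w \<le> q} + measure (limit_law (B - 1)) {w. - q \<le> limit_stat B 0 \<rho> w} =
        measure (limit_law (B - 1)) ({w. limit_stat B 0 \<rho> w \<le> q} \<union> {w. - q \<le> limit_stat B 0 \<rho> w})"
      using \<open>\<not> 0 \<le> q\<close> by (intro L.finite_measure_Union[symmetric]) (measurable, auto)
    also have "\<dots> \<le> 1" by (rule L.prob_le_1)
    finally show False using F \<beta> unfolding limit_stat_symmetric by simp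
  qed
  have bdd: "bdd_below A" using A0 by (intro bdd_belowI[where m=0])
  define q0 where "q0 = Inf A"
  have "q0 \<in> A"
    unfolding A_def
  proof (intro CollectI allI impI)
    fix \<theta> :: real assume \<theta>: "\<theta> \<ge> 0"
    interpret D: real_distribution "distr (limit_law (B - 1)) borel (limit_stat B \<theta> \<rho>)" by (rule rd)
    have "((\<lambda>q. F_O B q \<theta> \<rho>) \<longlongrightarrow> F_O B q0 \<theta> \<rho>) (at_right q0)"
      using D.cdf_is_right_cont[of q0] unfolding continuous_within F_O_def by simp
    moreover have "\<forall>\<^sub>F q in at_right q0. \<beta> \<le> F_O B q \<theta> \<rho>"
    proof (rule eventually_at_rightI[of q0 "q0 + 1"])
      fix q assume "q \<in> {q0<..<q0 + 1}"
      then obtain a where "a \<in> A" "a < q"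
        using cInf_lessD[of A q] \<open>q1 \<in> A\<close> by (auto simp: q0_def)
      then have "\<beta> \<le> F_O B a \<theta> \<rho>" using \<theta> by (simp add: A_def)
      also have "\<dots> \<le> F_O B q \<theta> \<rho>" unfolding F_O_def using \<open>a < q\<close> by (intro D.cdf_nondecreasing) simp
      finally show "\<beta> \<le> F_O B q \<theta> \<rho>" .
    qed simp
    ultimately show "\<beta> \<le> F_O B q0 \<theta> \<rho>"
      by (intro tendsto_lowerbound[of _ _ "at_right q0"]) auto
  qed
  then have "q_O B \<rho> \<beta> = q0"
    unfolding q_O_def INF_iff by (rule Least_equality) (auto simp: q0_def intro: cInf_lower bdd)
  then show ?thesis using \<open>q0 \<in> A\<close> \<theta> by (simp add: A_def)
qed

text \<open>Inclusion-exclusion for the two one-sided events, which are equally likely by symmetry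
  and each have probability at least \<beta>. The strict inequality, available since ties are null,
  is the form that continuous minorants can approximate from below.\<close>

lemma limit_coverage:
  assumes B: "B \<ge> 1" and \<rho>: "\<rho> > 0" and \<beta>: "1 / 2 < \<beta>" "\<beta> < 1" and \<theta>: "\<theta> > 0"
  shows "2 * \<beta> - 1 \<le> measure (limit_law (B - 1))
    {w. \<bar>\<theta> * fst w + fst (snd w)\<bar> < q_O B \<rho> \<beta> * limit_denom B \<theta> \<rho> w}"
proof -
  interpret L: prob_space "limit_law (B - 1)" by (rule prob_space_limit_law)
  define q where "q = q_O B \<rho> \<beta>"
  let ?U = "{w. limit_stat B \<theta> \<rho> w \<le> q}" and ?L = "{w. - q \<le> limit_stat B \<theta> \<rho> w}"
  have U: "\<beta> \<le> measure (limit_law (B - 1)) ?U"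
    using F_O_q_O[OF B \<rho> \<beta>, of \<theta>] \<theta> by (simp add: F_O_eq q_def)
  have "measure (limit_law (B - 1)) (?U \<union> ?L) = measure (limit_law (B - 1)) ?U + measure (limit_law (B - 1)) ?L - measure (limit_law (B - 1)) (?U \<inter> ?L)"
    by (rule measure_Un3) (unfold L.fmeasurable_eq_sets, measurable)
  then have "2 * \<beta> - 1 \<le> measure (limit_law (B - 1)) (?U \<inter> ?L)"
    using U L.prob_le_1[of "?U \<union> ?L"] unfolding limit_stat_symmetric by simp
  also have "\<dots> \<le> measure (limit_law (B - 1)) {w. \<bar>\<theta> * fst w + fst (snd w)\<bar> < q * limit_denom B \<theta> \<rho> w}"
  proof (rule L.finite_measure_mono_AE)
    show "AE w in limit_law (B - 1). w \<in> ?U \<inter> ?L \<longrightarrow> w \<in> {w. \<bar>\<theta> * fst w + fst (snd w)\<bar> < q * limit_denom B \<theta> \<rho> w}"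
      using limit_denom_pos[OF B \<rho>, where k="B - 1" and \<theta>=\<theta>] limit_no_atom[OF \<theta>, where k="B - 1" and q=q and B=B and \<rho>=\<rho>]
    proof eventually_elim
      case (elim w)
      obtain v1 v2 v3 y where w: "w = (v1, v2, v3, y)" by (cases w) auto
      show ?case
        using elim by (auto simp: w limit_stat_eq field_simps)
    qed
  qed measurable
  finally show ?thesis by (simp add: q_def)
qed

text \<open>With \<theta> = \<sigma> / \<eta>, dividing the event by \<eta> turns it into the one
  for the limit statistic: \<open>v3\<close> is the normalized sum of the \<open>G b\<close> and
  \<open>y\<close> their sum of squared deviations, which are independent of each other with the
  required laws.\<close>

lemma normal_sample_coverage:
  assumes B: "B \<ge> 1" and \<rho>: "\<rho> > 0" and \<beta>: "1 / 2 < \<beta>" "\<beta> < 1" and pos: "\<sigma> > 0" "\<eta> > 0" "s > 0"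
    and s: "s\<^sup>2 = \<sigma>\<^sup>2 + \<eta>\<^sup>2 * \<rho>\<^sup>2"
  shows "ennreal (2 * \<beta> - 1) \<le> (\<integral>\<^sup>+v1. \<integral>\<^sup>+v2. \<integral>\<^sup>+G.
      indicator {G. \<bar>\<sigma> * v1 + \<eta> * v2\<bar> < q_O B \<rho> \<beta> * sqrt (1 / real B * (\<Sum>b<B. (s * G b - \<eta> * v2)\<^sup>2))} G
    \<partial>(\<Pi>\<^sub>M i\<in>{..<B}. std_normal) \<partial>std_normal \<partial>std_normal)"
proof -
  interpret L: prob_space "limit_law (B - 1)" by (rule prob_space_limit_law)
  interpret C: prob_space "chi_square (B - 1)" by (rule prob_space_chi_square)
  define q where "q = q_O B \<rho> \<beta>"
  define \<theta> where "\<theta> = \<sigma> / \<eta>"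
  have \<theta>: "\<theta> > 0" using pos by (simp add: \<theta>_def)
  let ?X = "{w. \<bar>\<theta> * fst w + fst (snd w)\<bar> < q * limit_denom B \<theta> \<rho> w}"
  have [measurable]: "?X \<in> sets borel4" by measurable
  have Suc: "Suc (B - 1) = B" using B by simp
  have s': "s\<^sup>2 = \<eta>\<^sup>2 * (\<theta>\<^sup>2 + \<rho>\<^sup>2)" using pos by (simp add: s \<theta>_def power_divide field_simps)
  have sk: "sqrt ((\<theta>\<^sup>2 + \<rho>\<^sup>2) / real B) = s / (\<eta> * sqrt (real B))"
  proof -
    have "(\<theta>\<^sup>2 + \<rho>\<^sup>2) = (s / \<eta>)\<^sup>2" using pos by (simp add: power_divide s')
    then show ?thesis using pos by (simp add: real_sqrt_divide)
  qed
  \<comment> \<open>Expanding the squares uses that the sum of the (G b)^2 is y + v3^2; the cross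
    term supplies the summand with v3 v2.\<close>
  have key: "(v1, v2, (\<Sum>i<B. G i) / sqrt (real B), (\<Sum>i<B. (G i)\<^sup>2) - (\<Sum>i<B. G i)\<^sup>2 / real B) \<in> ?X \<longleftrightarrow>
      \<bar>\<sigma> * v1 + \<eta> * v2\<bar> < q * sqrt (1 / real B * (\<Sum>b<B. (s * G b - \<eta> * v2)\<^sup>2))" for v1 v2 and G :: "nat \<Rightarrow> real"
  proof -
    have "1 / real B * (\<Sum>b<B. (s * G b - \<eta> * v2)\<^sup>2) =
        1 / real B * (s\<^sup>2 * (\<Sum>b<B. (G b)\<^sup>2) - 2 * s * \<eta> * v2 * (\<Sum>b<B. G b) + real B * (\<eta> * v2)\<^sup>2)"
      by (simp add: power2_diff sum.distrib sum_subtractf sum_distrib_left power_mult_distrib algebra_simps)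
    also have "\<dots> = \<eta>\<^sup>2 * ((\<theta>\<^sup>2 + \<rho>\<^sup>2) / real B * ((\<Sum>i<B. (G i)\<^sup>2) - (\<Sum>i<B. G i)\<^sup>2 / real B + ((\<Sum>i<B. G i) / sqrt (real B))\<^sup>2)
           - 2 * sqrt ((\<theta>\<^sup>2 + \<rho>\<^sup>2) / real B) * ((\<Sum>i<B. G i) / sqrt (real B)) * v2 + v2\<^sup>2)"
      unfolding sk s' using B pos by (simp add: power_divide field_simps power2_eq_square)
    finally have "sqrt (1 / real B * (\<Sum>b<B. (s * G b - \<eta> * v2)\<^sup>2)) =
        \<eta> * limit_denom B \<theta> \<rho> (v1, v2, (\<Sum>i<B. G i) / sqrt (real B), (\<Sum>i<B. (G i)\<^sup>2) - (\<Sum>i<B. G i)\<^sup>2 / real B)"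
      using pos by (simp add: limit_denom_def real_sqrt_mult)
    moreover have "\<sigma> * v1 + \<eta> * v2 = \<eta> * (\<theta> * v1 + v2)" using pos by (simp add: \<theta>_def field_simps)
    ultimately show ?thesis using pos by (simp add: abs_mult mult.left_commute[of q])
  qed
  have "ennreal (2 * \<beta> - 1) \<le> emeasure (limit_law (B - 1)) ?X"
    using limit_coverage[OF B \<rho> \<beta> \<theta>] unfolding q_def[symmetric] L.emeasure_eq_measure by (rule ennreal_leI)
  also have "\<dots> = (\<integral>\<^sup>+w. indicator ?X w \<partial>limit_law (B - 1))"
    by (rule nn_integral_indicator[symmetric]) measurable
  also have "\<dots> = (\<integral>\<^sup>+v1. \<integral>\<^sup>+v2. \<integral>\<^sup>+v3. \<integral>\<^sup>+y. indicator ?X (v1, v2, v3, y)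
      \<partial>chi_square (B - 1) \<partial>std_normal \<partial>std_normal \<partial>std_normal)"
    by (rule nn_integral_limit_law) measurable
  also have "\<dots> = (\<integral>\<^sup>+v1. \<integral>\<^sup>+v2. \<integral>\<^sup>+G. indicator ?X (v1, v2, (\<Sum>i<B. G i) / sqrt (real B), (\<Sum>i<B. (G i)\<^sup>2) - (\<Sum>i<B. G i)\<^sup>2 / real B)
    \<partial>(\<Pi>\<^sub>M i\<in>{..<B}. std_normal) \<partial>std_normal \<partial>std_normal)"
  proof (intro nn_integral_cong)
    fix v1 v2 :: real
    show "(\<integral>\<^sup>+v3. \<integral>\<^sup>+y. indicator ?X (v1, v2, v3, y) \<partial>chi_square (B - 1) \<partial>std_normal) =
      (\<integral>\<^sup>+G. indicator ?X (v1, v2, (\<Sum>i<B. G i) / sqrt (real B), (\<Sum>i<B. (G i)\<^sup>2) - (\<Sum>i<B. G i)\<^sup>2 / real B)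
        \<partial>(\<Pi>\<^sub>M i\<in>{..<B}. std_normal))"
      using nn_integral_std_normal_sample[of "\<lambda>w. indicator ?X (v1, v2, w)" "B - 1", symmetric] unfolding Suc by simp
  qed
  also have "\<dots> = (\<integral>\<^sup>+v1. \<integral>\<^sup>+v2. \<integral>\<^sup>+G.
      indicator {G. \<bar>\<sigma> * v1 + \<eta> * v2\<bar> < q * sqrt (1 / real B * (\<Sum>b<B. (s * G b - \<eta> * v2)\<^sup>2))} G
    \<partial>(\<Pi>\<^sub>M i\<in>{..<B}. std_normal) \<partial>std_normal \<partial>std_normal)"
    unfolding indicator_def key by simp
  finally show ?thesis unfolding q_def .
qed

section \<open>Gaussian approximation of the coverage\<close>

text \<open>This is sqrt n times \<open>S_O\<close> in centred coordinates: \<open>e\<close> and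
  \<open>d b\<close> are the scaled deviations of the original and the b-th resample estimate from
  \<psi> of the empirical distribution.\<close>

definition rms_dev :: "nat \<Rightarrow> real \<Rightarrow> (nat \<Rightarrow> real) \<Rightarrow> real" where
  "rms_dev B e d = sqrt (1 / real B * (\<Sum>b<B. (d b - e)\<^sup>2))"

text \<open>A clipped ramp of slope \<open>k\<close> below the coverage indicator; \<open>a\<close>
  is the scaled error of the noise-free estimate, so \<open>a + e\<close> is that of the noisy
  one.\<close>

definition soft_cover :: "real \<Rightarrow> real \<Rightarrow> nat \<Rightarrow> real \<Rightarrow> real \<Rightarrow> (nat \<Rightarrow> real) \<Rightarrow> real" where
  "soft_cover k q B a e d = min 1 (max 0 (k * (q * rms_dev B e d - \<bar>a + e\<bar>)))"

lemma rms_dev_L2_set: "rms_dev B e d = L2_set (\<lambda>b. d b - e) {..<B} / sqrt (real B)"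
  by (simp add: rms_dev_def L2_set_def real_sqrt_divide)

lemma L2_set_diff_le: "\<bar>L2_set f A - L2_set g A\<bar> \<le> L2_set (\<lambda>i. f i - g i) A"
proof -
  have "L2_set f A \<le> L2_set (\<lambda>i. f i - g i) A + L2_set g A"
    using L2_set_triangle_ineq[of "\<lambda>i. f i - g i" g A] by simp
  moreover have "L2_set g A \<le> L2_set (\<lambda>i. g i - f i) A + L2_set f A"
    using L2_set_triangle_ineq[of "\<lambda>i. g i - f i" f A] by simp
  moreover have "L2_set (\<lambda>i. g i - f i) A = L2_set (\<lambda>i. f i - g i) A"
    unfolding L2_set_def by (simp add: power2_commute)
  ultimately show ?thesis by linarith
qed

text \<open>A normalized Euclidean distance, so the triangle inequality applies; the constant shift
  has norm sqrt B times its size, which the normalization cancels.\<close>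

lemma rms_dev_lipschitz_center: "\<bar>rms_dev B e d - rms_dev B e' d\<bar> \<le> \<bar>e - e'\<bar>"
proof (cases "B = 0")
  case False
  have "\<bar>L2_set (\<lambda>b. d b - e) {..<B} - L2_set (\<lambda>b. d b - e') {..<B}\<bar> \<le> L2_set (\<lambda>b. e' - e) {..<B}"
    using L2_set_diff_le[of "\<lambda>b. d b - e" "{..<B}" "\<lambda>b. d b - e'"] by simp
  also have "\<dots> = sqrt (real B) * \<bar>e - e'\<bar>"
    by (simp add: L2_set_constant abs_minus_commute)
  finally show ?thesis
    using False by (simp add: rms_dev_L2_set diff_divide_distrib[symmetric] divide_le_eq mult.commute)
qed (simp add: rms_dev_def)

lemma rms_dev_lipschitz_point: "\<bar>rms_dev B e (d(b := y)) - rms_dev B e (d(b := y'))\<bar> \<le> \<bar>y - y'\<bar>"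
proof (cases "B = 0")
  case False
  have "\<bar>L2_set (\<lambda>i. (d(b := y)) i - e) {..<B} - L2_set (\<lambda>i. (d(b := y')) i - e) {..<B}\<bar>
      \<le> L2_set (\<lambda>i. if i = b then y - y' else 0) {..<B}"
    by (rule order.trans[OF L2_set_diff_le]) (auto intro!: eq_refl L2_set_cong)
  also have "\<dots> \<le> (\<Sum>i<B. \<bar>if i = b then y - y' else 0\<bar>)" by (rule L2_set_le_sum_abs)
  also have "\<dots> \<le> \<bar>y - y'\<bar> * 1"
  proof -
    have "(\<Sum>i<B. \<bar>if i = b then y - y' else 0\<bar>) = (\<Sum>i<B. if i = b then \<bar>y - y'\<bar> else 0)"
      by (intro sum.cong) auto
    then show ?thesis by (simp add: sum.delta)
  qed
  also have "\<dots> \<le> \<bar>y - y'\<bar> * sqrt (real B)" using False by (intro mult_left_mono) auto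
  finally show ?thesis
    using False by (simp add: rms_dev_L2_set diff_divide_distrib[symmetric] divide_le_eq)
qed (simp add: rms_dev_def)

text \<open>Clipping does not increase distances. A move by t changes \<open>rms_dev\<close> by at
  most t, hence its multiple by at most \<bar>q\<bar> t, and \<open>\<bar>a + e\<bar>\<close> by at
  most t; this explains the common constant k (\<bar>q\<bar> + 1).\<close>

lemma soft_cover_lip:
  assumes "k \<ge> 0" and L: "L = k * (\<bar>q\<bar> + 1)"
  shows "lip01 L (\<lambda>a. soft_cover k q B a e d)"
    and "lip01 L (\<lambda>e. soft_cover k q B a e d)"
    and "lip01 L (\<lambda>y. soft_cover k q B a e (d(b := y)))"
proof -
  have clip: "\<bar>min 1 (max 0 (k * x)) - min 1 (max 0 (k * y))\<bar> \<le> L * t"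
    if "\<bar>x - y\<bar> \<le> (\<bar>q\<bar> + 1) * t" for x y t
  proof -
    have "\<bar>min 1 (max 0 (k * x)) - min 1 (max 0 (k * y))\<bar> \<le> \<bar>k * x - k * y\<bar>" by linarith
    also have "\<dots> = k * \<bar>x - y\<bar>" using assms by (simp add: abs_mult flip: right_diff_distrib)
    also have "\<dots> \<le> k * ((\<bar>q\<bar> + 1) * t)" using assms that by (intro mult_left_mono) auto
    finally show ?thesis by (simp add: L mult.assoc)
  qed
  have q: "\<bar>q * s - q * s'\<bar> \<le> \<bar>q\<bar> * t" if "\<bar>s - s'\<bar> \<le> t" for s s' t
    using mult_left_mono[OF that, of "\<bar>q\<bar>"] by (simp add: abs_mult flip: right_diff_distrib)
  have comb: "\<bar>s - \<bar>u\<bar> - (s' - \<bar>u'\<bar>)\<bar> \<le> (\<bar>q\<bar> + 1) * t"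
    if "\<bar>s - s'\<bar> \<le> \<bar>q\<bar> * t" "\<bar>u - u'\<bar> \<le> t" for s s' u u' t
  proof -
    have "\<bar>s - \<bar>u\<bar> - (s' - \<bar>u'\<bar>)\<bar> \<le> \<bar>s - s'\<bar> + \<bar>u - u'\<bar>" by linarith
    also have "\<dots> \<le> \<bar>q\<bar> * t + t" by (rule add_mono[OF that])
    finally show ?thesis by (simp add: distrib_right)
  qed
  show "lip01 L (\<lambda>a. soft_cover k q B a e d)"
    unfolding lip01_def soft_cover_def
  proof (intro conjI allI clip)
    fix x y :: real
    have "\<bar>q * rms_dev B e d - \<bar>x + e\<bar> - (q * rms_dev B e d - \<bar>y + e\<bar>)\<bar> \<le> \<bar>x - y\<bar>" by linarith
    also have "\<dots> \<le> (\<bar>q\<bar> + 1) * \<bar>x - y\<bar>" by (simp add: distrib_right)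
    finally show "\<bar>q * rms_dev B e d - \<bar>x + e\<bar> - (q * rms_dev B e d - \<bar>y + e\<bar>)\<bar> \<le> (\<bar>q\<bar> + 1) * \<bar>x - y\<bar>" .
  qed auto
  show "lip01 L (\<lambda>e. soft_cover k q B a e d)"
    unfolding lip01_def soft_cover_def
  proof (intro conjI allI clip)
    fix x y :: real
    show "\<bar>q * rms_dev B x d - \<bar>a + x\<bar> - (q * rms_dev B y d - \<bar>a + y\<bar>)\<bar> \<le> (\<bar>q\<bar> + 1) * \<bar>x - y\<bar>"
      using comb[OF q[OF rms_dev_lipschitz_center[of B x d y]], of "a + x" "a + y"] by simp
  qed auto
  show "lip01 L (\<lambda>y. soft_cover k q B a e (d(b := y)))"
    unfolding lip01_def soft_cover_def
  proof (intro conjI allI clip)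
    fix x y :: real
    show "\<bar>q * rms_dev B e (d(b := x)) - \<bar>a + e\<bar> - (q * rms_dev B e (d(b := y)) - \<bar>a + e\<bar>)\<bar> \<le> (\<bar>q\<bar> + 1) * \<bar>x - y\<bar>"
      using comb[OF q[OF rms_dev_lipschitz_point[of B e d b x y]], of "a + e" "a + e"] by simp
  qed auto
qed

lemma soft_cover_bounds: "0 \<le> soft_cover k q B a e d" "soft_cover k q B a e d \<le> 1"
  by (auto simp: soft_cover_def)

lemma soft_cover_le_indicator:
  assumes "k \<ge> 0"
  shows "soft_cover k q B a e d \<le> (if \<bar>a + e\<bar> \<le> q * rms_dev B e d then 1 else 0)"
  using assms by (auto simp: soft_cover_def mult_nonneg_nonpos)

text \<open>The ramp is 0 on the boundary of the coverage event for every slope, so the limit is the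
  indicator of the strict event.\<close>

lemma soft_cover_tendsto:
  "(\<lambda>k. soft_cover (real k) q B a e d) \<longlonglongrightarrow> (if \<bar>a + e\<bar> < q * rms_dev B e d then 1 else 0)"
proof -
  define t where "t = q * rms_dev B e d - \<bar>a + e\<bar>"
  show ?thesis
  proof (cases "t > 0")
    case True
    obtain m where m: "1 < real m * t" using reals_Archimedean3[OF True] by blast
    have "soft_cover (real k) q B a e d = 1" if "k \<ge> m" for k
    proof -
      have "real m * t \<le> real k * t" using True that by (intro mult_right_mono) auto
      then show ?thesis using m by (simp add: soft_cover_def t_def)
    qed
    then have "\<forall>\<^sub>F k in sequentially. soft_cover (real k) q B a e d = 1"
      by (auto simp: eventually_sequentially)
    then show ?thesis using True by (simp add: t_def tendsto_eventually)
  next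
    case False
    then have "soft_cover (real k) q B a e d = 0" for k
      by (simp add: soft_cover_def t_def mult_nonneg_nonpos)
    then show ?thesis using False by (simp add: t_def)
  qed
qed

lemma rms_dev_measurable [measurable]:
  assumes [measurable]: "f \<in> borel_measurable M" "g \<in> M \<rightarrow>\<^sub>M (\<Pi>\<^sub>M b\<in>{..<B}. borel)"
  shows "(\<lambda>x. rms_dev B (f x) (g x)) \<in> borel_measurable M"
  unfolding rms_dev_def by measurable

lemma soft_cover_measurable [measurable]:
  assumes [measurable]: "f \<in> borel_measurable M" "h \<in> borel_measurable M" "g \<in> M \<rightarrow>\<^sub>M (\<Pi>\<^sub>M b\<in>{..<B}. borel)"
  shows "(\<lambda>x. soft_cover k q B (f x) (h x) (g x)) \<in> borel_measurable M"
  unfolding soft_cover_def by measurable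

text \<open>For fixed \<open>e\<close> the B resample factors are replaced at cost B e1; the
  resulting average over \<open>d\<close> is Lipschitz in \<open>e\<close>, so the law of
  \<open>e\<close> can be replaced next at cost e0.\<close>

lemma nested_integral_close:
  assumes \<mu>: "real_distribution \<mu>" and \<nu>: "real_distribution \<nu>" and N0: "real_distribution N0" and N1: "real_distribution N1"
    and k: "k \<ge> 0" and L: "L = k * (\<bar>q\<bar> + 1)"
    and close0: "\<And>g. lip01 L g \<Longrightarrow> \<bar>integral\<^sup>L \<mu> g - integral\<^sup>L N0 g\<bar> \<le> e0"
    and close1: "\<And>g. lip01 L g \<Longrightarrow> \<bar>integral\<^sup>L \<nu> g - integral\<^sup>L N1 g\<bar> \<le> e1"
  shows "\<bar>(\<integral>e. \<integral>d. soft_cover k q B a e d \<partial>(\<Pi>\<^sub>M b\<in>{..<B}. \<nu>) \<partial>\<mu>) -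
    (\<integral>e. \<integral>d. soft_cover k q B a e d \<partial>(\<Pi>\<^sub>M b\<in>{..<B}. N1) \<partial>N0)\<bar> \<le> e0 + real B * e1"
proof -
  interpret \<mu>: real_distribution \<mu> by (rule \<mu>)
  interpret \<nu>: real_distribution \<nu> by (rule \<nu>)
  interpret N1: real_distribution N1 by (rule N1)
  have [measurable_cong]: "sets \<mu> = sets borel" "sets \<nu> = sets borel" "sets N1 = sets borel" by simp_all
  interpret P\<nu>: prob_space "\<Pi>\<^sub>M b\<in>{..<B}. \<nu>" by (rule prob_space_PiM) (rule \<nu>.prob_space_axioms)
  interpret PN: prob_space "\<Pi>\<^sub>M b\<in>{..<B}. N1" by (rule prob_space_PiM) (rule N1.prob_space_axioms)
  define g where "g = (\<lambda>e. \<integral>d. soft_cover k q B a e d \<partial>(\<Pi>\<^sub>M b\<in>{..<B}. N1))"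
  define h where "h = (\<lambda>e. \<integral>d. soft_cover k q B a e d \<partial>(\<Pi>\<^sub>M b\<in>{..<B}. \<nu>))"
  have lip: "lip01 L g" "lip01 L h"
    unfolding g_def h_def
    by (intro lip01_integral PN.prob_space_axioms P\<nu>.prob_space_axioms soft_cover_lip[OF k L]; measurable)+
  have gh: "\<bar>h e - g e\<bar> \<le> real B * e1" for e
  proof -
    have "\<bar>h e - g e\<bar> \<le> real (card {..<B}) * e1"
      unfolding g_def h_def
    proof (rule PiM_integral_close[OF _ \<nu> N1, where L=L])
      show "soft_cover k q B a e \<in> borel_measurable (\<Pi>\<^sub>M b\<in>{..<B}. borel)" by measurable
      show "lip01 L (\<lambda>y. soft_cover k q B a e (d(b := y)))" for b d by (rule soft_cover_lip[OF k L])
    qed (auto intro: close1 soft_cover_bounds)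
    then show ?thesis by simp
  qed
  note [measurable] = lip01_measurable[OF lip(1)] lip01_measurable[OF lip(2)]
  have int: "integrable \<mu> h" "integrable \<mu> g"
    by (auto intro!: \<mu>.integrable_01 lip01_bounds[OF lip(1)] lip01_bounds[OF lip(2)])
  have "\<bar>integral\<^sup>L \<mu> h - integral\<^sup>L \<mu> g\<bar> = \<bar>\<integral>e. h e - g e \<partial>\<mu>\<bar>" using int by simp
  also have "\<dots> \<le> (\<integral>e. \<bar>h e - g e\<bar> \<partial>\<mu>)" by (rule integral_abs_bound)
  also have "\<dots> \<le> (\<integral>e. real B * e1 \<partial>\<mu>)" using int gh by (intro integral_mono) auto
  also have "\<dots> = real B * e1" using \<mu>.prob_space by simp
  finally have "\<bar>integral\<^sup>L \<mu> h - integral\<^sup>L \<mu> g\<bar> \<le> real B * e1" .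
  moreover have "\<bar>integral\<^sup>L \<mu> g - integral\<^sup>L N0 g\<bar> \<le> e0" by (rule close0[OF lip(1)])
  ultimately have "\<bar>integral\<^sup>L \<mu> h - integral\<^sup>L N0 g\<bar> \<le> e0 + real B * e1" by linarith
  then show ?thesis unfolding g_def h_def .
qed

section \<open>The Gaussian limit of the softened coverage\<close>

abbreviation scaled_normal :: "real \<Rightarrow> real measure" where
  "scaled_normal s \<equiv> distr std_normal borel (\<lambda>z. s * z)"

lemma real_distribution_scaled_normal: "real_distribution (scaled_normal s)"
  using real_dist_normal_dist by (intro prob_space.real_distribution_distr) (auto simp: real_distribution_def)

lemma normal_dist_eq_scaled:
  assumes "\<sigma> > 0" shows "normal_dist \<sigma> = scaled_normal \<sigma>"
proof -
  interpret S: prob_space std_normal by (rule prob_space_std_normal)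
  have "distributed std_normal lborel (\<lambda>x. x) (\<lambda>x. ennreal (std_normal_density x))"
    by (auto simp: distributed_def distr_id2)
  then have "distributed std_normal lborel (\<lambda>x. 0 + \<sigma> * x) (\<lambda>x. ennreal (normal_density (0 + \<sigma> * 0) (\<bar>\<sigma>\<bar> * 1) x))"
    using assms by (intro S.normal_density_affine) auto
  then have "distr std_normal lborel (\<lambda>x. \<sigma> * x) = density lborel (normal_density 0 \<sigma>)"
    using assms by (simp add: distributed_def)
  moreover have "distr std_normal lborel (\<lambda>x. \<sigma> * x) = scaled_normal \<sigma>"
    by (intro distr_cong) auto
  ultimately show ?thesis by (simp add: normal_dist_def)
qed

lemma isCont_cdf_normal_dist:
  assumes "\<sigma> > 0" shows "isCont (cdf (normal_dist \<sigma>)) x"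
proof -
  interpret N: real_distribution "normal_dist \<sigma>"
    unfolding normal_dist_eq_scaled[OF assms] by (rule real_distribution_scaled_normal)
  have "emeasure (normal_dist \<sigma>) {x} = (\<integral>\<^sup>+y. ennreal (normal_density 0 \<sigma> y) * indicator {x} y \<partial>lborel)"
    unfolding normal_dist_def by (rule emeasure_density) auto
  also have "\<dots> = 0"
    using AE_lborel_singleton[of x] by (subst nn_integral_0_iff_AE) (auto elim!: eventually_mono)
  finally show ?thesis by (subst N.isCont_cdf) (simp add: measure_def)
qed

text \<open>Rotation with direction cosines \<eta> / s and \<sigma> / s turns the sum into s times
  one standard normal coordinate, and the other coordinate integrates out. This merges resampling
  fluctuation and computation noise.\<close>

lemma integral_sum_normals:
  assumes "\<sigma> > 0" and s: "s > 0" "s\<^sup>2 = \<sigma>\<^sup>2 + \<eta>\<^sup>2" and g: "lip01 L g"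
  shows "(\<integral>x. \<integral>z. g (\<eta> * z + x) \<partial>std_normal \<partial>scaled_normal \<sigma>) = integral\<^sup>L (scaled_normal s) g"
proof -
  interpret S: prob_space std_normal by (rule prob_space_std_normal)
  interpret SS: pair_prob_space std_normal std_normal ..
  note [measurable] = lip01_measurable[OF g]
  have ab: "(\<eta> / s)\<^sup>2 + (\<sigma> / s)\<^sup>2 = 1" "\<sigma> / s > 0"
    using assms by (simp_all add: power_divide add_divide_distrib[symmetric] add.commute)
  have eq: "s * (\<eta> / s * z + \<sigma> / s * x) = \<eta> * z + \<sigma> * x" for x z using s by (simp add: field_simps)
  have inner: "0 \<le> (\<integral>z. g (\<eta> * z + \<sigma> * x) \<partial>std_normal)" "(\<integral>z. g (\<eta> * z + \<sigma> * x) \<partial>std_normal) \<le> 1" for x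
    by (intro S.integral_01 lip01_bounds[OF g]; measurable)+
  have inner_nn: "(\<integral>\<^sup>+z. ennreal (g (\<eta> * z + \<sigma> * x)) \<partial>std_normal) =
      ennreal (\<integral>z. g (\<eta> * z + \<sigma> * x) \<partial>std_normal)" for x
    by (intro nn_integral_eq_integral S.integrable_01 lip01_bounds[OF g] AE_I2) measurable
  have "ennreal (\<integral>x. \<integral>z. g (\<eta> * z + \<sigma> * x) \<partial>std_normal \<partial>std_normal) =
      (\<integral>\<^sup>+x. \<integral>\<^sup>+z. ennreal (g (\<eta> * z + \<sigma> * x)) \<partial>std_normal \<partial>std_normal)"
    unfolding inner_nn by (intro nn_integral_eq_integral[symmetric] S.integrable_01 inner AE_I2) measurable
  also have "\<dots> = (\<integral>\<^sup>+z. \<integral>\<^sup>+x. ennreal (g (\<eta> * z + \<sigma> * x)) \<partial>std_normal \<partial>std_normal)"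
    by (rule SS.Fubini') measurable
  also have "\<dots> = (\<integral>\<^sup>+u. \<integral>\<^sup>+(w::real). ennreal (g (s * u)) \<partial>std_normal \<partial>std_normal)"
    using std_normal_rotation[OF ab, of "\<lambda>(u, w). ennreal (g (s * u))"] unfolding prod.case eq by simp
  also have "\<dots> = (\<integral>\<^sup>+u. ennreal (g (s * u)) \<partial>std_normal)"
    using S.emeasure_space_1 by simp
  also have "\<dots> = ennreal (\<integral>u. g (s * u) \<partial>std_normal)"
    by (intro nn_integral_eq_integral S.integrable_01 lip01_bounds[OF g] AE_I2) measurable
  finally have "(\<integral>x. \<integral>z. g (\<eta> * z + \<sigma> * x) \<partial>std_normal \<partial>std_normal) = (\<integral>u. g (s * u) \<partial>std_normal)"
    by (subst (asm) ennreal_inj) (auto intro!: integral_nonneg_AE lip01_bounds[OF g] inner)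
  then show ?thesis by (simp add: integral_distr)
qed

text \<open>Selects the slope: dominated convergence lets the ramp increase to the strict coverage
  event, whose Gaussian probability is already bounded below.\<close>

lemma soft_cover_limit:
  assumes B: "B \<ge> 1" and \<rho>: "\<rho> > 0" and \<beta>: "1 / 2 < \<beta>" "\<beta> < 1" and pos: "\<sigma> > 0" "\<eta> > 0" "s > 0"
    and s: "s\<^sup>2 = \<sigma>\<^sup>2 + \<eta>\<^sup>2 * \<rho>\<^sup>2" and e: "e > 0"
  shows "\<exists>k\<ge>0. 2 * \<beta> - 1 - e <
    (\<integral>a. \<integral>x. \<integral>d. soft_cover k (q_O B \<rho> \<beta>) B a x d \<partial>(\<Pi>\<^sub>M b\<in>{..<B}. scaled_normal s) \<partial>scaled_normal \<eta> \<partial>scaled_normal \<sigma>)"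
proof -
  let ?S = "std_normal" and ?PS = "\<Pi>\<^sub>M b\<in>{..<B}. std_normal"
  define q where "q = q_O B \<rho> \<beta>"
  interpret S: prob_space ?S by (rule prob_space_std_normal)
  interpret PS: prob_space ?PS by (rule prob_space_PiM) (rule prob_space_std_normal)
  interpret S2: pair_prob_space ?S ?PS ..
  interpret S3: pair_prob_space ?S "?S \<Otimes>\<^sub>M ?PS" ..
  \<comment> \<open>The restriction to \<open>{..<B}\<close> puts the vector into the extensional
    product space, as measurability requires; \<open>rms_dev\<close> reads only these
    coordinates.\<close>
  define f where "f k = (\<lambda>(v1, v2, G). soft_cover (real k) q B (\<sigma> * v1) (\<eta> * v2) (\<lambda>b\<in>{..<B}. s * G b))" for k
  have fm[measurable]: "f k \<in> borel_measurable (?S \<Otimes>\<^sub>M ?S \<Otimes>\<^sub>M ?PS)" for k unfolding f_def by measurable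
  have fb: "0 \<le> f k w" "f k w \<le> 1" for k w by (auto simp: f_def soft_cover_bounds split: prod.splits)
  let ?I = "\<lambda>(v1, v2, G). \<bar>\<sigma> * v1 + \<eta> * v2\<bar> < q * rms_dev B (\<eta> * v2) (\<lambda>b\<in>{..<B}. s * G b)"
  let ?X = "{w \<in> space (?S \<Otimes>\<^sub>M ?S \<Otimes>\<^sub>M ?PS). ?I w}"
  have X[measurable]: "?X \<in> sets (?S \<Otimes>\<^sub>M ?S \<Otimes>\<^sub>M ?PS)" by measurable
  have "(\<lambda>k. integral\<^sup>L (?S \<Otimes>\<^sub>M ?S \<Otimes>\<^sub>M ?PS) (f k)) \<longlonglongrightarrow> (\<integral>w. indicator ?X w \<partial>(?S \<Otimes>\<^sub>M ?S \<Otimes>\<^sub>M ?PS))"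
  proof (rule integral_dominated_convergence[where w="\<lambda>_. 1"])
    show "AE w in ?S \<Otimes>\<^sub>M ?S \<Otimes>\<^sub>M ?PS. (\<lambda>k. f k w) \<longlonglongrightarrow> indicator ?X w"
    proof (rule AE_I2)
      fix w assume w: "w \<in> space (?S \<Otimes>\<^sub>M ?S \<Otimes>\<^sub>M ?PS)"
      then have "(indicator ?X w :: real) = (if ?I w then 1 else 0)" by (simp add: indicator_def)
      then show "(\<lambda>k. f k w) \<longlonglongrightarrow> indicator ?X w"
        by (cases w) (simp add: f_def soft_cover_tendsto)
    qed
    show "AE w in ?S \<Otimes>\<^sub>M ?S \<Otimes>\<^sub>M ?PS. norm (f k w) \<le> 1" for k using fb by simp
  qed auto
  moreover have "2 * \<beta> - 1 \<le> (\<integral>w. indicator ?X w \<partial>(?S \<Otimes>\<^sub>M ?S \<Otimes>\<^sub>M ?PS))"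
  proof -
    have "ennreal (2 * \<beta> - 1) \<le> (\<integral>\<^sup>+v1. \<integral>\<^sup>+v2. \<integral>\<^sup>+G.
      indicator {G. \<bar>\<sigma> * v1 + \<eta> * v2\<bar> < q * sqrt (1 / real B * (\<Sum>b<B. (s * G b - \<eta> * v2)\<^sup>2))} G \<partial>?PS \<partial>?S \<partial>?S)"
      unfolding q_def by (rule normal_sample_coverage[OF B \<rho> \<beta> pos s])
    also have "\<dots> = (\<integral>\<^sup>+v1. \<integral>\<^sup>+v2. \<integral>\<^sup>+G. indicator ?X (v1, v2, G) \<partial>?PS \<partial>?S \<partial>?S)"
  proof (intro nn_integral_cong)
      fix v1 v2 :: real and G assume G: "G \<in> space ?PS"
      have "rms_dev B (\<eta> * v2) (\<lambda>b\<in>{..<B}. s * G b) = sqrt (1 / real B * (\<Sum>b<B. (s * G b - \<eta> * v2)\<^sup>2))"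
        unfolding rms_dev_def by (intro arg_cong[where f=sqrt] arg_cong2[where f="(*)"] refl sum.cong) auto
      then have "(v1, v2, G) \<in> ?X \<longleftrightarrow> \<bar>\<sigma> * v1 + \<eta> * v2\<bar> < q * sqrt (1 / real B * (\<Sum>b<B. (s * G b - \<eta> * v2)\<^sup>2))"
        using G by (simp only: mem_Collect_eq prod.case space_pair_measure mem_Times_iff fst_conv snd_conv) simp
      then show "indicator {G. \<bar>\<sigma> * v1 + \<eta> * v2\<bar> < q * sqrt (1 / real B * (\<Sum>b<B. (s * G b - \<eta> * v2)\<^sup>2))} G =
          (indicator ?X (v1, v2, G) :: ennreal)"
        unfolding indicator_def mem_Collect_eq[of G] by presburger
    qed
    also have "\<dots> = (\<integral>\<^sup>+v1. \<integral>\<^sup>+w. indicator ?X (v1, w) \<partial>(?S \<Otimes>\<^sub>M ?PS) \<partial>?S)"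
    proof (rule nn_integral_cong)
      fix v1 :: real
      have "(\<lambda>w. indicator ?X (v1, w) :: ennreal) \<in> borel_measurable (?S \<Otimes>\<^sub>M ?PS)"
        by (rule measurable_compose[OF measurable_Pair1'[of v1 ?S] borel_measurable_indicator[OF X]]) simp
      from PS.nn_integral_fst[OF this]
      show "(\<integral>\<^sup>+v2. \<integral>\<^sup>+G. indicator ?X (v1, v2, G) \<partial>?PS \<partial>?S) = (\<integral>\<^sup>+w. indicator ?X (v1, w) \<partial>(?S \<Otimes>\<^sub>M ?PS))" .
    qed
    also have "\<dots> = (\<integral>\<^sup>+w. indicator ?X w \<partial>(?S \<Otimes>\<^sub>M ?S \<Otimes>\<^sub>M ?PS))"
      by (rule S2.P.nn_integral_fst[OF borel_measurable_indicator[OF X]])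
    also have "\<dots> = ennreal (measure (?S \<Otimes>\<^sub>M ?S \<Otimes>\<^sub>M ?PS) ?X)"
      unfolding nn_integral_indicator[OF X] by (rule S3.emeasure_eq_measure)
    finally have "2 * \<beta> - 1 \<le> measure (?S \<Otimes>\<^sub>M ?S \<Otimes>\<^sub>M ?PS) ?X"
      by (subst (asm) ennreal_le_iff) auto
    then show ?thesis by (simp add: Int_absorb2)
  qed
  ultimately have "\<forall>\<^sub>F k in sequentially. 2 * \<beta> - 1 - e < integral\<^sup>L (?S \<Otimes>\<^sub>M ?S \<Otimes>\<^sub>M ?PS) (f k)"
    using e by (elim order_tendstoD(1)) linarith
  then obtain k where k: "2 * \<beta> - 1 - e < integral\<^sup>L (?S \<Otimes>\<^sub>M ?S \<Otimes>\<^sub>M ?PS) (f k)"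
    by (auto simp: eventually_sequentially)
  have PN: "(\<Pi>\<^sub>M b\<in>{..<B}. scaled_normal s) = distr ?PS (\<Pi>\<^sub>M b\<in>{..<B}. borel) (\<lambda>G. \<lambda>b\<in>{..<B}. s * G b)"
  proof -
    have "distr ?PS (\<Pi>\<^sub>M b\<in>{..<B}. ?S) (compose {..<B} (\<lambda>z. s * z)) = (\<Pi>\<^sub>M b\<in>{..<B}. distr ?S ?S (\<lambda>z. s * z))"
      by (rule distr_PiM_finite_prob_space') (auto intro: prob_space_std_normal)
    moreover have "distr ?S ?S (\<lambda>z. s * z) = scaled_normal s" by (intro distr_cong) auto
    moreover have "distr ?PS (\<Pi>\<^sub>M b\<in>{..<B}. ?S) (compose {..<B} (\<lambda>z. s * z)) = distr ?PS (\<Pi>\<^sub>M b\<in>{..<B}. borel) (\<lambda>G. \<lambda>b\<in>{..<B}. s * G b)"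
      by (intro distr_cong sets_PiM_cong) (auto simp: compose_def)
    ultimately show ?thesis by simp
  qed
  have "integral\<^sup>L (?S \<Otimes>\<^sub>M ?S \<Otimes>\<^sub>M ?PS) (f k) = (\<integral>v1. \<integral>w. f k (v1, w) \<partial>(?S \<Otimes>\<^sub>M ?PS) \<partial>?S)"
    by (rule S3.integral_fst'[symmetric]) (auto intro!: S3.integrable_01 fb)
  also have "\<dots> = (\<integral>v1. \<integral>v2. \<integral>G. f k (v1, v2, G) \<partial>?PS \<partial>?S \<partial>?S)"
    by (intro Bochner_Integration.integral_cong refl S2.integral_fst'[symmetric] S2.integrable_01 fb) measurable
  also have "\<dots> = (\<integral>v1. \<integral>v2. \<integral>d. soft_cover (real k) q B (\<sigma> * v1) (\<eta> * v2) d \<partial>(\<Pi>\<^sub>M b\<in>{..<B}. scaled_normal s) \<partial>?S \<partial>?S)"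
    unfolding PN by (subst integral_distr) (auto simp: f_def)
  also have "\<dots> = (\<integral>a. \<integral>x. \<integral>d. soft_cover (real k) q B a x d \<partial>(\<Pi>\<^sub>M b\<in>{..<B}. scaled_normal s) \<partial>scaled_normal \<eta> \<partial>scaled_normal \<sigma>)"
  proof -
    interpret Ns: real_distribution "scaled_normal s" by (rule real_distribution_scaled_normal)
    interpret PNs: prob_space "\<Pi>\<^sub>M b\<in>{..<B}. scaled_normal s" by (rule prob_space_PiM) (rule Ns.prob_space_axioms)
    have "(\<lambda>(a, x). \<integral>d. soft_cover (real k) q B a x d \<partial>(\<Pi>\<^sub>M b\<in>{..<B}. scaled_normal s)) \<in> borel_measurable (borel \<Otimes>\<^sub>M borel)"
      unfolding split_def by (rule PNs.borel_measurable_lebesgue_integral) measurable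
    then have m[measurable]: "(\<lambda>w. \<integral>d. soft_cover (real k) q B (fst w) (snd w) d \<partial>(\<Pi>\<^sub>M b\<in>{..<B}. scaled_normal s)) \<in> borel_measurable (borel \<Otimes>\<^sub>M borel)"
      by (simp add: split_def)
    have m1[measurable]: "(\<lambda>x. \<integral>d. soft_cover (real k) q B a x d \<partial>(\<Pi>\<^sub>M b\<in>{..<B}. scaled_normal s)) \<in> borel_measurable borel" for a
      using measurable_compose[OF measurable_Pair1' m, of a] by simp
    have m2[measurable]: "(\<lambda>a. \<integral>v2. \<integral>d. soft_cover (real k) q B a (\<eta> * v2) d \<partial>(\<Pi>\<^sub>M b\<in>{..<B}. scaled_normal s) \<partial>?S) \<in> borel_measurable borel"
      by (rule S.borel_measurable_lebesgue_integral)
         (use measurable_compose[OF _ m, of "\<lambda>w. (fst w, \<eta> * snd w)" "borel \<Otimes>\<^sub>M ?S"] in \<open>simp add: split_def\<close>)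
    show ?thesis by (simp add: integral_distr)
  qed
  finally show ?thesis using k unfolding q_def by (intro exI[of _ "real k"]) auto
qed

section \<open>Nested resampling\<close>

lemma measurable_kernel_nn_integral:
  assumes "K \<in> M \<rightarrow>\<^sub>M prob_algebra N" "(\<lambda>(x, y). f x y) \<in> borel_measurable (M \<Otimes>\<^sub>M N)"
  shows "(\<lambda>x. \<integral>\<^sup>+y. f x y \<partial>K x) \<in> borel_measurable M"
  using nn_integral_measurable_subprob_algebra2[OF assms(2) measurable_prob_algebraD[OF assms(1)]] .

text \<open>Since \<open>ennreal\<close> sends negative numbers to 0, the two nonnegative integrals
  are those of the positive and the negative part, each measurable in the kernel argument.\<close>

lemma measurable_kernel_mean:
  assumes K: "K \<in> M \<rightarrow>\<^sub>M prob_algebra borel" and int: "\<And>x. x \<in> space M \<Longrightarrow> integrable (K x) (\<lambda>y. y :: real)"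
  shows "(\<lambda>x. \<integral>y. y \<partial>K x) \<in> borel_measurable M"
proof -
  have "(\<lambda>x. \<integral>\<^sup>+y. ennreal y \<partial>K x) \<in> borel_measurable M"
    by (rule measurable_kernel_nn_integral[OF K, of "\<lambda>x y. ennreal y"]) measurable
  moreover have "(\<lambda>x. \<integral>\<^sup>+y. ennreal (- y) \<partial>K x) \<in> borel_measurable M"
    by (rule measurable_kernel_nn_integral[OF K, of "\<lambda>x y. ennreal (- y)"]) measurable
  ultimately have "(\<lambda>x. enn2real (\<integral>\<^sup>+y. ennreal y \<partial>K x) - enn2real (\<integral>\<^sup>+y. ennreal (- y) \<partial>K x)) \<in> borel_measurable M"
    by (rule borel_measurable_diff[OF borel_measurable_enn2real borel_measurable_enn2real])
  then show ?thesis
    by (rule measurable_cong[THEN iffD1, rotated]) (rule real_lebesgue_integral_def[OF int, symmetric])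
qed

lemma empirical_cong: "(\<And>i. i < n \<Longrightarrow> x i = y i) \<Longrightarrow> empirical S n x = empirical S n y"
  unfolding empirical_def by (intro distr_cong) (auto simp: space_uniform_count_measure)

lemma prob_space_data_law: "prob_space P \<Longrightarrow> prob_space (data_law P n)"
  unfolding data_law_def by (intro prob_space_PiM)

lemma prob_space_index_law: "n \<ge> 1 \<Longrightarrow> prob_space (index_law n)"
  unfolding index_law_def by (intro prob_space_PiM prob_space_uniform_count_measure) auto

text \<open>Collects the hypotheses that concern distributions or a fixed sample size; the
  asymptotic ones enter only in \<open>coverage_eventually_ge\<close>.\<close>

locale nested_sampling =
  fixes P :: "'a measure" and D :: "'a measure set" and \<psi> :: "'a measure \<Rightarrow> real"
    and run :: "'a measure \<Rightarrow> real measure"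
  assumes P: "prob_space P" "P \<in> D"
    and empirical_D: "\<And>n x. n \<ge> 1 \<Longrightarrow> x \<in> {..<n} \<rightarrow> space P \<Longrightarrow> empirical P n x \<in> D"
    and run: "\<And>Q. Q \<in> D \<Longrightarrow> run Q \<in> space (prob_algebra borel)"
    and unbiased: "\<And>Q. Q \<in> D \<Longrightarrow> integrable (run Q) (\<lambda>y. y)"
      "\<And>Q. Q \<in> D \<Longrightarrow> (\<integral>y. y \<partial>run Q) = \<psi> Q"
    and run_measurable:
      "\<And>n. n \<ge> 1 \<Longrightarrow> (\<lambda>x. run (empirical P n x)) \<in> data_law P n \<rightarrow>\<^sub>M prob_algebra borel"
begin

section \<open>Measurability in the data and the resampling indices\<close>

lemma real_distribution_run: "Q \<in> D \<Longrightarrow> real_distribution (run Q)"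
  using run[of Q] by (auto simp: space_prob_algebra real_distribution_def real_distribution_axioms_def)

lemma data_D: "n \<ge> 1 \<Longrightarrow> x \<in> space (data_law P n) \<Longrightarrow> empirical P n x \<in> D"
  by (intro empirical_D) (auto simp: data_law_def space_PiM)

lemma resample_D:
  "n \<ge> 1 \<Longrightarrow> x \<in> space (data_law P n) \<Longrightarrow> j \<in> space (index_law n) \<Longrightarrow> resample_empirical P n x j \<in> D"
  unfolding resample_empirical_def
  by (intro empirical_D) (auto simp: data_law_def index_law_def space_PiM space_uniform_count_measure PiE_iff)

text \<open>An index takes finitely many values, so evaluation of the data at a random index is
  measurable piece by piece. Since a resample is again a point of the data space, every
  measurability fact for the original sample transfers by composition.\<close>

lemma resample_measurable:
  "(\<lambda>w. \<lambda>i\<in>{..<n}. fst w (snd w i)) \<in> data_law P n \<Otimes>\<^sub>M index_law n \<rightarrow>\<^sub>M data_law P n"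
  unfolding data_law_def
proof (rule measurable_restrict)
  fix i assume i: "i \<in> {..<n}"
  show "(\<lambda>w. fst w (snd w i)) \<in> (\<Pi>\<^sub>M i\<in>{..<n}. P) \<Otimes>\<^sub>M index_law n \<rightarrow>\<^sub>M P"
  proof (rule measurable_compose_countable'[where I="{..<n}" and f="\<lambda>k w. fst w k" and g="\<lambda>w. snd w i"])
    have "(\<lambda>w. snd w i) \<in> (\<Pi>\<^sub>M i\<in>{..<n}. P) \<Otimes>\<^sub>M index_law n \<rightarrow>\<^sub>M uniform_count_measure {..<n}"
      unfolding index_law_def using i by measurable
    then show "(\<lambda>w. snd w i) \<in> (\<Pi>\<^sub>M i\<in>{..<n}. P) \<Otimes>\<^sub>M index_law n \<rightarrow>\<^sub>M count_space {..<n}"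
      by (subst (asm) measurable_cong_sets[OF refl, of _ "count_space {..<n}"]) (auto simp: sets_uniform_count_measure)
  qed (use i in \<open>auto simp: countable_finite\<close>)
qed

lemma resample_empirical_eq:
  "resample_empirical P n (fst w) (snd w) = empirical P n (\<lambda>i\<in>{..<n}. fst w (snd w i))"
  unfolding resample_empirical_def by (rule empirical_cong) simp

lemma run_resample_measurable:
  assumes "n \<ge> 1"
  shows "(\<lambda>w. run (resample_empirical P n (fst w) (snd w))) \<in> data_law P n \<Otimes>\<^sub>M index_law n \<rightarrow>\<^sub>M prob_algebra borel"
  unfolding resample_empirical_eq
  by (rule measurable_compose[OF resample_measurable run_measurable[OF assms]])

text \<open>By unbiasedness \<psi> is the mean of the run kernel, and that kernel is measurable in
  the data by assumption.\<close>

lemma \<psi>_empirical_measurable: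
  assumes n: "n \<ge> 1" shows "(\<lambda>x. \<psi> (empirical P n x)) \<in> borel_measurable (data_law P n)"
proof -
  have "(\<lambda>x. \<integral>y. y \<partial>run (empirical P n x)) \<in> borel_measurable (data_law P n)"
    by (rule measurable_kernel_mean[OF run_measurable[OF n]]) (rule unbiased(1)[OF data_D[OF n]])
  then show ?thesis
    by (rule measurable_cong[THEN iffD1, rotated]) (rule unbiased(2)[OF data_D[OF n]])
qed

lemma \<psi>_resample_measurable:
  assumes n: "n \<ge> 1"
  shows "(\<lambda>w. \<psi> (resample_empirical P n (fst w) (snd w))) \<in> borel_measurable (data_law P n \<Otimes>\<^sub>M index_law n)"
  unfolding resample_empirical_eq
  by (rule measurable_compose[OF resample_measurable \<psi>_empirical_measurable[OF n]])

lemma noise_var_measurable: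
  assumes n: "n \<ge> 1" shows "(\<lambda>x. noise_var run (empirical P n x)) \<in> borel_measurable (data_law P n)"
proof -
  have m: "(\<lambda>x. \<integral>y. y \<partial>run (empirical P n x)) \<in> borel_measurable (data_law P n)"
    by (rule measurable_kernel_mean[OF run_measurable[OF n]]) (rule unbiased(1)[OF data_D[OF n]])
  note [measurable] = measurable_compose[OF measurable_fst m]
  show ?thesis
    unfolding noise_var_def by (rule measurable_kernel_nn_integral[OF run_measurable[OF n]]) measurable
qed

lemma noise_abs3_measurable:
  assumes n: "n \<ge> 1" shows "(\<lambda>x. noise_abs3 \<psi> run (empirical P n x)) \<in> borel_measurable (data_law P n)"
proof -
  note [measurable] = measurable_compose[OF measurable_fst \<psi>_empirical_measurable[OF n]]
  show ?thesis
    unfolding noise_abs3_def by (rule measurable_kernel_nn_integral[OF run_measurable[OF n]]) measurable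
qed

lemma noise_resample_measurable:
  assumes n: "n \<ge> 1"
  shows "(\<lambda>w. noise_var run (resample_empirical P n (fst w) (snd w))) \<in> borel_measurable (data_law P n \<Otimes>\<^sub>M index_law n)"
    "(\<lambda>w. noise_abs3 \<psi> run (resample_empirical P n (fst w) (snd w))) \<in> borel_measurable (data_law P n \<Otimes>\<^sub>M index_law n)"
  unfolding resample_empirical_eq
  by (rule measurable_compose[OF resample_measurable noise_var_measurable[OF n]],
      rule measurable_compose[OF resample_measurable noise_abs3_measurable[OF n]])

lemma near_moments_run:
  "Q \<in> D \<Longrightarrow> near_moments v \<delta> K (run Q) \<longleftrightarrow>
    noise_var run Q \<in> {ennreal (v - \<delta>)<..<ennreal (v + \<delta>)} \<and> noise_abs3 \<psi> run Q < ennreal K"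
  using unbiased[of Q] by (simp add: near_moments_def noise_var_def noise_abs3_def)

section \<open>Laws of the runs given the data\<close>

definition resample_runs :: "nat \<Rightarrow> nat \<Rightarrow> (nat \<Rightarrow> 'a) \<Rightarrow> (nat \<Rightarrow> nat) \<Rightarrow> (nat \<Rightarrow> real) measure" where
  "resample_runs n R x j = (\<Pi>\<^sub>M r\<in>{..<R}. run (resample_empirical P n x j))"

definition original_runs :: "nat \<Rightarrow> nat \<Rightarrow> (nat \<Rightarrow> 'a) \<Rightarrow> (nat \<Rightarrow> real) measure" where
  "original_runs n R x = (\<Pi>\<^sub>M r\<in>{..<R}. run (empirical P n x))"

text \<open>The law of one resample block given the data alone: its indices are averaged out, so the
  runs within a block are only exchangeable, while the B blocks stay independent.\<close>

definition mixed_runs :: "nat \<Rightarrow> nat \<Rightarrow> (nat \<Rightarrow> 'a) \<Rightarrow> (nat \<Rightarrow> real) measure" where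
  "mixed_runs n R x = index_law n \<bind> resample_runs n R x"

lemma resample_runs_measurable:
  assumes n: "n \<ge> 1"
  shows "(\<lambda>w. resample_runs n R (fst w) (snd w)) \<in> data_law P n \<Otimes>\<^sub>M index_law n \<rightarrow>\<^sub>M prob_algebra (\<Pi>\<^sub>M r\<in>{..<R}. borel)"
  unfolding resample_runs_def by (intro measurable_PiM_prob_algebra run_resample_measurable n) simp

lemma resample_runs_measurable1:
  assumes n: "n \<ge> 1" and x: "x \<in> space (data_law P n)"
  shows "resample_runs n R x \<in> index_law n \<rightarrow>\<^sub>M prob_algebra (\<Pi>\<^sub>M r\<in>{..<R}. borel)"
  using measurable_compose[OF measurable_Pair1'[OF x] resample_runs_measurable[OF n]] by simp

lemma original_runs_measurable:
  assumes n: "n \<ge> 1"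
  shows "original_runs n R \<in> data_law P n \<rightarrow>\<^sub>M prob_algebra (\<Pi>\<^sub>M r\<in>{..<R}. borel)"
  unfolding original_runs_def[abs_def] by (intro measurable_PiM_prob_algebra run_measurable n) simp

lemma mixed_runs_measurable:
  assumes n: "n \<ge> 1"
  shows "mixed_runs n R \<in> data_law P n \<rightarrow>\<^sub>M prob_algebra (\<Pi>\<^sub>M r\<in>{..<R}. borel)"
proof -
  have "index_law n \<in> space (prob_algebra (index_law n))"
    using prob_space_index_law[OF n] by (simp add: space_prob_algebra)
  then show ?thesis
    unfolding mixed_runs_def[abs_def] using resample_runs_measurable[OF n]
    by (intro measurable_bind_prob_space2[OF measurable_const]) (auto simp: split_def)
qed

text \<open>The indices of each block influence only that block and never the original runs, so they
  can be averaged out inside each factor. What remains is, for given data, a product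
  measure.\<close>

lemma nested_law_eq:
  assumes n: "n \<ge> 1"
  shows "nested_law P run n B R0 R =
    data_law P n \<bind> (\<lambda>x. original_runs n R0 x \<Otimes>\<^sub>M (\<Pi>\<^sub>M b\<in>{..<B}. mixed_runs n R x))"
proof -
  let ?X = "data_law P n" and ?J = "\<Pi>\<^sub>M b\<in>{..<B}. index_law n"
  define K where "K w = (\<Pi>\<^sub>M b\<in>{..<B}. resample_runs n R (fst w) (snd w b))" for w
  have X: "prob_space ?X" and J: "prob_space ?J"
    using P(1) n by (auto intro!: prob_space_data_law prob_space_PiM prob_space_index_law)
  have K: "K \<in> ?X \<Otimes>\<^sub>M ?J \<rightarrow>\<^sub>M prob_algebra (\<Pi>\<^sub>M b\<in>{..<B}. \<Pi>\<^sub>M r\<in>{..<R}. borel)"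
    unfolding K_def[abs_def]
  proof (rule measurable_PiM_prob_algebra)
    fix b assume b: "b \<in> {..<B}"
    have "(\<lambda>w. (fst w, snd w b)) \<in> ?X \<Otimes>\<^sub>M ?J \<rightarrow>\<^sub>M ?X \<Otimes>\<^sub>M index_law n" using b by measurable
    from measurable_compose[OF this resample_runs_measurable[OF n]]
    show "(\<lambda>w. resample_runs n R (fst w) (snd w b)) \<in> ?X \<Otimes>\<^sub>M ?J \<rightarrow>\<^sub>M prob_algebra (\<Pi>\<^sub>M r\<in>{..<R}. borel)" by simp
  qed simp
  have "nested_law P run n B R0 R = (?X \<Otimes>\<^sub>M ?J) \<bind> (\<lambda>(x, j). original_runs n R0 x \<Otimes>\<^sub>M K (x, j))"
    unfolding nested_law_def runs_law_def original_runs_def K_def resample_runs_def by simp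
  also have "\<dots> = ?X \<bind> (\<lambda>x. original_runs n R0 x \<Otimes>\<^sub>M (?J \<bind> (\<lambda>j. K (x, j))))"
    by (rule bind_pair_measure_kernels[OF X J original_runs_measurable[OF n] K])
  also have "\<dots> = ?X \<bind> (\<lambda>x. original_runs n R0 x \<Otimes>\<^sub>M (\<Pi>\<^sub>M b\<in>{..<B}. mixed_runs n R x))"
  proof (intro bind_cong refl arg_cong2[where f=pair_measure])
    fix x assume x: "x \<in> space ?X"
    show "?J \<bind> (\<lambda>j. K (x, j)) = (\<Pi>\<^sub>M b\<in>{..<B}. mixed_runs n R x)"
      unfolding K_def mixed_runs_def fst_conv snd_conv
      by (rule PiM_bind_PiM[OF finite_lessThan prob_space_index_law[OF n] resample_runs_measurable1[OF n x]])
  qed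
  finally show ?thesis .
qed

lemma run_mean_kernel_measurable:
  assumes "sets M = sets (\<Pi>\<^sub>M r\<in>{..<R}. (borel :: real measure))"
  shows "(\<lambda>u. c * (run_mean R u - m)) \<in> borel_measurable M"
  unfolding measurable_cong_sets[OF assms refl] by measurable

text \<open>The deviation splits into noise around \<psi> of the resample and the bootstrap error
  \<open>C j\<close>. For fixed \<open>j\<close> the noise is replaced by a normal law (cost
  \<open>e\<close>, or 1 on indices with bad moments), then the law of \<open>C j\<close> is
  replaced (cost \<open>e\<close>), and the two normals are added.\<close>

lemma mixed_runs_close:
  assumes n: "n \<ge> 1" and x: "x \<in> space (data_law P n)" and g: "lip01 L g"
    and clt: "\<And>Q g. real_distribution Q \<Longrightarrow> near_moments v \<delta> K Q \<Longrightarrow> lip01 L g \<Longrightarrow>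
      \<bar>(\<integral>u. g (sqrt (real n) * (run_mean R u - integral\<^sup>L Q (\<lambda>y. y))) \<partial>(\<Pi>\<^sub>M r\<in>{..<R}. Q))
        - (\<integral>z. g (\<eta> * z) \<partial>std_normal)\<bar> \<le> e"
    and boot: "\<And>g. lip01 L g \<Longrightarrow> \<bar>(\<integral>j. g (sqrt (real n) * (\<psi> (resample_empirical P n x j) - \<psi> (empirical P n x))) \<partial>index_law n)
        - integral\<^sup>L (scaled_normal \<sigma>) g\<bar> \<le> e"
    and pos: "\<sigma> > 0" "s > 0" "s\<^sup>2 = \<sigma>\<^sup>2 + \<eta>\<^sup>2" "e \<ge> 0"
  shows "\<bar>integral\<^sup>L (distr (mixed_runs n R x) borel (\<lambda>u. sqrt (real n) * (run_mean R u - \<psi> (empirical P n x)))) g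
      - integral\<^sup>L (scaled_normal s) g\<bar>
    \<le> 2 * e + measure (index_law n) {j \<in> space (index_law n). \<not> near_moments v \<delta> K (run (resample_empirical P n x j))}"
proof -
  let ?I = "index_law n" and ?c = "sqrt (real n)" and ?m = "\<psi> (empirical P n x)"
  interpret I: prob_space ?I by (rule prob_space_index_law[OF n])
  interpret S: prob_space std_normal by (rule prob_space_std_normal)
  note [measurable] = lip01_measurable[OF g]
  note km = resample_runs_measurable1[OF n x]
  define C where "C j = ?c * (\<psi> (resample_empirical P n x j) - ?m)" for j
  have cut: "(\<lambda>j. f (x, j)) \<in> borel_measurable ?I" if "f \<in> borel_measurable (data_law P n \<Otimes>\<^sub>M ?I)" for f :: "_ \<Rightarrow> 'c :: topological_space"
    using measurable_compose[OF measurable_Pair1'[OF x] that] .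
  have \<psi>m[measurable]: "(\<lambda>j. \<psi> (resample_empirical P n x j)) \<in> borel_measurable ?I"
    using cut[OF \<psi>_resample_measurable[OF n]] by simp
  have Cm[measurable]: "C \<in> borel_measurable ?I" unfolding C_def[abs_def] by measurable
  let ?bad = "{j \<in> space ?I. \<not> near_moments v \<delta> K (run (resample_empirical P n x j))}"
  have bad[measurable]: "?bad \<in> sets ?I"
  proof -
    have [measurable]: "(\<lambda>j. noise_var run (resample_empirical P n x j)) \<in> borel_measurable ?I"
      "(\<lambda>j. noise_abs3 \<psi> run (resample_empirical P n x j)) \<in> borel_measurable ?I"
      using cut[OF noise_resample_measurable(1)[OF n]] cut[OF noise_resample_measurable(2)[OF n]] by simp_all
    have "?bad = {j \<in> space ?I. \<not> (noise_var run (resample_empirical P n x j) \<in> {ennreal (v - \<delta>)<..<ennreal (v + \<delta>)} \<and>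
        noise_abs3 \<psi> run (resample_empirical P n x j) < ennreal K)}"
      using near_moments_run[OF resample_D[OF n x]] by blast
    also have "\<dots> \<in> sets ?I" by measurable
    finally show ?thesis .
  qed
  have kj: "prob_space (resample_runs n R x j)" "sets (resample_runs n R x j) = sets (\<Pi>\<^sub>M r\<in>{..<R}. borel)" if "j \<in> space ?I" for j
    using measurable_space[OF km that] by (auto simp: space_prob_algebra)
  have sm: "sets (mixed_runs n R x) = sets (\<Pi>\<^sub>M r\<in>{..<R}. borel)"
    using measurable_space[OF mixed_runs_measurable[OF n] x] by (auto simp: space_prob_algebra)
  let ?h = "\<lambda>u. g (?c * (run_mean R u - ?m))"
  have hm: "?h \<in> borel_measurable (\<Pi>\<^sub>M r\<in>{..<R}. borel)" by measurable
  have "integral\<^sup>L (distr (mixed_runs n R x) borel (\<lambda>u. ?c * (run_mean R u - ?m))) g = (\<integral>u. ?h u \<partial>mixed_runs n R x)"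
    by (rule integral_distr) (auto intro: run_mean_kernel_measurable[OF sm])
  also have "\<dots> = (\<integral>j. \<integral>u. ?h u \<partial>resample_runs n R x j \<partial>?I)"
    unfolding mixed_runs_def
    by (rule integral_bind[OF hm _ measurable_prob_algebraD[OF km] I.finite_measure_axioms, where B=1 and B'=1])
       (auto intro!: AE_I2 lip01_bounds[OF g] simp: prob_space.emeasure_space_1[OF kj(1)])
  finally have 1: "integral\<^sup>L (distr (mixed_runs n R x) borel (\<lambda>u. ?c * (run_mean R u - ?m))) g = (\<integral>j. \<integral>u. ?h u \<partial>resample_runs n R x j \<partial>?I)" .
  define H where "H j = (\<integral>u. ?h u \<partial>resample_runs n R x j)" for j
  \<comment> \<open>\<open>g\<close> smoothed by the Gaussian noise; being Lipschitz again, it is an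
    admissible test function for the bootstrap error.\<close>
  define G where "G c = (\<integral>z. g (\<eta> * z + c) \<partial>std_normal)" for c
  have Glip: "lip01 L G"
    unfolding G_def[abs_def]
  proof (rule lip01_integral[OF S.prob_space_axioms])
    show "lip01 L (\<lambda>c. g (\<eta> * z + c))" for z
      unfolding lip01_def
    proof (intro conjI allI lip01_bounds[OF g])
      fix c c'
      have "\<bar>g (\<eta> * z + c) - g (\<eta> * z + c')\<bar> \<le> L * \<bar>(\<eta> * z + c) - (\<eta> * z + c')\<bar>" using g unfolding lip01_def by blast
      then show "\<bar>g (\<eta> * z + c) - g (\<eta> * z + c')\<bar> \<le> L * \<bar>c - c'\<bar>" by simp
    qed
  qed measurable
  \<comment> \<open>For a fixed index vector \<open>C j\<close> is a constant shift, and the test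
    class is translation invariant, so the noise approximation holds with the same \<open>e\<close>
    for every shift.\<close>
  have gshift: "lip01 L (\<lambda>y. g (y + c))" for c
    unfolding lip01_def
  proof (intro conjI allI lip01_bounds[OF g])
    fix y y'
    have "\<bar>g (y + c) - g (y' + c)\<bar> \<le> L * \<bar>(y + c) - (y' + c)\<bar>" using g unfolding lip01_def by blast
    then show "\<bar>g (y + c) - g (y' + c)\<bar> \<le> L * \<bar>y - y'\<bar>" by simp
  qed
  have Hm[measurable]: "H \<in> borel_measurable ?I"
    unfolding H_def[abs_def]
    by (rule measurable_compose[OF measurable_prob_algebraD[OF km] integral_measurable_subprob_algebra[OF hm]])
  have Hb: "0 \<le> H j" "H j \<le> 1" if "j \<in> space ?I" for j
  proof -
    interpret K: prob_space "resample_runs n R x j" by (rule kj(1)[OF that])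
    have "?h \<in> borel_measurable (resample_runs n R x j)"
      unfolding measurable_cong_sets[OF kj(2)[OF that] refl] by (rule hm)
    then show "0 \<le> H j" "H j \<le> 1"
      unfolding H_def by (intro K.integral_01 lip01_bounds[OF g]; assumption)+
  qed
  have Gm[measurable]: "(\<lambda>j. G (C j)) \<in> borel_measurable ?I"
    using measurable_compose[OF Cm lip01_measurable[OF Glip]] .
  have HG: "\<bar>H j - G (C j)\<bar> \<le> e + indicator ?bad j" if j: "j \<in> space ?I" for j
  proof (cases "j \<in> ?bad")
    case True
    have "\<bar>H j - G (C j)\<bar> \<le> 1" using Hb[OF j] lip01_bounds[OF Glip, of "C j"] by linarith
    then show ?thesis using True pos by simp
  next
    case False
    then have "\<bar>(\<integral>u. g (?c * (run_mean R u - integral\<^sup>L (run (resample_empirical P n x j)) (\<lambda>y. y)) + C j) \<partial>resample_runs n R x j)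
        - (\<integral>z. g (\<eta> * z + C j) \<partial>std_normal)\<bar> \<le> e"
      unfolding resample_runs_def using j
      by (intro clt[OF _ _ gshift] real_distribution_run resample_D n x) auto
    moreover have "?c * (run_mean R u - integral\<^sup>L (run (resample_empirical P n x j)) (\<lambda>y. y)) + C j = ?c * (run_mean R u - ?m)" for u
      using unbiased(2)[OF resample_D[OF n x j]] by (simp add: C_def algebra_simps)
    ultimately show ?thesis using False by (simp add: H_def G_def)
  qed
  have intH: "integrable ?I H"
    by (rule I.integrable_const_bound[where B=1]) (use Hb in \<open>auto intro!: AE_I2\<close>)
  have intG: "integrable ?I (\<lambda>j. G (C j))" by (intro I.integrable_01 Gm lip01_bounds[OF Glip])
  have "\<bar>(\<integral>j. H j \<partial>?I) - (\<integral>j. G (C j) \<partial>?I)\<bar> = \<bar>\<integral>j. H j - G (C j) \<partial>?I\<bar>" using intH intG by simp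
  also have "\<dots> \<le> (\<integral>j. \<bar>H j - G (C j)\<bar> \<partial>?I)" by (rule integral_abs_bound)
  also have "\<dots> \<le> (\<integral>j. e + indicator ?bad j \<partial>?I)"
    using intH intG HG by (intro integral_mono) (auto simp: I.emeasure_eq_measure)
  also have "\<dots> = e + measure ?I ?bad"
  proof -
    have "integrable ?I (indicator ?bad :: _ \<Rightarrow> real)" by (rule integrable_real_indicator) (auto simp: I.emeasure_eq_measure)
    moreover have "(\<integral>j. indicator ?bad j \<partial>?I) = measure ?I ?bad"
      using sets.sets_into_space[OF bad] by (simp add: Int_absorb2)
    ultimately show ?thesis
      by (subst Bochner_Integration.integral_add[OF I.integrable_const]) (simp_all add: I.prob_space)
  qed
  finally have 2: "\<bar>(\<integral>j. H j \<partial>?I) - (\<integral>j. G (C j) \<partial>?I)\<bar> \<le> e + measure ?I ?bad" .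
  have 3: "\<bar>(\<integral>j. G (C j) \<partial>?I) - integral\<^sup>L (scaled_normal \<sigma>) G\<bar> \<le> e"
    using boot[OF Glip] by (simp add: C_def)
  have 4: "integral\<^sup>L (scaled_normal \<sigma>) G = integral\<^sup>L (scaled_normal s) g"
    unfolding G_def[abs_def] by (rule integral_sum_normals[OF pos(1,2,3) g])
  have tri: "\<bar>a - c\<bar> \<le> 2 * e + m" if "\<bar>a - b\<bar> \<le> e + m" "\<bar>b - c\<bar> \<le> e" for a b c m :: real
    using that by linarith
  have "integral\<^sup>L (distr (mixed_runs n R x) borel (\<lambda>u. ?c * (run_mean R u - ?m))) g = (\<integral>j. H j \<partial>?I)"
    unfolding H_def by (rule 1)
  then show ?thesis using tri[OF 2 3[unfolded 4]] by (simp only:)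
qed

end

section \<open>Conditional coverage\<close>

text \<open>The third moment only has to be bounded, so any threshold above its limit works;
  \<kappa> + 1 is one.\<close>

lemma conv_in_prob_near:
  fixes V T :: "nat \<Rightarrow> 'b \<Rightarrow> ennreal"
  assumes V: "conv_in_prob M V (ennreal v)" and T: "conv_in_prob M T (ennreal \<kappa>)"
    and meas: "\<And>n. n \<ge> 1 \<Longrightarrow> prob_space (M n) \<and> V n \<in> borel_measurable (M n) \<and> T n \<in> borel_measurable (M n)"
    and pos: "v > 0" "\<kappa> \<ge> 0" "\<delta> > 0" "e > 0"
  shows "\<forall>\<^sub>F n in sequentially. measure (M n) {\<omega> \<in> space (M n). \<not> (V n \<omega> \<in> {ennreal (v - \<delta>)<..<ennreal (v + \<delta>)} \<and>
    T n \<omega> < ennreal (\<kappa> + 1))} < e"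
proof -
  let ?U = "{ennreal (v - \<delta>)<..<ennreal (v + \<delta>)}" and ?W = "{..<ennreal (\<kappa> + 1)}"
  have "open ?U \<and> ennreal v \<in> ?U" "open ?W \<and> ennreal \<kappa> \<in> ?W"
    using pos by (auto simp: ennreal_less_iff intro!: ennreal_lessI)
  then have "(\<lambda>n. \<P>(\<omega> in M n. V n \<omega> \<notin> ?U)) \<longlonglongrightarrow> 0" "(\<lambda>n. \<P>(\<omega> in M n. T n \<omega> \<notin> ?W)) \<longlonglongrightarrow> 0"
    using V[unfolded conv_in_prob_def, rule_format, of ?U] T[unfolded conv_in_prob_def, rule_format, of ?W] by blast+
  from this[THEN order_tendstoD(2), of "e / 2"]
  have "\<forall>\<^sub>F n in sequentially. \<P>(\<omega> in M n. V n \<omega> \<notin> ?U) < e / 2"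
    "\<forall>\<^sub>F n in sequentially. \<P>(\<omega> in M n. T n \<omega> \<notin> ?W) < e / 2"
    using pos by simp_all
  then show ?thesis
    using eventually_ge_at_top[of 1]
  proof eventually_elim
    case (elim n)
    note [measurable] = meas[OF elim(3), THEN conjunct2, THEN conjunct1] meas[OF elim(3), THEN conjunct2, THEN conjunct2]
    have eq: "{\<omega> \<in> space (M n). \<not> (V n \<omega> \<in> ?U \<and> T n \<omega> < ennreal (\<kappa> + 1))} =
        {\<omega> \<in> space (M n). V n \<omega> \<notin> ?U} \<union> {\<omega> \<in> space (M n). T n \<omega> \<notin> ?W}" by auto
    moreover have "measure (M n) ({\<omega> \<in> space (M n). V n \<omega> \<notin> ?U} \<union> {\<omega> \<in> space (M n). T n \<omega> \<notin> ?W}) \<le>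
        measure (M n) {\<omega> \<in> space (M n). V n \<omega> \<notin> ?U} + measure (M n) {\<omega> \<in> space (M n). T n \<omega> \<notin> ?W}"
      by (rule measure_Un_le) measurable
    ultimately show ?case using elim unfolding eq by linarith
  qed
qed

lemma conv_in_prob_finite:
  fixes X :: "nat \<Rightarrow> 'i \<Rightarrow> 'b \<Rightarrow> real"
  assumes X: "\<And>t. t \<in> T \<Longrightarrow> conv_in_prob M (\<lambda>n. X n t) (c t)" and T: "finite T"
    and meas: "\<And>n t. n \<ge> 1 \<Longrightarrow> X n t \<in> borel_measurable (M n)"
    and pos: "\<delta> > 0" "e > 0"
  shows "\<forall>\<^sub>F n in sequentially. measure (M n) {\<omega> \<in> space (M n). \<not> (\<forall>t\<in>T. \<bar>X n t \<omega> - c t\<bar> < \<delta>)} < e"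
  using T X \<open>e > 0\<close>
proof (induction T arbitrary: e rule: finite_induct)
  case (insert t T)
  have "(\<lambda>n. \<P>(\<omega> in M n. X n t \<omega> \<notin> ball (c t) \<delta>)) \<longlonglongrightarrow> 0"
    using pos by (intro insert.prems(1)[unfolded conv_in_prob_def, rule_format]) auto
  from order_tendstoD(2)[OF this, of "e / 2"]
  have "\<forall>\<^sub>F n in sequentially. \<P>(\<omega> in M n. X n t \<omega> \<notin> ball (c t) \<delta>) < e / 2"
    using insert.prems by simp
  moreover have "\<forall>\<^sub>F n in sequentially. measure (M n) {\<omega> \<in> space (M n). \<not> (\<forall>t\<in>T. \<bar>X n t \<omega> - c t\<bar> < \<delta>)} < e / 2"
    using insert.prems by (intro insert.IH) auto
  ultimately show ?case
    using eventually_ge_at_top[of 1]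
  proof eventually_elim
    case (elim n)
    note [measurable] = meas[OF elim(3)]
    have [measurable]: "ball (c t) \<delta> \<in> sets borel" by simp
    have [simp]: "countable T" using insert.hyps by (simp add: countable_finite)
    have eq: "{\<omega> \<in> space (M n). \<not> (\<forall>t\<in>insert t T. \<bar>X n t \<omega> - c t\<bar> < \<delta>)} =
        {\<omega> \<in> space (M n). X n t \<omega> \<notin> ball (c t) \<delta>} \<union> {\<omega> \<in> space (M n). \<not> (\<forall>t\<in>T. \<bar>X n t \<omega> - c t\<bar> < \<delta>)}"
      by (auto simp: dist_real_def abs_minus_commute)
    moreover have "measure (M n) \<dots> \<le> measure (M n) {\<omega> \<in> space (M n). X n t \<omega> \<notin> ball (c t) \<delta>} +
        measure (M n) {\<omega> \<in> space (M n). \<not> (\<forall>t\<in>T. \<bar>X n t \<omega> - c t\<bar> < \<delta>)}"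
      using insert.hyps by (intro measure_Un_le) measurable
    ultimately show ?case using elim unfolding eq by linarith
  qed
qed simp

lemma coverage_measurable:
  "{w \<in> space ((\<Pi>\<^sub>M r\<in>{..<R0}. borel) \<Otimes>\<^sub>M (\<Pi>\<^sub>M b\<in>{..<B}. \<Pi>\<^sub>M r\<in>{..<R}. borel)). t \<in> I_O B R0 R q w}
    \<in> sets ((\<Pi>\<^sub>M r\<in>{..<R0}. borel) \<Otimes>\<^sub>M (\<Pi>\<^sub>M b\<in>{..<B}. \<Pi>\<^sub>M r\<in>{..<R}. (borel :: real measure)))"
proof -
  let ?N = "(\<Pi>\<^sub>M r\<in>{..<R0}. borel) \<Otimes>\<^sub>M (\<Pi>\<^sub>M b\<in>{..<B}. \<Pi>\<^sub>M r\<in>{..<R}. (borel :: real measure))"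
  have [measurable]: "(\<lambda>w. run_mean R0 (fst w)) \<in> borel_measurable ?N"
    by (rule measurable_compose[OF measurable_fst run_mean_measurable])
  have vm: "(\<lambda>w. run_mean R (snd w b)) \<in> borel_measurable ?N" if "b \<in> {..<B}" for b
    by (rule measurable_compose[OF measurable_compose[OF measurable_snd measurable_component_singleton[OF that]] run_mean_measurable])
  have [measurable]: "(\<lambda>w. \<Sum>b<B. (run_mean R (snd w b) - run_mean R0 (fst w))\<^sup>2) \<in> borel_measurable ?N"
    by (rule borel_measurable_sum) (use vm in measurable)
  have [measurable]: "S_O B R0 R \<in> borel_measurable ?N"
    unfolding S_O_def split_def by measurable
  show ?thesis unfolding I_O_def atLeastAtMost_iff by measurable
qed

context nested_sampling
begin

text \<open>Multiplying by sqrt n > 0 and centring at \<psi> of the empirical distribution turns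
  coverage into \<open>\<bar>a + e\<bar> \<le> q * rms_dev B e d\<close>, of which the ramp is a
  minorant. The iterated integral is the expectation of the ramp under the conditional product law,
  pushed forward to the run means.\<close>

lemma conditional_coverage_ge:
  fixes R0 R B :: nat and q k :: real
  assumes n: "n \<ge> 1" and x: "x \<in> space (data_law P n)" and k: "k \<ge> 0"
  defines "\<mu> \<equiv> distr (original_runs n R0 x) borel (\<lambda>u. sqrt (real n) * (run_mean R0 u - \<psi> (empirical P n x)))"
    and "\<nu> \<equiv> distr (mixed_runs n R x) borel (\<lambda>u. sqrt (real n) * (run_mean R u - \<psi> (empirical P n x)))"
    and "W \<equiv> original_runs n R0 x \<Otimes>\<^sub>M (\<Pi>\<^sub>M b\<in>{..<B}. mixed_runs n R x)"
  shows "real_distribution \<mu>" "real_distribution \<nu>"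
    "(\<integral>e. \<integral>d. soft_cover k q B (sqrt (real n) * (\<psi> (empirical P n x) - \<psi> P)) e d \<partial>(\<Pi>\<^sub>M b\<in>{..<B}. \<nu>) \<partial>\<mu>)
      \<le> measure W {w \<in> space W. \<psi> P \<in> I_O B R0 R q w}"
proof -
  let ?O = "original_runs n R0 x" and ?M = "mixed_runs n R x"
  let ?c = "sqrt (real n)" and ?m = "\<psi> (empirical P n x)"
  let ?a = "?c * (?m - \<psi> P)"
  have O: "prob_space ?O" and sO[measurable_cong]: "sets ?O = sets (\<Pi>\<^sub>M r\<in>{..<R0}. borel)"
    using measurable_space[OF original_runs_measurable[OF n] x, of R0] by (auto simp: space_prob_algebra)
  have M: "prob_space ?M" and sM[measurable_cong]: "sets ?M = sets (\<Pi>\<^sub>M r\<in>{..<R}. borel)"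
    using measurable_space[OF mixed_runs_measurable[OF n] x, of R] by (auto simp: space_prob_algebra)
  interpret O: prob_space ?O by (rule O)
  interpret M: prob_space ?M by (rule M)
  interpret PM: prob_space "\<Pi>\<^sub>M b\<in>{..<B}. ?M" by (rule prob_space_PiM) (rule M)
  interpret W: pair_prob_space ?O "\<Pi>\<^sub>M b\<in>{..<B}. ?M" ..
  define e where "e u = ?c * (run_mean R0 u - ?m)" for u
  define d where "d v = ?c * (run_mean R v - ?m)" for v
  have em[measurable]: "e \<in> borel_measurable (\<Pi>\<^sub>M r\<in>{..<R0}. borel)" unfolding e_def[abs_def] by measurable
  have dm[measurable]: "d \<in> borel_measurable (\<Pi>\<^sub>M r\<in>{..<R}. borel)" unfolding d_def[abs_def] by measurable
  have eO[measurable]: "e \<in> borel_measurable ?O" by measurable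
  have dM[measurable]: "d \<in> borel_measurable ?M" by measurable
  have \<mu>: "\<mu> = distr ?O borel e" and \<nu>: "\<nu> = distr ?M borel d" by (simp_all add: \<mu>_def \<nu>_def e_def[abs_def] d_def[abs_def])
  show \<mu>r: "real_distribution \<mu>" and \<nu>r: "real_distribution \<nu>"
    unfolding \<mu> \<nu> by (auto intro: O.real_distribution_distr M.real_distribution_distr)
  interpret \<nu>: real_distribution \<nu> by (rule \<nu>r)
  interpret P\<nu>: prob_space "\<Pi>\<^sub>M b\<in>{..<B}. \<nu>" by (rule prob_space_PiM) (rule \<nu>.prob_space_axioms)
  have s\<nu>[measurable_cong]: "sets \<nu> = sets borel" by simp
  have Dm[measurable]: "(\<lambda>v. \<lambda>b\<in>{..<B}. d (v b)) \<in> (\<Pi>\<^sub>M b\<in>{..<B}. ?M) \<rightarrow>\<^sub>M (\<Pi>\<^sub>M b\<in>{..<B}. borel)"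
    by (rule measurable_restrict) measurable
  have P\<nu>_eq: "(\<Pi>\<^sub>M b\<in>{..<B}. \<nu>) = distr (\<Pi>\<^sub>M b\<in>{..<B}. ?M) (\<Pi>\<^sub>M b\<in>{..<B}. borel) (\<lambda>v. \<lambda>b\<in>{..<B}. d (v b))"
  proof -
    have "distr (\<Pi>\<^sub>M b\<in>{..<B}. ?M) (\<Pi>\<^sub>M b\<in>{..<B}. \<nu>) (compose {..<B} d) = (\<Pi>\<^sub>M b\<in>{..<B}. distr ?M \<nu> d)"
      by (rule distr_PiM_finite_prob_space') (auto intro: M \<nu>.prob_space_axioms)
    moreover have "distr ?M \<nu> d = \<nu>" unfolding \<nu> by (intro distr_cong) auto
    moreover have "distr (\<Pi>\<^sub>M b\<in>{..<B}. ?M) (\<Pi>\<^sub>M b\<in>{..<B}. \<nu>) (compose {..<B} d) =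
        distr (\<Pi>\<^sub>M b\<in>{..<B}. ?M) (\<Pi>\<^sub>M b\<in>{..<B}. borel) (\<lambda>v. \<lambda>b\<in>{..<B}. d (v b))"
      by (intro distr_cong sets_PiM_cong) (auto simp: compose_def)
    ultimately show ?thesis by simp
  qed
  define f where "f = (\<lambda>w. soft_cover k q B ?a (e (fst w)) (\<lambda>b\<in>{..<B}. d (snd w b)))"
  have fm[measurable]: "f \<in> borel_measurable (?O \<Otimes>\<^sub>M (\<Pi>\<^sub>M b\<in>{..<B}. ?M))"
    unfolding f_def
  proof (rule soft_cover_measurable)
    show "(\<lambda>w. \<lambda>b\<in>{..<B}. d (snd w b)) \<in> ?O \<Otimes>\<^sub>M (\<Pi>\<^sub>M b\<in>{..<B}. ?M) \<rightarrow>\<^sub>M (\<Pi>\<^sub>M b\<in>{..<B}. borel)"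
      using measurable_compose[OF measurable_snd Dm] .
  qed measurable
  have fb: "0 \<le> f w" "f w \<le> 1" for w by (auto simp: f_def soft_cover_bounds)
  have inner: "(\<integral>d. soft_cover k q B ?a t d \<partial>(\<Pi>\<^sub>M b\<in>{..<B}. \<nu>)) = (\<integral>v. soft_cover k q B ?a t (\<lambda>b\<in>{..<B}. d (v b)) \<partial>(\<Pi>\<^sub>M b\<in>{..<B}. ?M))" for t
    unfolding P\<nu>_eq by (rule integral_distr[OF Dm]) measurable
  have innerm: "(\<lambda>t. \<integral>d. soft_cover k q B ?a t d \<partial>(\<Pi>\<^sub>M b\<in>{..<B}. \<nu>)) \<in> borel_measurable borel"
    by (rule lip01_measurable, rule lip01_integral[OF P\<nu>.prob_space_axioms], rule soft_cover_lip(2)[OF k refl]) measurable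
  have "(\<integral>e. \<integral>d. soft_cover k q B ?a e d \<partial>(\<Pi>\<^sub>M b\<in>{..<B}. \<nu>) \<partial>\<mu>) = (\<integral>u. \<integral>v. f (u, v) \<partial>(\<Pi>\<^sub>M b\<in>{..<B}. ?M) \<partial>?O)"
    unfolding \<mu> by (subst integral_distr[OF eO innerm]) (simp add: inner f_def)
  also have "\<dots> = integral\<^sup>L W f"
    unfolding W_def by (rule W.integral_fst'[OF W.integrable_01[OF fm fb]])
  also have "\<dots> \<le> (\<integral>w. indicator {w \<in> space W. \<psi> P \<in> I_O B R0 R q w} w \<partial>W)"
  proof (rule integral_mono)
    let ?X = "{w \<in> space W. \<psi> P \<in> I_O B R0 R q w}"
    have sW: "sets W = sets ((\<Pi>\<^sub>M r\<in>{..<R0}. borel) \<Otimes>\<^sub>M (\<Pi>\<^sub>M b\<in>{..<B}. \<Pi>\<^sub>M r\<in>{..<R}. (borel :: real measure)))"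
      unfolding W_def by (intro sets_pair_measure_cong sets_PiM_cong sO sM refl)
    have X: "?X \<in> sets W"
      unfolding sets_eq_imp_space_eq[OF sW] sW by (rule coverage_measurable)
    show "integrable W f" unfolding W_def by (rule W.integrable_01[OF fm fb])
    show "integrable W (indicator ?X :: _ \<Rightarrow> real)"
      by (rule integrable_real_indicator[OF X]) (simp add: W_def W.emeasure_eq_measure)
    fix w assume w: "w \<in> space W"
    obtain u v where uv: "w = (u, v)" by (cases w) auto
    have c: "?c > 0" using n by simp
    have "rms_dev B (e u) (\<lambda>b\<in>{..<B}. d (v b)) = sqrt (1 / real B * (\<Sum>b<B. ?c\<^sup>2 * (run_mean R (v b) - run_mean R0 u)\<^sup>2))"
      unfolding rms_dev_def
    proof (intro arg_cong[where f=sqrt] arg_cong2[where f="(*)"] refl sum.cong)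
      fix b assume "b \<in> {..<B}"
      moreover have "d (v b) - e u = ?c * (run_mean R (v b) - run_mean R0 u)"
        by (simp add: e_def d_def algebra_simps)
      ultimately show "((\<lambda>b\<in>{..<B}. d (v b)) b - e u)\<^sup>2 = ?c\<^sup>2 * (run_mean R (v b) - run_mean R0 u)\<^sup>2"
        by (simp only: restrict_apply' power_mult_distrib)
    qed
    also have "\<dots> = sqrt (?c\<^sup>2 * (1 / real B * (\<Sum>b<B. (run_mean R (v b) - run_mean R0 u)\<^sup>2)))"
      by (simp add: sum_distrib_left[symmetric])
    also have "\<dots> = ?c * S_O B R0 R w"
      unfolding real_sqrt_mult[of "?c\<^sup>2"] using c by (simp add: S_O_def uv)
    finally have rms: "rms_dev B (e u) (\<lambda>b\<in>{..<B}. d (v b)) = ?c * S_O B R0 R w" .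
    have "?a + e u = ?c * (run_mean R0 u - \<psi> P)" by (simp add: e_def algebra_simps)
    then have "\<bar>?a + e u\<bar> \<le> q * (?c * S_O B R0 R w) \<longleftrightarrow> \<bar>run_mean R0 u - \<psi> P\<bar> \<le> q * S_O B R0 R w"
      using c by (simp add: abs_mult mult.left_commute[of q])
    also have "\<dots> \<longleftrightarrow> \<psi> P \<in> I_O B R0 R q w"
      unfolding I_O_def uv by (auto simp: abs_le_iff)
    finally have iff: "\<bar>?a + e u\<bar> \<le> q * (?c * S_O B R0 R w) \<longleftrightarrow> \<psi> P \<in> I_O B R0 R q w" .
    have "f w \<le> (if \<bar>?a + e u\<bar> \<le> q * (?c * S_O B R0 R w) then 1 else 0)"
      unfolding f_def uv fst_conv snd_conv rms[symmetric, unfolded uv] by (rule soft_cover_le_indicator[OF k])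
    then show "f w \<le> indicator ?X w" unfolding iff using w by (auto simp: indicator_def split: if_splits)
  qed
  also have "\<dots> = measure W {w \<in> space W. \<psi> P \<in> I_O B R0 R q w}" by (simp add: Int_absorb2)
  finally show "(\<integral>e. \<integral>d. soft_cover k q B ?a e d \<partial>(\<Pi>\<^sub>M b\<in>{..<B}. \<nu>) \<partial>\<mu>)
      \<le> measure W {w \<in> space W. \<psi> P \<in> I_O B R0 R q w}" .
qed

end

section \<open>Asymptotic coverage\<close>

lemma lip01_integral_diff_le_1:
  assumes g: "lip01 L g" and M: "real_distribution M" and N: "real_distribution N"
  shows "\<bar>integral\<^sup>L M g - integral\<^sup>L N g\<bar> \<le> 1"
proof -
  interpret M: real_distribution M by (rule M)
  interpret N: real_distribution N by (rule N)
  have "0 \<le> integral\<^sup>L M g" "integral\<^sup>L M g \<le> 1" "0 \<le> integral\<^sup>L N g" "integral\<^sup>L N g \<le> 1"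
    using lip01_measurable[OF g] by (auto intro!: M.integral_01 N.integral_01 lip01_bounds[OF g])
  then show ?thesis by linarith
qed

text \<open>Integrates the pointwise error. \<open>b\<close> is a conditional failure probability
  that enters linearly, so it is averaged over the data and needs no threshold of its own.\<close>

lemma (in prob_space) expectation_error_bound:
  fixes f h b :: "'a \<Rightarrow> real"
  assumes f: "integrable M f" and h: "integrable M h" and b: "integrable M b"
    and sets: "X \<in> sets M" "Y \<in> sets M"
    and le: "\<And>x. x \<in> space M \<Longrightarrow> h x - (e + indicator X x + c * (2 * e + b x + indicator Y x)) \<le> f x"
  shows "integral\<^sup>L M h - (e + prob X + c * (2 * e + integral\<^sup>L M b + prob Y)) \<le> integral\<^sup>L M f"
proof -
  have i: "integrable M (indicator X :: _ \<Rightarrow> real)" "integrable M (indicator Y :: _ \<Rightarrow> real)"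
    using sets by (auto simp: emeasure_eq_measure)
  have eq: "X \<inter> space M = X" "Y \<inter> space M = Y"
    using sets by simp_all
  have iT: "integrable M (\<lambda>x. e + indicator X x + c * (2 * e + b x + indicator Y x))"
    using i b by (intro Bochner_Integration.integrable_add integrable_mult_right integrable_const)
  have "(\<integral>x. e + indicator X x + c * (2 * e + b x + indicator Y x) \<partial>M) = e + prob X + c * (2 * e + integral\<^sup>L M b + prob Y)"
    using i b by (simp add: eq prob_space)
  then have "integral\<^sup>L M h - (e + prob X + c * (2 * e + integral\<^sup>L M b + prob Y)) =
      (\<integral>x. h x - (e + indicator X x + c * (2 * e + b x + indicator Y x)) \<partial>M)"
    using h iT by (subst Bochner_Integration.integral_diff) simp_all
  also have "\<dots> \<le> integral\<^sup>L M f"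
    by (rule integral_mono[OF Bochner_Integration.integrable_diff[OF h iT] f le])
  finally show ?thesis .
qed

context nested_sampling
begin

text \<open>With the slope \<open>k\<close> held fixed, the noise and the resampling are replaced
  conditionally, outside exceptional data; the data error is replaced last and unconditionally,
  through the Lipschitz function \<open>f2\<close>.\<close>

lemma coverage_eventually_ge:
  fixes B :: nat and R0 R :: "nat \<Rightarrow> nat" and \<sigma> p0 p q k \<epsilon> :: real
  assumes \<sigma>: "\<sigma> > 0"
    and clt: "weak_conv_m
      (\<lambda>n. distr (data_law P n) borel (\<lambda>x. sqrt (real n) * (\<psi> (empirical P n x) - \<psi> P)))
      (normal_dist \<sigma>)"
    and bootstrap_clt: "\<And>t. conv_in_prob (data_law P)
      (\<lambda>n x. \<P>(j in index_law n.
         sqrt (real n) * (\<psi> (resample_empirical P n x j) - \<psi> (empirical P n x)) \<le> t))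
      (cdf (normal_dist \<sigma>) t)"
    and var_P: "noise_var run P = ennreal v" "v > 0"
    and abs3_P: "noise_abs3 \<psi> run P = ennreal \<kappa>" "\<kappa> \<ge> 0"
    and var_empirical: "conv_in_prob (data_law P)
      (\<lambda>n x. noise_var run (empirical P n x)) (noise_var run P)"
    and abs3_empirical: "conv_in_prob (data_law P)
      (\<lambda>n x. noise_abs3 \<psi> run (empirical P n x)) (noise_abs3 \<psi> run P)"
    and var_resample: "conv_in_prob (\<lambda>n. data_law P n \<Otimes>\<^sub>M index_law n)
      (\<lambda>n (x, j). noise_var run (resample_empirical P n x j)) (noise_var run P)"
    and abs3_resample: "conv_in_prob (\<lambda>n. data_law P n \<Otimes>\<^sub>M index_law n)
      (\<lambda>n (x, j). noise_abs3 \<psi> run (resample_empirical P n x j)) (noise_abs3 \<psi> run P)"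
    and R0: "filterlim R0 at_top sequentially" "0 < p0" "(\<lambda>n. real (R0 n) / real n) \<longlonglongrightarrow> p0"
    and R: "filterlim R at_top sequentially" "0 < p" "(\<lambda>n. real (R n) / real n) \<longlonglongrightarrow> p"
    and k: "k \<ge> 0" and \<epsilon>: "\<epsilon> > 0" and s: "s > 0" "s\<^sup>2 = \<sigma>\<^sup>2 + v / p"
  shows "\<forall>\<^sub>F n in sequentially.
    (\<integral>a. \<integral>x. \<integral>d. soft_cover k q B a x d \<partial>(\<Pi>\<^sub>M b\<in>{..<B}. scaled_normal s) \<partial>scaled_normal (sqrt (v / p0)) \<partial>scaled_normal \<sigma>) - \<epsilon>
      \<le> \<P>(w in nested_law P run n B (R0 n) (R n). \<psi> P \<in> I_O B (R0 n) (R n) q w)"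
proof -
  define L where "L = k * (\<bar>q\<bar> + 1)"
  \<comment> \<open>Error budget: one \<open>e\<close> each for the data error, the original noise
    and \<open>bad0\<close>; for each of the B resamples 2 e from its two replacements and one
    \<open>e\<close> each from \<open>bad1\<close> and \<open>bad2\<close>.\<close>
  define e where "e = \<epsilon> / (3 + 4 * real B)"
  have e: "e > 0" using \<epsilon> by (simp add: e_def)
  have e\<epsilon>: "(3 + 4 * real B) * e = \<epsilon>" by (simp add: e_def)
  define \<eta>0 where "\<eta>0 = sqrt (v / p0)"
  define \<eta> where "\<eta> = sqrt (v / p)"
  have s2: "s\<^sup>2 = \<sigma>\<^sup>2 + \<eta>\<^sup>2" using var_P R s by (simp add: \<eta>_def)
  define f2 where "f2 = (\<lambda>a. \<integral>x. \<integral>d. soft_cover k q B a x d \<partial>(\<Pi>\<^sub>M b\<in>{..<B}. scaled_normal s) \<partial>scaled_normal \<eta>0)"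
  define A where "A n x = sqrt (real n) * (\<psi> (empirical P n x) - \<psi> P)" for n x
  interpret Ns: real_distribution "scaled_normal s" by (rule real_distribution_scaled_normal)
  interpret N\<eta>: real_distribution "scaled_normal \<eta>0" by (rule real_distribution_scaled_normal)
  interpret PNs: prob_space "\<Pi>\<^sub>M b\<in>{..<B}. scaled_normal s" by (rule prob_space_PiM) (rule Ns.prob_space_axioms)
  interpret X: prob_space "data_law P n" for n by (rule prob_space_data_law[OF P(1)])
  have f2lip: "lip01 L f2"
    unfolding f2_def
  proof (rule lip01_integral[OF N\<eta>.prob_space_axioms])
    fix x show "lip01 L (\<lambda>a. \<integral>d. soft_cover k q B a x d \<partial>(\<Pi>\<^sub>M b\<in>{..<B}. scaled_normal s))"
      by (rule lip01_integral[OF PNs.prob_space_axioms], rule soft_cover_lip(1)[OF k L_def]) measurable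
  next
    fix a
    have "lip01 L (\<lambda>x. \<integral>d. soft_cover k q B a x d \<partial>(\<Pi>\<^sub>M b\<in>{..<B}. scaled_normal s))"
      by (rule lip01_integral[OF PNs.prob_space_axioms], rule soft_cover_lip(2)[OF k L_def]) measurable
    from lip01_measurable[OF this]
    show "(\<lambda>x. \<integral>d. soft_cover k q B a x d \<partial>(\<Pi>\<^sub>M b\<in>{..<B}. scaled_normal s)) \<in> borel_measurable (scaled_normal \<eta>0)"
      by simp
  qed
  have Am: "A n \<in> borel_measurable (data_law P n)" for n
  \<comment> \<open>Measurability of \<psi> is available for positive sample sizes; at n = 0 the
    factor sqrt 0 makes \<open>A\<close> constant.\<close>
  proof (cases "n = 0")
    case False
    then have "n \<ge> 1" by simp
    note [measurable] = \<psi>_empirical_measurable[OF this]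
    show ?thesis unfolding A_def[abs_def] by measurable
  qed (simp add: A_def[abs_def])
  obtain \<delta>0 where \<delta>0: "\<delta>0 > 0" "\<forall>\<^sub>F n in sequentially. \<forall>Q g. real_distribution Q \<longrightarrow> near_moments v \<delta>0 (\<kappa> + 1) Q \<longrightarrow> lip01 L g \<longrightarrow>
    \<bar>(\<integral>u. g (sqrt (real n) * (run_mean (R0 n) u - integral\<^sup>L Q (\<lambda>y. y))) \<partial>(\<Pi>\<^sub>M r\<in>{..<R0 n}. Q))
      - (\<integral>z. g (\<eta>0 * z) \<partial>std_normal)\<bar> \<le> e"
    using uniform_clt[OF R0(1,3,2) var_P(2) e, of "\<kappa> + 1" L] unfolding \<eta>0_def by blast
  obtain \<delta>1 where \<delta>1: "\<delta>1 > 0" "\<forall>\<^sub>F n in sequentially. \<forall>Q g. real_distribution Q \<longrightarrow> near_moments v \<delta>1 (\<kappa> + 1) Q \<longrightarrow> lip01 L g \<longrightarrow>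
    \<bar>(\<integral>u. g (sqrt (real n) * (run_mean (R n) u - integral\<^sup>L Q (\<lambda>y. y))) \<partial>(\<Pi>\<^sub>M r\<in>{..<R n}. Q))
      - (\<integral>z. g (\<eta> * z) \<partial>std_normal)\<bar> \<le> e"
    using uniform_clt[OF R(1,3,2) var_P(2) e, of "\<kappa> + 1" L] unfolding \<eta>_def by blast
  have N\<sigma>: "real_distribution (normal_dist \<sigma>)"
    unfolding normal_dist_eq_scaled[OF \<sigma>] by (rule real_distribution_scaled_normal)
  obtain \<delta>2 T where \<delta>2: "\<delta>2 > 0" "finite T" "\<And>M g. real_distribution M \<Longrightarrow>
    (\<forall>t\<in>T. \<bar>cdf M t - cdf (normal_dist \<sigma>) t\<bar> < \<delta>2) \<Longrightarrow> lip01 L g \<Longrightarrow> \<bar>integral\<^sup>L M g - integral\<^sup>L (normal_dist \<sigma>) g\<bar> \<le> e"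
    using cdf_close_imp_lip01_close[OF N\<sigma> isCont_cdf_normal_dist[OF \<sigma>] e, of L] by blast
  \<comment> \<open>The exceptional events: wrong noise moments at the sample (\<open>bad0\<close>),
    wrong noise moments at a resample, an event in data and indices jointly (\<open>bad1\<close>),
    and a conditional bootstrap distribution function that is off at a point of \<open>T\<close>
    (\<open>bad2\<close>).\<close>
  define bad0 where "bad0 n = {x \<in> space (data_law P n). \<not> (noise_var run (empirical P n x) \<in> {ennreal (v - \<delta>0)<..<ennreal (v + \<delta>0)} \<and>
      noise_abs3 \<psi> run (empirical P n x) < ennreal (\<kappa> + 1))}" for n
  define bad1 where "bad1 n = {w \<in> space (data_law P n \<Otimes>\<^sub>M index_law n).
      \<not> (noise_var run (resample_empirical P n (fst w) (snd w)) \<in> {ennreal (v - \<delta>1)<..<ennreal (v + \<delta>1)} \<and>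
      noise_abs3 \<psi> run (resample_empirical P n (fst w) (snd w)) < ennreal (\<kappa> + 1))}" for n
  define G where "G n t x = \<P>(j in index_law n. sqrt (real n) * (\<psi> (resample_empirical P n x j) - \<psi> (empirical P n x)) \<le> t)" for n t x
  define bad2 where "bad2 n = {x \<in> space (data_law P n). \<not> (\<forall>t\<in>T. \<bar>G n t x - cdf (normal_dist \<sigma>) t\<bar> < \<delta>2)}" for n
  have Gm: "G n t \<in> borel_measurable (data_law P n)" if n: "n \<ge> 1" for n t
  proof -
    interpret I: prob_space "index_law n" by (rule prob_space_index_law[OF n])
    note [measurable] = measurable_compose[OF measurable_fst \<psi>_empirical_measurable[OF n]] \<psi>_resample_measurable[OF n]
    let ?Z = "{w \<in> space (data_law P n \<Otimes>\<^sub>M index_law n).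
      sqrt (real n) * (\<psi> (resample_empirical P n (fst w) (snd w)) - \<psi> (empirical P n (fst w))) \<le> t}"
    have "?Z \<in> sets (data_law P n \<Otimes>\<^sub>M index_law n)" by measurable
    from borel_measurable_enn2real[OF I.measurable_emeasure_Pair[OF this]]
    have "(\<lambda>x. measure (index_law n) (Pair x -` ?Z)) \<in> borel_measurable (data_law P n)" by (simp add: measure_def)
    then show ?thesis
      by (rule measurable_cong[THEN iffD1, rotated])
         (auto simp: G_def space_pair_measure intro!: arg_cong2[where f=measure])
  qed
  have ev0: "\<forall>\<^sub>F n in sequentially. measure (data_law P n) (bad0 n) < e"
    unfolding bad0_def using var_empirical abs3_empirical noise_var_measurable noise_abs3_measurable var_P abs3_P \<delta>0(1) e
    by (intro conv_in_prob_near) (auto intro: X.prob_space_axioms)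
  have ev1: "\<forall>\<^sub>F n in sequentially. measure (data_law P n \<Otimes>\<^sub>M index_law n) (bad1 n) < e"
    unfolding bad1_def
  proof (rule conv_in_prob_near[OF _ _ _ var_P(2) abs3_P(2) \<delta>1(1) e])
    fix n :: nat assume n: "n \<ge> 1"
    show "prob_space (data_law P n \<Otimes>\<^sub>M index_law n) \<and>
      (\<lambda>w. noise_var run (resample_empirical P n (fst w) (snd w))) \<in> borel_measurable (data_law P n \<Otimes>\<^sub>M index_law n) \<and>
      (\<lambda>w. noise_abs3 \<psi> run (resample_empirical P n (fst w) (snd w))) \<in> borel_measurable (data_law P n \<Otimes>\<^sub>M index_law n)"
      by (intro conjI prob_space_pair X.prob_space_axioms prob_space_index_law noise_resample_measurable n)
  qed (use var_resample abs3_resample var_P abs3_P in \<open>simp_all add: split_def\<close>)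
  have ev2: "\<forall>\<^sub>F n in sequentially. measure (data_law P n) (bad2 n) < e"
    unfolding bad2_def using bootstrap_clt \<delta>2(1,2) e Gm
    by (intro conv_in_prob_finite) (auto simp: G_def[abs_def])
  have dA: "real_distribution (distr (data_law P n) borel (A n))" for n
    by (rule X.real_distribution_distr[OF Am])
  have "weak_conv_m (\<lambda>n. distr (data_law P n) borel (A n)) (normal_dist \<sigma>)"
    using clt unfolding A_def[abs_def] .
  from weak_conv_imp_lip01_close[OF dA N\<sigma> this e, of L]
  have evA: "\<forall>\<^sub>F n in sequentially. \<bar>integral\<^sup>L (distr (data_law P n) borel (A n)) f2 - integral\<^sup>L (normal_dist \<sigma>) f2\<bar> \<le> e"
    by eventually_elim (use f2lip in blast)
  show ?thesis
    using ev0 ev1 ev2 evA \<delta>0(2) \<delta>1(2) eventually_ge_at_top[of 1]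
  proof eventually_elim
    case (elim n)
    have n: "n \<ge> 1" by (rule elim)
    let ?X = "data_law P n" and ?I = "index_law n"
    interpret I: prob_space ?I by (rule prob_space_index_law[OF n])
    define W where "W x = original_runs n (R0 n) x \<Otimes>\<^sub>M (\<Pi>\<^sub>M b\<in>{..<B}. mixed_runs n (R n) x)" for x
    let ?N = "(\<Pi>\<^sub>M r\<in>{..<R0 n}. borel) \<Otimes>\<^sub>M (\<Pi>\<^sub>M b\<in>{..<B}. \<Pi>\<^sub>M r\<in>{..<R n}. (borel :: real measure))"
    have Wm: "W \<in> ?X \<rightarrow>\<^sub>M prob_algebra ?N"
      unfolding W_def[abs_def]
      by (intro measurable_pair_prob original_runs_measurable measurable_PiM_prob_algebra mixed_runs_measurable n) simp
    have nl: "nested_law P run n B (R0 n) (R n) = ?X \<bind> W"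
      unfolding W_def[abs_def] by (rule nested_law_eq[OF n])
    let ?Ev = "{w \<in> space ?N. \<psi> P \<in> I_O B (R0 n) (R n) q w}"
    have Ev: "?Ev \<in> sets ?N" by (rule coverage_measurable)
    have Xp: "?X \<in> space (prob_algebra ?X)" by (simp add: space_prob_algebra X.prob_space_axioms)
    have sp: "space (?X \<bind> W) = space ?N" by (rule sets_eq_imp_space_eq[OF sets_bind'[OF Xp Wm]])
    have prob_eq: "\<P>(w in nested_law P run n B (R0 n) (R n). \<psi> P \<in> I_O B (R0 n) (R n) q w) = (\<integral>x. measure (W x) ?Ev \<partial>?X)"
      unfolding nl sp by (rule X.measure_bind[OF measurable_prob_algebraD[OF Wm] Ev])
    have Wx: "prob_space (W x)" "space (W x) = space ?N" if "x \<in> space ?X" for x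
      using measurable_space[OF Wm that] by (auto simp: space_prob_algebra dest: sets_eq_imp_space_eq)
    \<comment> \<open>Conditional probability of \<open>bad1\<close> given the data; its mean is the
      joint probability of \<open>bad1\<close>, which is below \<open>e\<close>.\<close>
    define b where "b x = measure ?I (Pair x -` bad1 n)" for x
    have bad0m: "bad0 n \<in> sets ?X"
    proof -
      note [measurable] = noise_var_measurable[OF n] noise_abs3_measurable[OF n]
      show ?thesis unfolding bad0_def by measurable
    qed
    have bad1m: "bad1 n \<in> sets (?X \<Otimes>\<^sub>M ?I)"
    proof -
      note [measurable] = noise_resample_measurable[OF n]
      show ?thesis unfolding bad1_def by measurable
    qed
    have bad2m: "bad2 n \<in> sets ?X"
    proof -
      note [measurable] = Gm[OF n]
      have [simp]: "countable T" using \<delta>2(2) by (rule countable_finite)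
      show ?thesis unfolding bad2_def using \<delta>2(2) by measurable
    qed
    have bm: "b \<in> borel_measurable ?X"
      using borel_measurable_enn2real[OF I.measurable_emeasure_Pair[OF bad1m]] by (simp add: b_def[abs_def] measure_def)
    have bint: "integrable ?X b" by (rule X.integrable_01[OF bm]) (auto simp: b_def)
    have bI: "integral\<^sup>L ?X b = measure (?X \<Otimes>\<^sub>M ?I) (bad1 n)"
    proof -
      interpret XI: pair_prob_space ?X ?I ..
      have "ennreal (measure (?X \<Otimes>\<^sub>M ?I) (bad1 n)) = (\<integral>\<^sup>+x. emeasure ?I (Pair x -` bad1 n) \<partial>?X)"
        unfolding XI.emeasure_eq_measure[symmetric] by (rule I.emeasure_pair_measure_alt[OF bad1m])
      also have "\<dots> = (\<integral>\<^sup>+x. ennreal (b x) \<partial>?X)" by (simp add: b_def I.emeasure_eq_measure)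
      also have "\<dots> = ennreal (integral\<^sup>L ?X b)" by (rule nn_integral_eq_integral[OF bint]) (simp add: b_def)
      finally show ?thesis by (subst (asm) ennreal_inj) (auto simp: b_def intro!: integral_nonneg_AE)
    qed
    have pointwise: "f2 (A n x) - (e + indicator (bad0 n) x + real B * (2 * e + b x + indicator (bad2 n) x)) \<le> measure (W x) ?Ev"
      if x: "x \<in> space ?X" for x
    proof -
      define \<mu> where "\<mu> = distr (original_runs n (R0 n) x) borel (\<lambda>u. sqrt (real n) * (run_mean (R0 n) u - \<psi> (empirical P n x)))"
      define \<nu> where "\<nu> = distr (mixed_runs n (R n) x) borel (\<lambda>u. sqrt (real n) * (run_mean (R n) u - \<psi> (empirical P n x)))"
      note cc = conditional_coverage_ge(1)[OF n x k, where ?R0.0="R0 n", folded \<mu>_def]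
        conditional_coverage_ge(2)[OF n x k, where R="R n", folded \<nu>_def]
        conditional_coverage_ge(3)[OF n x k, where ?R0.0="R0 n" and R="R n" and q=q and B=B, folded \<mu>_def \<nu>_def A_def W_def]
      have bx: "Pair x -` bad1 n = {j \<in> space ?I. \<not> near_moments v \<delta>1 (\<kappa> + 1) (run (resample_empirical P n x j))}"
        using x near_moments_run[OF resample_D[OF n x]] by (auto simp: bad1_def space_pair_measure)
      \<comment> \<open>Outside \<open>bad0\<close> the uniform limit theorem applies to this one
        law; on \<open>bad0\<close> the trivial bound 1 is paid by the indicator.\<close>
      have c0: "\<bar>integral\<^sup>L \<mu> g - integral\<^sup>L (scaled_normal \<eta>0) g\<bar> \<le> e + indicator (bad0 n) x" if g: "lip01 L g" for g
      proof (cases "x \<in> bad0 n")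
        case True
        then show ?thesis using lip01_integral_diff_le_1[OF g cc(1) N\<eta>.real_distribution_axioms] e by simp
      next
        case False
        note [measurable] = lip01_measurable[OF g]
        have Ed: "empirical P n x \<in> D" by (rule data_D[OF n x])
        have near: "near_moments v \<delta>0 (\<kappa> + 1) (run (empirical P n x))"
          using False x unfolding near_moments_run[OF Ed] bad0_def by blast
        have sO: "sets (original_runs n (R0 n) x) = sets (\<Pi>\<^sub>M r\<in>{..<R0 n}. borel)"
          using measurable_space[OF original_runs_measurable[OF n] x] by (auto simp: space_prob_algebra)
        have "integral\<^sup>L \<mu> g = (\<integral>u. g (sqrt (real n) * (run_mean (R0 n) u - \<psi> (empirical P n x))) \<partial>original_runs n (R0 n) x)"
          unfolding \<mu>_def by (rule integral_distr[OF run_mean_kernel_measurable[OF sO]]) measurable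
        moreover have "integral\<^sup>L (scaled_normal \<eta>0) g = (\<integral>z. g (\<eta>0 * z) \<partial>std_normal)"
          by (rule integral_distr) measurable
        moreover have "\<bar>(\<integral>u. g (sqrt (real n) * (run_mean (R0 n) u - \<psi> (empirical P n x))) \<partial>original_runs n (R0 n) x)
            - (\<integral>z. g (\<eta>0 * z) \<partial>std_normal)\<bar> \<le> e"
          using elim(5) real_distribution_run[OF Ed] near g unfolding original_runs_def unbiased(2)[OF Ed, symmetric] by blast
        ultimately show ?thesis using False by simp
      qed
      have c1: "\<bar>integral\<^sup>L \<nu> g - integral\<^sup>L (scaled_normal s) g\<bar> \<le> 2 * e + b x + indicator (bad2 n) x" if g: "lip01 L g" for g
      proof (cases "x \<in> bad2 n")
        case True
        have "0 \<le> b x" by (simp add: b_def)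
        then show ?thesis using True lip01_integral_diff_le_1[OF g cc(2) Ns.real_distribution_axioms] e by simp
      next
        case False
        let ?C = "\<lambda>j. sqrt (real n) * (\<psi> (resample_empirical P n x j) - \<psi> (empirical P n x))"
        have [measurable]: "(\<lambda>j. \<psi> (resample_empirical P n x j)) \<in> borel_measurable ?I"
          using measurable_compose[OF measurable_Pair1'[OF x] \<psi>_resample_measurable[OF n]] by simp
        have Cm: "?C \<in> borel_measurable ?I" by measurable
        have "\<bar>integral\<^sup>L \<nu> g - integral\<^sup>L (scaled_normal s) g\<bar> \<le> 2 * e + measure ?I {j \<in> space ?I. \<not> near_moments v \<delta>1 (\<kappa> + 1) (run (resample_empirical P n x j))}"
          unfolding \<nu>_def
        proof (rule mixed_runs_close[OF n x g _ _ \<sigma> s(1) s2])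
          show "\<bar>(\<integral>u. g (sqrt (real n) * (run_mean (R n) u - integral\<^sup>L Q (\<lambda>y. y))) \<partial>(\<Pi>\<^sub>M r\<in>{..<R n}. Q))
              - (\<integral>z. g (\<eta> * z) \<partial>std_normal)\<bar> \<le> e"
            if "real_distribution Q" "near_moments v \<delta>1 (\<kappa> + 1) Q" "lip01 L g" for Q g
            using elim(6) that by blast
          show "\<bar>(\<integral>j. g (?C j) \<partial>?I) - integral\<^sup>L (scaled_normal \<sigma>) g\<bar> \<le> e" if g: "lip01 L g" for g
          proof -
            note [measurable] = lip01_measurable[OF g]
            have "\<bar>integral\<^sup>L (distr ?I borel ?C) g - integral\<^sup>L (normal_dist \<sigma>) g\<bar> \<le> e"
            proof (rule \<delta>2(3)[OF I.real_distribution_distr[OF Cm] _ g])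
              have "cdf (distr ?I borel ?C) t = G n t x" for t
                unfolding cdf_def G_def by (subst measure_distr[OF Cm]) (auto intro!: arg_cong2[where f=measure])
              then show "\<forall>t\<in>T. \<bar>cdf (distr ?I borel ?C) t - cdf (normal_dist \<sigma>) t\<bar> < \<delta>2"
                using False x by (simp add: bad2_def)
            qed
            then show ?thesis unfolding normal_dist_eq_scaled[OF \<sigma>] by (subst (asm) (1) integral_distr[OF Cm]) auto
          qed
        qed (use e in simp)
        then show ?thesis using False unfolding b_def bx by simp
      qed
      have f2A: "f2 (A n x) = (\<integral>u. \<integral>d. soft_cover k q B (A n x) u d \<partial>(\<Pi>\<^sub>M b\<in>{..<B}. scaled_normal s) \<partial>scaled_normal \<eta>0)"
        by (simp add: f2_def)
      have "\<bar>(\<integral>u. \<integral>d. soft_cover k q B (A n x) u d \<partial>(\<Pi>\<^sub>M b\<in>{..<B}. \<nu>) \<partial>\<mu>) - f2 (A n x)\<bar>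
          \<le> (e + indicator (bad0 n) x) + real B * (2 * e + b x + indicator (bad2 n) x)"
        unfolding f2A by (rule nested_integral_close[OF cc(1,2) N\<eta>.real_distribution_axioms Ns.real_distribution_axioms k L_def c0 c1])
      moreover have "(\<integral>u. \<integral>d. soft_cover k q B (A n x) u d \<partial>(\<Pi>\<^sub>M b\<in>{..<B}. \<nu>) \<partial>\<mu>) \<le> measure (W x) ?Ev"
        using cc(3) unfolding Wx(2)[OF x] .
      ultimately show ?thesis by linarith
    qed
    have f2m: "f2 \<in> borel_measurable borel" by (rule lip01_measurable[OF f2lip])
    have "integral\<^sup>L ?X (\<lambda>x. f2 (A n x)) - (e + measure ?X (bad0 n) + real B * (2 * e + integral\<^sup>L ?X b + measure ?X (bad2 n)))
        \<le> (\<integral>x. measure (W x) ?Ev \<partial>?X)"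
    proof (rule X.expectation_error_bound[OF _ _ bint bad0m bad2m pointwise])
      show "integrable ?X (\<lambda>x. measure (W x) ?Ev)"
        using measurable_compose[OF measurable_prob_algebraD[OF Wm] measurable_measure_subprob_algebra[OF Ev]] Wx(1)
        by (intro X.integrable_const_bound[where B=1]) (auto intro!: AE_I2 prob_space.prob_le_1)
      show "integrable ?X (\<lambda>x. f2 (A n x))"
        by (intro X.integrable_01 measurable_compose[OF Am f2m] lip01_bounds[OF f2lip])
    qed
    moreover have "integral\<^sup>L ?X (\<lambda>x. f2 (A n x)) = integral\<^sup>L (distr ?X borel (A n)) f2"
      by (rule integral_distr[OF Am f2m, symmetric])
    moreover have "real B * (2 * e + integral\<^sup>L ?X b + measure ?X (bad2 n)) \<le> real B * (4 * e)"
      using elim(2,3) unfolding bI by (intro mult_left_mono) auto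
    moreover have "integral\<^sup>L (normal_dist \<sigma>) f2 = (\<integral>a. f2 a \<partial>scaled_normal \<sigma>)"
      unfolding normal_dist_eq_scaled[OF \<sigma>] ..
    moreover have "3 * e + real B * (4 * e) = \<epsilon>" using e\<epsilon> by (simp add: algebra_simps)
    ultimately have "(\<integral>a. f2 a \<partial>scaled_normal \<sigma>) - \<epsilon> \<le> (\<integral>x. measure (W x) ?Ev \<partial>?X)"
      using elim(1,4) by linarith
    then show ?case unfolding prob_eq f2_def \<eta>0_def .
  qed
qed

end

theorem theorem4:
  fixes P :: "'a measure"
    and D :: "'a measure set"
    and \<psi> :: "'a measure \<Rightarrow> real"
    and run :: "'a measure \<Rightarrow> real measure"
    and B :: nat and R0 R :: "nat \<Rightarrow> nat"
    and \<alpha> \<sigma> p0 p \<rho> :: real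
  assumes B: "B \<ge> 1" and \<alpha>: "0 < \<alpha>" "\<alpha> < 1"
    \<comment> \<open>\<open>D\<close> is the set of distributions on which \<open>\<psi>\<close> and the noisy runs are defined\<close>
    and P: "prob_space P" "P \<in> D"
    and D: "D \<subseteq> space (prob_algebra P)"
      "\<And>n x. n \<ge> 1 \<Longrightarrow> x \<in> {..<n} \<rightarrow> space P \<Longrightarrow> empirical P n x \<in> D"
    and run: "\<And>Q. Q \<in> D \<Longrightarrow> run Q \<in> space (prob_algebra borel)"
    and unbiased: "\<And>Q. Q \<in> D \<Longrightarrow> integrable (run Q) (\<lambda>y. y)"
      "\<And>Q. Q \<in> D \<Longrightarrow> (\<integral>y. y \<partial>run Q) = \<psi> Q"
    and run_measurable:
      "\<And>n. n \<ge> 1 \<Longrightarrow> (\<lambda>x. run (empirical P n x)) \<in> data_law P n \<rightarrow>\<^sub>M prob_algebra borel"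
    and \<sigma>: "\<sigma> > 0"
    and clt: "weak_conv_m
      (\<lambda>n. distr (data_law P n) borel (\<lambda>x. sqrt (real n) * (\<psi> (empirical P n x) - \<psi> P)))
      (normal_dist \<sigma>)"
    and bootstrap_clt: "\<And>t. conv_in_prob (data_law P)
      (\<lambda>n x. \<P>(j in index_law n.
         sqrt (real n) * (\<psi> (resample_empirical P n x j) - \<psi> (empirical P n x)) \<le> t))
      (cdf (normal_dist \<sigma>) t)"
    and var_P: "0 < noise_var run P" "noise_var run P < \<infinity>"
    and abs3_P: "noise_abs3 \<psi> run P < \<infinity>"
    and var_empirical: "conv_in_prob (data_law P)
      (\<lambda>n x. noise_var run (empirical P n x)) (noise_var run P)"
    and abs3_empirical: "conv_in_prob (data_law P)
      (\<lambda>n x. noise_abs3 \<psi> run (empirical P n x)) (noise_abs3 \<psi> run P)"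
    and var_resample: "conv_in_prob (\<lambda>n. data_law P n \<Otimes>\<^sub>M index_law n)
      (\<lambda>n (x, j). noise_var run (resample_empirical P n x j)) (noise_var run P)"
    and abs3_resample: "conv_in_prob (\<lambda>n. data_law P n \<Otimes>\<^sub>M index_law n)
      (\<lambda>n (x, j). noise_abs3 \<psi> run (resample_empirical P n x j)) (noise_abs3 \<psi> run P)"
    and R0: "filterlim R0 at_top sequentially" "0 < p0" "p0 < 1"
      "(\<lambda>n. real (R0 n) / real n) \<longlonglongrightarrow> p0"
    and R: "filterlim R at_top sequentially" "0 < p" "p < 1"
      "(\<lambda>n. real (R n) / real n) \<longlonglongrightarrow> p"
    and \<rho>: "\<rho> = sqrt (p0 / p)"
  shows "liminf (\<lambda>n. ereal (\<P>(w in nested_law P run n B (R0 n) (R n).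
           \<psi> P \<in> I_O B (R0 n) (R n) (q_O B \<rho> (1 - \<alpha> / 2)) w))) \<ge> ereal (1 - \<alpha>)"
proof -
  interpret nested_sampling P D \<psi> run
    by (rule nested_sampling.intro) (fact P D(2) run unbiased run_measurable)+
  define v where "v = enn2real (noise_var run P)"
  define \<kappa> where "\<kappa> = enn2real (noise_abs3 \<psi> run P)"
  have v: "noise_var run P = ennreal v" "v > 0"
    using var_P by (auto simp: v_def enn2real_positive_iff)
  have \<kappa>: "noise_abs3 \<psi> run P = ennreal \<kappa>" "\<kappa> \<ge> 0"
    using abs3_P by (auto simp: \<kappa>_def)
  define s where "s = sqrt (\<sigma>\<^sup>2 + v / p)"
  have vp: "v / p > 0" using v R by simp
  have s: "s > 0" "s\<^sup>2 = \<sigma>\<^sup>2 + v / p"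
    using \<sigma> vp by (simp_all add: s_def add_pos_pos add_nonneg_nonneg)
  \<comment> \<open>Since (v / p0) \<rho>^2 = v / p, this is the variance relation under which the
    Gaussian sample reproduces the limit statistic with parameter \<rho>.\<close>
  have s': "s\<^sup>2 = \<sigma>\<^sup>2 + (sqrt (v / p0))\<^sup>2 * \<rho>\<^sup>2"
    using v R0 R by (simp add: s(2) \<rho>)
  have pos: "\<rho> > 0" "sqrt (v / p0) > 0" using v R0 R by (simp_all add: \<rho>)
  let ?q = "q_O B \<rho> (1 - \<alpha> / 2)"
  let ?p = "\<lambda>n. \<P>(w in nested_law P run n B (R0 n) (R n). \<psi> P \<in> I_O B (R0 n) (R n) ?q w)"
  show ?thesis
    unfolding le_Liminf_iff
  proof (intro allI impI)
    fix y assume y: "y < ereal (1 - \<alpha>)"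
    \<comment> \<open>The slack below 1 - \<alpha> is halved: one half pays for softening the
      indicator, the other for the Gaussian approximation. With \<beta> = 1 - \<alpha> / 2 the
      Gaussian level 2 \<beta> - 1 is 1 - \<alpha>.\<close>
    obtain e where e: "e > 0" "y < ereal (1 - \<alpha> - e)"
    proof -
      obtain z where "y < ereal z" "ereal z < ereal (1 - \<alpha>)" using ereal_dense2[OF y] by blast
      then show thesis using that[of "1 - \<alpha> - z"] by simp
    qed
    have "0 < e / 2" using e by simp
    from soft_cover_limit[OF B pos(1) _ _ \<sigma> pos(2) s(1) s' this, of "1 - \<alpha> / 2"] \<alpha>
    obtain k where k: "k \<ge> 0" "1 - \<alpha> - e / 2 <
      (\<integral>a. \<integral>x. \<integral>d. soft_cover k ?q B a x d \<partial>(\<Pi>\<^sub>M b\<in>{..<B}. scaled_normal s) \<partial>scaled_normal (sqrt (v / p0)) \<partial>scaled_normal \<sigma>)"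
      by auto
    from coverage_eventually_ge[OF \<sigma> clt bootstrap_clt v \<kappa> var_empirical abs3_empirical var_resample abs3_resample
        R0(1,2,4) R(1,2,4) k(1) \<open>0 < e / 2\<close> s, where q="?q" and B=B]
    show "\<forall>\<^sub>F n in sequentially. y < ereal (?p n)"
    proof eventually_elim
      case (elim n)
      then have "1 - \<alpha> - e \<le> ?p n" using k(2) by linarith
      then show ?case using e(2) by (meson ereal_less_eq(3) less_le_trans)
    qed
  qed
qed

end
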